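(* Let $S=c^{\lambda}$ and $T=d^{\mu}$ be primary types of the same dimension (that is, $c|\lambda|=d|\mu|$), and let $\mathbf{F}_q$ be a finite field. Let $h$ be the highest common factor of $c$ and $d$, and let $\ell$ be the least common multiple of $c$ and $d$. Then $S$ and $T$ commute over $\mathbf{F}_q$ if and only if $\lambda$ is $\frac{d}{h}$-divisible, $\mu$ is $\frac{c}{h}$-divisible, and the nilpotent classes $N(\frac{h}{d}\lambda)$ and $N(\frac{h}{c}\mu)$ commute over $\mathbf{F}_{q^{\ell}}$.
   Context: A partition is a weakly decreasing finite sequence of positive integers, whose terms are its parts; the sum of the parts of $\lambda$ is $|\lambda|$. For partitions $\mu$ and $\nu$, $\mu+\nu$ denotes the partition whose multiset of parts is the union (with multiplicities added) of the multisets of parts of $\mu$ and of $\nu$; for a positive integer $t$, $t\lambda$ denotes $\lambda+\cdots+\lambda$ ($t$ times), so each part's multiplicity is multiplied by $t$. A partition is $t$-divisible if it equals $t\nu$ for some partition $\nu$. If $s\lambda=t\mu$ we write $\mu=\frac{s}{t}\lambda$; thus when $\lambda$ is $\frac{d}{h}$-divisible, $\frac{h}{d}\lambda$ is the partition $\nu$ with $\frac{d}{h}\nu=\lambda$. Let $K$ be a field. A matrix $M\in\mathrm{Mat}_n(K)$ has primary class type $d^{\lambda}$ if there is a monic irreducible polynomial $f\in K[x]$ of degree $d$ such that the $K[x]$-module $K^n$ (with $x$ acting as $M$) is isomorphic to $\bigoplus_j K[x]/(f^{\lambda(j)})$, where $\lambda(j)$ is the $j$-th part of $\lambda$. The dimension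 of the type $d^\lambda$ is $d|\lambda|$. Types $S$ and $T$ commute over $K$ if there are commuting matrices $X$ and $Y$ over $K$ of class types $S$ and $T$ respectively. For a partition $\nu$, $N(\nu)$ denotes the similarity class of nilpotent matrices whose Jordan block sizes are the parts of $\nu$. Two similarity classes commute over $K$ if they contain commuting representatives with entries in $K$. *)

theory Defs
  imports
    "Jordan_Normal_Form.Jordan_Normal_Form_Existence"
    "HOL-Algebra.QuotRing"
    "HOL-Library.Cardinality"
begin

section \<open>Partitions\<close>

definition is_partition :: "nat list \<Rightarrow> bool" where
  "is_partition \<nu> \<longleftrightarrow> sorted_wrt (\<ge>) \<nu> \<and> (\<forall>k\<in>set \<nu>. 0 < k)"

definition partition_add :: "nat list \<Rightarrow> nat list \<Rightarrow> nat list" where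
  "partition_add \<mu> \<nu> = rev (sorted_list_of_multiset (mset \<mu> + mset \<nu>))"

definition partition_times :: "nat \<Rightarrow> nat list \<Rightarrow> nat list" where
  "partition_times t \<nu> = ((partition_add \<nu>) ^^ t) []"

definition partition_divisible :: "nat \<Rightarrow> nat list \<Rightarrow> bool" where
  "partition_divisible t \<mu> \<longleftrightarrow> (\<exists>\<nu>. is_partition \<nu> \<and> \<mu> = partition_times t \<nu>)"

text \<open>\<open>partition_frac s t \<nu>\<close> is \<open>(s/t) \<nu>\<close>; it is only meaningful if \<open>t > 0\<close> and
  \<open>partition_times s \<nu>\<close> is \<open>t\<close>-divisible, in which case it is the unique such partition.\<close>

definition partition_frac :: "nat \<Rightarrow> nat \<Rightarrow> nat list \<Rightarrow> nat list" where
  "partition_frac s t \<nu> =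
     (THE \<rho>. is_partition \<rho> \<and> partition_times s \<nu> = partition_times t \<rho>)"


section \<open>Modules\<close>

text \<open>The record of modules extends that of rings; in the module constructions below the fields
  \<open>mult\<close> and \<open>one\<close> carry no information.\<close>

definition quotient_module :: "('r, 'm) ring_scheme \<Rightarrow> 'r set \<Rightarrow> ('r, 'r set) module" where
  "quotient_module R I =
     \<lparr>carrier = carrier (R Quot I),
      mult = mult (R Quot I), one = one (R Quot I),
      zero = zero (R Quot I), add = add (R Quot I),
      smult = (\<lambda>r C. (I +>\<^bsub>R\<^esub> r) \<otimes>\<^bsub>R Quot I\<^esub> C)\<rparr>"

text \<open>For a finite index set this is the direct sum.\<close>

definition direct_sum_module :: "'i set \<Rightarrow> ('i \<Rightarrow> ('r, 'v) module) \<Rightarrow> ('r, 'i \<Rightarrow> 'v) module" where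
  "direct_sum_module J N =
     \<lparr>carrier = (\<Pi>\<^sub>E j\<in>J. carrier (N j)),
      mult = (\<lambda>x y. \<lambda>j\<in>J. x j \<otimes>\<^bsub>N j\<^esub> y j), one = (\<lambda>j\<in>J. \<one>\<^bsub>N j\<^esub>),
      zero = (\<lambda>j\<in>J. \<zero>\<^bsub>N j\<^esub>), add = (\<lambda>x y. \<lambda>j\<in>J. x j \<oplus>\<^bsub>N j\<^esub> y j),
      smult = (\<lambda>r x. \<lambda>j\<in>J. r \<odot>\<^bsub>N j\<^esub> x j)\<rparr>"

definition module_isomorphic ::
    "('r, 'm) ring_scheme \<Rightarrow> ('r, 'v) module \<Rightarrow> ('r, 'w) module \<Rightarrow> bool" where
  "module_isomorphic R V W \<longleftrightarrow> (\<exists>\<phi>\<in>module_hom R V W. bij_betw \<phi> (carrier V) (carrier W))"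

text \<open>The space of column vectors of length \<open>dim_row M\<close>, where a polynomial \<open>p\<close> acts as \<open>p(M)\<close>.\<close>

definition matrix_module :: "'a::field mat \<Rightarrow> ('a poly, 'a vec) module" where
  "matrix_module M = (let n = dim_row M in
     \<lparr>carrier = carrier_vec n,
      mult = undefined, one = undefined,
      zero = 0\<^sub>v n, add = (+),
      smult = (\<lambda>p v. finsum_vec TYPE('a) n (\<lambda>i. coeff p i \<cdot>\<^sub>v ((M ^\<^sub>m i) *\<^sub>v v)) {..degree p})\<rparr>)"


section \<open>Primary class types\<close>

text \<open>The pair \<open>(d, \<nu>)\<close> stands for the primary type of degree \<open>d\<close> and partition \<open>\<nu>\<close>.\<close>

type_synonym primary_type = "nat \<times> nat list"

fun type_dim :: "primary_type \<Rightarrow> nat" where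
  "type_dim (d, \<nu>) = d * sum_list \<nu>"

fun has_primary_type :: "'a::field mat \<Rightarrow> primary_type \<Rightarrow> bool" where
  "has_primary_type M (d, \<nu>) \<longleftrightarrow> square_mat M \<and>
     (\<exists>f :: 'a poly. monic f \<and> irreducible f \<and> degree f = d \<and>
        module_isomorphic (class_ring :: 'a poly ring) (matrix_module M)
          (direct_sum_module {..<length \<nu>}
            (\<lambda>j. quotient_module class_ring (PIdl\<^bsub>class_ring\<^esub> (f ^ (\<nu> ! j))))))"

text \<open>Multiplication of matrices is total, so matching dimensions have to be required explicitly.\<close>

definition commuting_mats :: "'a::field mat \<Rightarrow> 'a mat \<Rightarrow> bool" where
  "commuting_mats X Y \<longleftrightarrow>
     (\<exists>n. X \<in> carrier_mat n n \<and> Y \<in> carrier_mat n n \<and> X * Y = Y * X)"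

definition types_commute :: "'a::field itself \<Rightarrow> primary_type \<Rightarrow> primary_type \<Rightarrow> bool" where
  "types_commute _ S T \<longleftrightarrow>
     (\<exists>X Y :: 'a mat. has_primary_type X S \<and> has_primary_type Y T \<and> commuting_mats X Y)"


section \<open>Nilpotent similarity classes\<close>

definition nilpotent_class :: "nat list \<Rightarrow> 'a::field mat set" where
  "nilpotent_class \<nu> = {M. jordan_nf M (map (\<lambda>k. (k, 0)) \<nu>)}"

definition classes_commute :: "'a::field mat set \<Rightarrow> 'a mat set \<Rightarrow> bool" where
  "classes_commute C D \<longleftrightarrow> (\<exists>X\<in>C. \<exists>Y\<in>D. commuting_mats X Y)"

end

theory Submission
  imports Defs "HOL-Algebra.Exponent" "HOL-Algebra.Multiplicative_Group"
    "HOL-Combinatorics.List_Permutation" "HOL-Library.Function_Algebras" "HOL-Number_Theory.Cong"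
begin

text \<open>The type of a matrix is determined by the cardinalities of the kernels of \<open>f\<^sup>r\<close>, so both
  directions compare such kernels, over \<open>K = F\<^sub>q\<close> and over \<open>L = F\<^sub>q\<^sup>\<ell>\<close>.

  Let \<open>X\<close>, \<open>Y\<close> be commuting of types \<open>c\<^sup>\<lambda>\<close>, \<open>d\<^sup>\<mu>\<close>, with associated polynomials \<open>f\<close>, \<open>g\<close>. Over \<open>L\<close> these split
  into linear factors, and \<open>L\<^sup>n\<close> is the direct sum of \<open>\<ell>\<close> spaces \<open>P\<^sub>t\<close> permuted cyclically
  by Frobenius, each of them a sum of joint generalised eigenspaces. The trace identifies \<open>P\<^sub>0\<close> with
  \<open>K\<^sup>n\<close> as a module over \<open>K[X, Y]\<close>. On the \<open>L\<close>-space \<open>P\<^sub>0\<close> the operators \<open>f(X)\<close> and \<open>g(Y)\<close> are commuting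
  nilpotents, and since \<open>L\<close> has degree \<open>\<ell> = c (d/h) = d (c/h)\<close> over \<open>K\<close>, kernel sizes give their
  Jordan types \<open>\<nu>\<^sub>1\<close>, \<open>\<nu>\<^sub>2\<close> with \<open>\<lambda> = (d/h) \<nu>\<^sub>1\<close> and \<open>\<mu> = (c/h) \<nu>\<^sub>2\<close>.

  Conversely, if \<open>N\<^sub>1\<close>, \<open>N\<^sub>2\<close> are commuting nilpotents over \<open>L\<close> and \<open>\<alpha>\<close>, \<open>\<beta>\<close> in \<open>L\<close> have degrees \<open>c\<close>, \<open>d\<close> over \<open>K\<close>,
  then \<open>\<alpha> + N\<^sub>1\<close> and \<open>\<beta> + N\<^sub>2\<close>, regarded as operators over \<open>K\<close>, commute and have the required types.\<close>

hide_const (open) UnivPoly.up_ring.monom UnivPoly.up_ring.coeff Module.module.smult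

section \<open>Partitions\<close>

text \<open>The \<open>c d\<close> pairs of roots form \<open>h\<close> Frobenius orbits of length
  \<open>\<ell>\<close>, and a single joint eigenspace sees only the part of
  \<open>K\<^sup>n\<close> that belongs to its own orbit. Hence each \<open>P\<^sub>t\<close>
  collects \<open>h\<close> eigenspaces, one from every orbit; then its conjugates exhaust
  \<open>L\<^sup>n\<close> and the trace loses nothing. This is also why \<open>f(X)\<close> and
  \<open>g(Y)\<close> are used on \<open>P\<^sub>0\<close> in place of \<open>X - \<alpha>\<close>
  and \<open>Y - \<beta>\<close>: \<open>Y\<close> may have up to \<open>h\<close> eigenvalues
  there, so no shift by a scalar need make it nilpotent, whereas \<open>f\<close> and
  \<open>g\<close> have coefficients in \<open>K\<close>, so that the trace carries their kernels on
  \<open>P\<^sub>0\<close> to kernels in \<open>K\<^sup>n\<close>. In the converse,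
  \<open>f(\<alpha> + N\<^sub>1)\<close> is \<open>N\<^sub>1\<close> times an invertible operator,
  since the other roots of \<open>f\<close> differ from \<open>\<alpha>\<close>; so powers of the
  two have the same kernels. Counting elements, instead of computing dimensions, lets one and the
  same kernel be measured over \<open>K\<close> and over \<open>L\<close> without carrying bases
  from one field to the other.\<close>

lemma mset_partition_times: "mset (partition_times t \<nu>) = repeat_mset t (mset \<nu>)"
  unfolding partition_times_def
  by (induction t) (simp_all add: partition_add_def)

lemma is_partition_add: "is_partition \<mu> \<Longrightarrow> is_partition \<nu> \<Longrightarrow> is_partition (partition_add \<mu> \<nu>)"
proof -
  assume a: "is_partition \<mu>" "is_partition \<nu>"
  have "set (partition_add \<mu> \<nu>) = set \<mu> \<union> set \<nu>"
    by (simp add: partition_add_def)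
  moreover have "sorted_wrt (\<ge>) (partition_add \<mu> \<nu>)"
    by (simp add: partition_add_def sorted_wrt_rev)
  ultimately show ?thesis using a by (auto simp: is_partition_def)
qed

lemma is_partition_times: "is_partition \<nu> \<Longrightarrow> is_partition (partition_times t \<nu>)"
  by (induction t) (simp_all add: partition_times_def is_partition_add is_partition_def[of "[]"])

lemma is_partition_mset_eqD:
  assumes "is_partition \<mu>" "is_partition \<nu>" "mset \<mu> = mset \<nu>"
  shows "\<mu> = \<nu>"
proof -
  have "sorted (rev \<mu>)" "sorted (rev \<nu>)"
    using assms by (auto simp: is_partition_def sorted_wrt_rev)
  moreover have "mset (rev \<mu>) = mset (rev \<nu>)" using assms by simp
  ultimately have "rev \<mu> = rev \<nu>" by (metis properties_for_sort)
  thus ?thesis by simp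
qed

text \<open>Evaluates the definite description: the witness works because
  \<open>h * (d div h) = d\<close>, and it is unique because multiplicities can be divided by
  \<open>d > 0\<close>.\<close>

lemma partition_frac_times:
  assumes "is_partition \<nu>" "0 < h" "h dvd d" "0 < d"
  shows "partition_frac h d (partition_times (d div h) \<nu>) = \<nu>"
  unfolding partition_frac_def
proof (rule the_equality)
  have "mset (partition_times h (partition_times (d div h) \<nu>)) = mset (partition_times d \<nu>)"
    using assms by (simp add: mset_partition_times)
  thus "is_partition \<nu> \<and> partition_times h (partition_times (d div h) \<nu>) = partition_times d \<nu>"
    using assms is_partition_mset_eqD is_partition_times by blast
next
  fix \<rho> assume r: "is_partition \<rho> \<and> partition_times h (partition_times (d div h) \<nu>) = partition_times d \<rho>"
  hence "mset (partition_times h (partition_times (d div h) \<nu>)) = mset (partition_times d \<rho>)" by simp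
  hence "repeat_mset d (mset \<nu>) = repeat_mset d (mset \<rho>)"
    using assms by (simp add: mset_partition_times)
  hence "mset \<nu> = mset \<rho>" using assms by (simp add: repeat_mset_cancel1)
  thus "\<rho> = \<nu>" using r assms is_partition_mset_eqD by metis
qed

text \<open>If \<open>M\<close> is the multiset of Jordan block sizes of a nilpotent matrix, \<open>conj_sum M r\<close> is the nullity of
  its \<open>r\<close>-th power.\<close>

definition conj_sum :: "nat multiset \<Rightarrow> nat \<Rightarrow> nat" where
  "conj_sum M r = (\<Sum>k\<in>#M. min r k)"

lemma conj_sum_simps [simp]:
  "conj_sum {#} r = 0" "conj_sum (add_mset k M) r = min r k + conj_sum M r"
  "conj_sum (M + N) r = conj_sum M r + conj_sum N r"
  by (simp_all add: conj_sum_def)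

lemma conj_sum_repeat: "conj_sum (repeat_mset t M) r = t * conj_sum M r"
  by (induction t) simp_all

text \<open>As a function of \<open>r\<close>, \<open>min r k\<close> is linear except for a kink at
  \<open>r = k\<close>, so the second difference around \<open>Suc r\<close> counts the parts equal
  to \<open>Suc r\<close>. The additive form avoids subtraction of natural numbers.\<close>

lemma conj_sum_second_difference:
  "conj_sum M r + conj_sum M (Suc (Suc r)) + count M (Suc r) = 2 * conj_sum M (Suc r)"
proof (induction M)
  case (add k M)
  have "min r k + min (Suc (Suc r)) k + (if k = Suc r then 1 else 0) = 2 * min (Suc r) k"
    by (auto simp: min_def)
  thus ?case using add.IH by (cases "k = Suc r") simp_all
qed simp

lemma conj_sum_eventually: "(\<And>k. k \<in># M \<Longrightarrow> k \<le> r) \<Longrightarrow> conj_sum M r = sum_mset M"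
  by (induction M) (simp_all add: min_absorb2)

text \<open>Second differences recover all positive multiplicities. Parts equal to 0 leave no trace
  in \<open>conj_sum\<close> and therefore have to be excluded.\<close>

lemma conj_sum_eq_imp:
  assumes "\<And>r. a * conj_sum M r = b * conj_sum N r" "0 \<notin># M" "0 \<notin># N"
  shows "repeat_mset a M = repeat_mset b N"
proof (rule multiset_eqI)
  fix k
  show "count (repeat_mset a M) k = count (repeat_mset b N) k"
  proof (cases k)
    case 0
    thus ?thesis using assms(2,3) by (simp add: not_in_iff)
  next
    case (Suc r)
    have "a * (2 * conj_sum M (Suc r)) = b * (2 * conj_sum N (Suc r))"
      using assms(1)[of "Suc r"] by simp
    hence "a * count M (Suc r) = b * count N (Suc r)"
      using assms(1)[of r] assms(1)[of "Suc (Suc r)"]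
      by (simp flip: conj_sum_second_difference add: algebra_simps)
    thus ?thesis using Suc by simp
  qed
qed

section \<open>Finite fields\<close>

text \<open>With \<open>q\<close> elements and characteristic \<open>p\<close>, the polynomials
  \<open>(x + 1)^q\<close> and \<open>x^q + 1\<close> agree at all \<open>q\<close> points and
  differ in degree below \<open>q\<close> only, so they are equal and \<open>p\<close> divides every
  middle binomial coefficient of \<open>q\<close>. But \<open>q choose p^a\<close>, for
  \<open>p^a\<close> the exact power of \<open>p\<close> in \<open>q\<close>, is prime to
  \<open>p\<close>; hence \<open>p^a\<close> is not a middle index and
  \<open>q = p^a\<close>.\<close>

lemma CARD_finite_field_eq_CHAR_power:
  "\<exists>e. CARD('a::finite_field) = CHAR('a) ^ e"
proof -
  let ?q = "CARD('a)" and ?p = "CHAR('a)"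
  have p: "prime ?p" by simp
  have q0: "?q > 0" by (simp add: finite_UNIV_card_ge_0)
  define s where "s = ([:1, 1:] :: 'a poly) ^ ?q - (monom 1 ?q + 1)"
  have "degree (([:1, 1:] :: 'a poly) ^ ?q) = ?q" by (simp add: degree_power_eq)
  moreover have "lead_coeff (([:1, 1:] :: 'a poly) ^ ?q) = 1" by (simp add: lead_coeff_power)
  ultimately have "coeff s n = 0" if "n \<ge> ?q" for n
  proof (cases "n = ?q")
    case True
    with \<open>degree _ = ?q\<close> \<open>lead_coeff _ = 1\<close> q0 show ?thesis by (simp add: s_def)
  next
    case False
    with that have n: "n > ?q" by simp
    hence "coeff (([:1, 1:] :: 'a poly) ^ ?q) n = 0"
      using \<open>degree _ = ?q\<close> by (intro coeff_eq_0) simp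
    thus ?thesis using n by (simp add: s_def)
  qed
  hence deg: "s = 0 \<or> degree s < ?q"
    by (metis leading_coeff_0_iff linorder_not_le)
  have root: "poly s x = 0" for x
    by (simp add: s_def poly_monom finite_field_power_card_eq_same add.commute)
  have s0: "s = 0"
  proof (rule ccontr)
    assume "s \<noteq> 0"
    hence "card {x. poly s x = 0} \<le> degree s" by (rule poly_roots_degree)
    thus False using root deg \<open>s \<noteq> 0\<close> by simp
  qed
  have choose0: "?p dvd (?q choose k)" if "0 < k" "k < ?q" for k
  proof -
    have "coeff (([:1, 1:] :: 'a poly) ^ ?q) k = of_nat (?q choose k)"
    proof -
      have "coeff (([:1, 1:] :: 'a poly) ^ ?q) k = coeff ((1 + monom 1 1) ^ ?q) k"
        by (simp add: monom_altdef one_pCons)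
      also have "(1 + monom 1 1 :: 'a poly) ^ ?q = (\<Sum>i\<le>?q. of_nat (?q choose i) * monom 1 1 ^ i)"
        by (subst add.commute, subst binomial_ring) simp
      also have "coeff \<dots> k = (\<Sum>i\<le>?q. if i = k then of_nat (?q choose k) else 0)"
        unfolding coeff_sum by (intro sum.cong refl) (auto simp: monom_power of_nat_monom mult_monom)
      finally show ?thesis using that by simp
    qed
    moreover have "coeff s k = 0" using s0 by simp
    ultimately have "of_nat (?q choose k) = (0::'a)"
      using that by (simp add: s_def)
    thus ?thesis by (simp add: of_nat_eq_0_iff_char_dvd)
  qed
  define a where "a = multiplicity ?p ?q"
  obtain m where m: "?q = ?p ^ a * m" "\<not> ?p dvd m"
    using multiplicity_decompose'[of ?q ?p] q0 p unfolding a_def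
    by (metis not_prime_unit not_gr_zero)
  have m0: "m > 0" using m q0 by (cases m) auto
  have "multiplicity ?p (?p ^ a * m choose ?p ^ a) = multiplicity ?p m"
    by (rule const_p_fac[OF m0 p])
  also have "\<dots> = 0" using m by (simp add: not_dvd_imp_multiplicity_0)
  finally have "\<not> ?p dvd (?q choose (?p ^ a))"
    using m p m0 by (metis not_prime_unit multiplicity_eq_zero_iff binomial_eq_0_iff dvd_triv_left
      leD nat_dvd_not_less q0 prime_gt_0_nat linorder_not_le zero_less_power
      dvd_imp_le neq0_conv prime_multiplicity_gt_zero_iff prime_elem_multiplicity_eq_zero_iff prime_imp_prime_elem)
  hence "\<not> ?p ^ a < ?q" using choose0[of "?p ^ a"] p prime_gt_0_nat by auto
  moreover have "?p ^ a dvd ?q" using m by simp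
  ultimately have "?q = ?p ^ a" using q0 dvd_imp_le by (metis le_neq_implies_less)
  thus ?thesis by blast
qed

section \<open>Frobenius powers, primitive elements and the roots of \<open>x^q - x\<close>\<close>

lemma CARD_field_gt_1: "CARD('a::finite_field) > 1"
proof -
  have "card {0, 1 :: 'a} \<le> CARD('a)" by (rule card_mono) auto
  thus ?thesis by simp
qed

lemma CHAR_eq_if_CARD_power:
  assumes "CARD('b::finite_field) = CARD('a::finite_field) ^ l"
  shows "CHAR('b) = CHAR('a)"
proof -
  obtain e where e: "CARD('b) = CHAR('b) ^ e" using CARD_finite_field_eq_CHAR_power by blast
  obtain e' where e': "CARD('a) = CHAR('a) ^ e'" using CARD_finite_field_eq_CHAR_power by blast
  have "e > 0" using e CARD_field_gt_1[where 'a='b] by (cases e) auto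
  hence "CHAR('b) dvd CHAR('a) ^ (e' * l)" using e e' assms by (simp add: power_mult flip: e)
      (metis dvd_power e)
  hence "CHAR('b) dvd CHAR('a)" using prime_dvd_power CHAR_prime by blast
  thus ?thesis using CHAR_prime primes_dvd_imp_eq by blast
qed

lemma finite_field_power_card_add:
  fixes x y :: "'b::finite_field"
  assumes "CARD('b) = CARD('a::finite_field) ^ l"
  shows "(x + y) ^ (CARD('a) ^ i) = x ^ (CARD('a) ^ i) + y ^ (CARD('a) ^ i)"
proof -
  obtain e where e: "CARD('a) = CHAR('a) ^ e" using CARD_finite_field_eq_CHAR_power by blast
  show ?thesis
    by (rule freshmans_dream'[where n = "e * i"])
      (simp_all add: e power_mult CHAR_eq_if_CARD_power[OF assms])
qed

text \<open>With such a \<open>g\<close>, evaluation of integer polynomials at \<open>g\<close> is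
  surjective, which presents the field as a quotient of \<open>\<int>[x]\<close>.\<close>

lemma finite_field_primitive_element:
  "\<exists>g :: 'a::finite_field. \<forall>x. x \<noteq> 0 \<longrightarrow> (\<exists>i::nat. x = g ^ i)"
proof -
  have pow: "x [^]\<^bsub>class_ring\<^esub> i = x ^ i" for x :: 'a and i :: nat
    by (simp add: class_ring_simps)
  have fin: "finite (carrier (class_ring :: 'a ring))" by simp
  obtain g where "carrier (mult_of (class_ring :: 'a ring)) = {g [^]\<^bsub>class_ring\<^esub> i | i::nat. i \<in> UNIV}"
    using field.finite_field_mult_group_has_gen[OF class_field fin] by blast
  thus ?thesis by (auto simp: set_eq_iff pow)
qed

text \<open>If \<open>x^Q - x = P W\<close> over the field with \<open>Q\<close> elements, every
  element is a root of \<open>P\<close> or of \<open>W\<close>. As the degrees add up to at most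
  \<open>Q\<close>, both bounds on the number of roots are attained.\<close>

lemma card_roots_dvd:
  fixes P :: "'b::finite_field poly"
  assumes "P dvd monom 1 (CARD('b)) - monom 1 1"
  shows "card {z. poly P z = 0} = degree P"
proof -
  let ?F = "monom 1 (CARD('b)) - monom 1 1 :: 'b poly"
  obtain W where W: "?F = P * W" using assms by blast
  have Q: "CARD('b) > 1" by (rule CARD_field_gt_1)
  have "coeff ?F (CARD('b)) = 1" using Q by simp
  hence F0: "?F \<noteq> 0" by (metis coeff_0 zero_neq_one)
  hence n0: "P \<noteq> 0" "W \<noteq> 0" using W by auto
  have "degree ?F \<le> CARD('b)"
    using Q by (intro degree_diff_le) (auto intro: order.trans[OF degree_monom_le])
  hence deg: "degree P + degree W \<le> CARD('b)"
    using n0 W by (simp add: degree_mult_eq)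
  have "poly ?F z = 0" for z by (simp add: poly_monom finite_field_power_card_eq_same)
  hence "UNIV = {z. poly P z = 0} \<union> {z. poly W z = 0}" using W
    by (metis (mono_tags, lifting) UNIV_eq_I UnI1 UnI2 mem_Collect_eq mult_eq_0_iff poly_mult)
  hence "CARD('b) \<le> card {z. poly P z = 0} + card {z. poly W z = 0}"
    by (metis card_Un_le)
  thus ?thesis using poly_roots_degree[OF n0(1)] poly_roots_degree[OF n0(2)] deg by linarith
qed

text \<open>The number \<open>r - 1\<close> divides \<open>r^k - 1\<close>; therefore
  \<open>x^(r - 1) - 1\<close> divides \<open>x^(r^k - 1) - 1\<close> by a geometric sum.\<close>

lemma monom_power_card_diff_dvd:
  fixes r k :: nat
  assumes "r > 0" "k > 0"
  shows "(monom 1 r - monom 1 1 :: 'b::comm_ring_1 poly) dvd monom 1 (r ^ k) - monom 1 1"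
proof -
  have "\<exists>m. r ^ k = 1 + (r - 1) * m" if "r > 0" for k
  proof (induction k)
    case (Suc k)
    then obtain m where "r ^ k = 1 + (r - 1) * m" by blast
    hence "r ^ Suc k = 1 + (r - 1) * (1 + r * m)"
      using that by (cases r) (auto simp: algebra_simps)
    thus ?case by blast
  qed auto
  then obtain m where m: "r ^ k = 1 + (r - 1) * m" using assms by blast
  let ?x = "monom 1 1 :: 'b poly"
  have "monom 1 (r ^ k) - monom 1 1 = ?x * ((?x ^ (r - 1)) ^ m - 1)"
    by (simp add: m monom_power mult_monom right_diff_distrib flip: power_mult)
  also have "(?x ^ (r - 1)) ^ m - 1 = (?x ^ (r - 1) - 1) * (\<Sum>i<m. (?x ^ (r - 1)) ^ i)"
    by (rule power_diff_1_eq)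
  finally have "monom 1 (r ^ k) - monom 1 1 = (?x * (?x ^ (r - 1) - 1)) * (\<Sum>i<m. (?x ^ (r - 1)) ^ i)"
    by (simp only: mult.assoc)
  moreover have "?x * (?x ^ (r - 1) - 1) = monom 1 r - monom 1 1"
    using assms by (simp add: monom_power mult_monom right_diff_distrib)
  ultimately show ?thesis by simp
qed

lemma degree_monom_diff:
  assumes "r > 1"
  shows "degree (monom 1 r - monom 1 1 :: 'b::comm_ring_1 poly) = r"
    "monic (monom 1 r - monom 1 1 :: 'b::comm_ring_1 poly)"
proof -
  have "degree (monom 1 r - monom 1 1 :: 'b poly) \<le> r"
    using assms by (intro degree_diff_le) (auto intro: order.trans[OF degree_monom_le])
  moreover have "coeff (monom 1 r - monom 1 1 :: 'b poly) r = 1" using assms by simp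
  ultimately show "degree (monom 1 r - monom 1 1 :: 'b poly) = r"
    by (metis le_degree antisym zero_neq_one)
  thus "monic (monom 1 r - monom 1 1 :: 'b poly)" using assms by simp
qed

lemma card_fixed_power:
  assumes "CARD('b::finite_field) = r ^ k" "k > 0" "r > 1"
  shows "card {z :: 'b. z ^ r = z} = r"
proof -
  let ?P = "monom 1 r - monom 1 1 :: 'b poly"
  have "card {z. poly ?P z = 0} = degree ?P"
    by (rule card_roots_dvd) (use assms monom_power_card_diff_dvd[of r k] in simp)
  also have "degree ?P = r" using assms degree_monom_diff(1)[of r] by simp
  finally show ?thesis by (simp add: poly_monom)
qed

text \<open>The kernel of evaluation at \<open>g\<close> is the ideal generated by the
  characteristic \<open>p\<close> and a monic \<open>m\<close> of least degree in it. This is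
  division with remainder, with one more case: a leading coefficient divisible by \<open>p\<close>
  is removed by a multiple of \<open>p\<close>. Integer coefficients stand in for those in the prime
  field.\<close>

lemma int_poly_kernel_generator:
  fixes g :: "'a::finite_field"
  assumes ev: "\<And>P. ev P = poly (map_poly of_int P) g"
  obtains m where "monic m" "ev m = 0"
    "\<And>P. ev P = 0 \<Longrightarrow> \<exists>S T. P = m * S + Polynomial.smult (of_nat CHAR('a)) T"
proof -
  let ?p = "int CHAR('a)"
  let ?C = "\<lambda>n. \<exists>m. monic m \<and> ev m = 0 \<and> degree m = n"
  have ev_simps: "ev (P + R) = ev P + ev R" "ev (P - R) = ev P - ev R"
    "ev (P * R) = ev P * ev R" "ev (Polynomial.smult c P) = of_int c * ev P"
    "ev (monom c n) = of_int c * g ^ n" for P R c n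
    by (simp_all add: ev of_int_poly_hom.hom_minus hom_distribs map_poly_monom poly_monom)
  have "?C (CARD('a))"
  proof (intro exI conjI)
    let ?m = "monom 1 (CARD('a)) - monom 1 1 :: int poly"
    show "degree ?m = CARD('a)" "monic ?m"
      using CARD_field_gt_1[where 'a='a] by (rule degree_monom_diff)+
    show "ev ?m = 0" by (simp add: ev_simps finite_field_power_card_eq_same)
  qed
  hence "?C (LEAST n. ?C n)" by (rule LeastI)
  then obtain m where m: "monic m" "ev m = 0" "degree m = (LEAST n. ?C n)" by blast
  have least: "degree m \<le> degree P" if "monic P" "ev P = 0" for P
    unfolding m(3) using that by (intro Least_le) blast
  have p0: "of_int ?p = (0::'a)" by simp
  have "\<exists>S T. P = m * S + Polynomial.smult ?p T" if "ev P = 0" for P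
    using that
  \<comment> \<open>The measure separates the zero polynomial from the nonzero constants, which have
    the same \<open>degree\<close>.\<close>
  proof (induction "if P = 0 then 0 else Suc (degree P)" arbitrary: P rule: less_induct)
    case less
    show ?case
    proof (cases "P = 0")
      case True
      thus ?thesis by (intro exI[of _ 0]) simp
    next
      case False
      let ?a = "lead_coeff P" and ?n = "degree P"
      have smaller: "(if P - R = 0 then 0 else Suc (degree (P - R))) < (if P = 0 then 0 else Suc (degree P))"
        if "degree R \<le> ?n" "coeff R ?n = ?a" for R
      proof (cases "P - R = 0")
        case nz: False
        have "degree (P - R) \<le> ?n" using that by (intro degree_diff_le) auto
        moreover have "coeff (P - R) ?n = 0" using that by simp
        ultimately have "degree (P - R) < ?n"
          using nz by (metis leading_coeff_0_iff le_neq_implies_less)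
        thus ?thesis using False nz by simp
      qed (use False in simp)
      consider (p) "?p dvd ?a" | (m) "degree m \<le> ?n" | (bad) "\<not> ?p dvd ?a" "?n < degree m" by linarith
      thus ?thesis
      proof cases
        case p
        then obtain b where b: "?a = ?p * b" by blast
        have "ev (P - monom ?a ?n) = 0" using less.prems b p0 by (simp add: ev_simps)
        from less.hyps[OF smaller this] obtain S T where "P - monom ?a ?n = m * S + Polynomial.smult ?p T"
          by (auto simp: degree_monom_le)
        moreover have "monom ?a ?n = Polynomial.smult ?p (monom b ?n)" by (simp only: smult_monom b)
        ultimately have "P = m * S + Polynomial.smult ?p (T + monom b ?n)"
          by (simp only: smult_add_right)
        thus ?thesis by blast
      next
        case m': m
        let ?R = "m * monom ?a (?n - degree m)"
        have "coeff ?R ?n = ?a" using m' m(1) by (simp add: coeff_monom_mult mult.commute[of m])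
        moreover have "degree ?R \<le> ?n"
          using m' degree_mult_le[of m "monom ?a (?n - degree m)"] degree_monom_le[of ?a "?n - degree m"]
          by linarith
        moreover have "ev (P - ?R) = 0" using less.prems m(2) by (simp add: ev_simps)
        ultimately obtain S T where "P - ?R = m * S + Polynomial.smult ?p T"
          using less.hyps[OF smaller] by blast
        hence "P = m * (S + monom ?a (?n - degree m)) + Polynomial.smult ?p T"
          by (simp add: algebra_simps)
        thus ?thesis by blast
      next
        case bad
        have "coprime ?a ?p"
          using bad(1) prime_imp_coprime[of ?p ?a] by (simp add: coprime_commute)
        moreover obtain u v where "u * ?a + v * ?p = gcd ?a ?p" using bezout_int by blast
        ultimately have "?a * u - 1 = ?p * (- v)" by (simp add: algebra_simps)
        then obtain w where w: "?a * u - 1 = ?p * w" by blast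
        \<comment> \<open>The leading coefficient of \<open>u P\<close> is 1 modulo
          \<open>p\<close>. Subtracting its excess \<open>p w\<close>, a term that evaluates to 0,
          leaves a monic element of the kernel of degree below that of \<open>m\<close>, contrary to
          minimality.\<close>
        define R where "R = Polynomial.smult u P - monom (?p * w) ?n"
        have c: "coeff R ?n = 1" using w by (simp add: R_def mult.commute)
        have "degree R \<le> ?n" unfolding R_def
          by (intro degree_diff_le) (auto intro: degree_smult_le degree_monom_le)
        hence "degree R = ?n" using c by (metis le_degree antisym zero_neq_one)
        moreover have "ev R = 0" using less.prems p0 by (simp add: R_def ev_simps)
        ultimately show ?thesis using least[of R] c bad(2) by simp
      qed
    qed
  qed
  thus ?thesis by (rule that[OF m(1,2)])
qed

text \<open>The smaller field is \<open>\<int>[x]/(p, m)\<close>; sending \<open>x\<close> to a root of \<open>m\<close> in the larger field embeds it.\<close>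

lemma finite_field_embedding:
  assumes card: "CARD('b::finite_field) = CARD('a::finite_field) ^ l"
  shows "\<exists>\<iota> :: 'a \<Rightarrow> 'b. field_hom \<iota>"
proof -
  let ?q = "CARD('a)"
  have q1: "?q > 1" by (rule CARD_field_gt_1)
  have l0: "l > 0" using card CARD_field_gt_1[where 'a='b] by (cases l) auto
  obtain g :: 'a where g: "\<And>x. x \<noteq> 0 \<Longrightarrow> \<exists>i::nat. x = g ^ i"
    using finite_field_primitive_element by blast
  define ev where "ev P = poly (map_poly of_int P) g" for P :: "int poly"
  obtain m where m: "monic m" "ev m = 0"
    and ker: "\<And>P. ev P = 0 \<Longrightarrow> \<exists>S T. P = m * S + Polynomial.smult (of_nat CHAR('a)) T"
    using int_poly_kernel_generator[OF ev_def] by blast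
  have ev_simps: "ev (P + R) = ev P + ev R" "ev (P - R) = ev P - ev R"
    "ev (P * R) = ev P * ev R" "ev 1 = 1" "ev (monom c n) = of_int c * g ^ n" for P R c n
    by (simp_all add: ev_def of_int_poly_hom.hom_minus hom_distribs map_poly_monom poly_monom)
  \<comment> \<open>Since \<open>x^q - x\<close> lies in the kernel, \<open>m\<close> divides it
    modulo \<open>p\<close>. So the image \<open>M\<close> of \<open>m\<close> over the larger field
    divides \<open>x^q - x\<close>, hence also the polynomial that vanishes on the whole field, and
    must have a root there.\<close>
  have "ev (monom 1 ?q - monom 1 1) = 0"
    by (simp add: ev_simps finite_field_power_card_eq_same)
  from ker[OF this] obtain S T where ST: "monom 1 ?q - monom 1 1 = m * S + Polynomial.smult (of_nat CHAR('a)) T"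
    by blast
  have p0: "of_nat CHAR('a) = (0::'b)"
    using CHAR_eq_if_CARD_power[OF card] by (metis of_nat_CHAR)
  define M where "M = (map_poly of_int m :: 'b poly)"
  have "map_poly of_int (monom 1 ?q - monom 1 1 :: int poly) = (monom 1 ?q - monom 1 1 :: 'b poly)"
    by (simp add: of_int_poly_hom.hom_minus map_poly_monom)
  hence "(monom 1 ?q - monom 1 1 :: 'b poly) = M * map_poly of_int S"
    unfolding ST M_def using p0 by (simp add: hom_distribs)
  hence "M dvd (monom 1 ?q - monom 1 1 :: 'b poly)" by simp
  also have "\<dots> dvd monom 1 (CARD('b)) - monom 1 1"
    unfolding card by (rule monom_power_card_diff_dvd) (use q1 l0 in auto)
  finally have "card {z. poly M z = 0} = degree M" by (rule card_roots_dvd)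
  moreover have "degree M > 0"
  proof -
    have "degree m > 0"
    proof (rule ccontr)
      assume "\<not> degree m > 0"
      hence "m = 1" using m(1) by (metis monic_degree_0 not_gr_zero)
      thus False using m(2) by (simp add: ev_simps)
    qed
    moreover have "degree M = degree m" unfolding M_def
      by (rule degree_map_poly) (use m in auto)
    ultimately show ?thesis by simp
  qed
  ultimately obtain b where b: "poly M b = 0" by (metis (mono_tags) card.empty empty_Collect_eq less_irrefl)
  define ev' where "ev' P = poly (map_poly of_int P) b" for P :: "int poly"
  have ev'_simps: "ev' (P + R) = ev' P + ev' R" "ev' (P - R) = ev' P - ev' R"
    "ev' (P * R) = ev' P * ev' R" "ev' 1 = 1" "ev' 0 = 0" "ev' (Polynomial.smult c P) = of_int c * ev' P" for P R c
    by (simp_all add: ev'_def of_int_poly_hom.hom_minus hom_distribs)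
  \<comment> \<open>The two generators of the kernel of \<open>ev\<close> vanish under
    \<open>ev'\<close> as well, so the value at \<open>b\<close> depends on the value at
    \<open>g\<close> only.\<close>
  have well: "ev' P = ev' R" if "ev P = ev R" for P R
  proof -
    have "ev (P - R) = 0" using that by (simp add: ev_simps)
    then obtain S T where "P - R = m * S + Polynomial.smult (of_nat CHAR('a)) T" using ker by blast
    hence "ev' (P - R) = 0" using b p0 by (simp add: ev'_simps M_def[symmetric] ev'_def[of m])
    thus ?thesis by (simp add: ev'_simps)
  qed
  have surj: "\<exists>P. ev P = x" for x
  proof (cases "x = 0")
    case True
    thus ?thesis by (intro exI[of _ 0]) (simp add: ev_def)
  next
    case False
    then obtain i where "x = g ^ i" using g by blast
    thus ?thesis by (intro exI[of _ "monom 1 i"]) (simp add: ev_simps)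
  qed
  define \<iota> where "\<iota> x = ev' (SOME P. ev P = x)" for x
  have \<iota>: "\<iota> (ev P) = ev' P" for P
    unfolding \<iota>_def by (rule well, rule someI_ex) (rule surj)
  have "field_hom \<iota>"
  proof
    fix x y
    obtain P R where PR: "ev P = x" "ev R = y" using surj by meson
    show "\<iota> (x + y) = \<iota> x + \<iota> y" "\<iota> (x * y) = \<iota> x * \<iota> y"
      using \<iota>[of "P + R"] \<iota>[of "P * R"] by (simp_all add: ev_simps ev'_simps \<iota> flip: PR)
    show "\<iota> 1 = 1" using \<iota>[of 1] by (simp add: ev_simps ev'_simps)
    show "\<iota> 0 = 0" using \<iota>[of 0] by (simp add: ev_def ev'_simps)
  qed
  thus ?thesis by blast
qed

section \<open>Polynomials over fields\<close>

lemma field_poly_bezout: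
  fixes a b :: "'a::field poly"
  shows "\<exists>d r s. d dvd a \<and> d dvd b \<and> d = r * a + s * b"
proof (induction "if b = 0 then 0 else Suc (degree b)" arbitrary: a b rule: less_induct)
  case less
  show ?case
  proof (cases "b = 0")
    case True
    thus ?thesis by (intro exI[of _ a] exI[of _ 1] exI[of _ 0]) simp
  next
    case False
    have "a mod b = 0 \<or> degree (a mod b) < degree b"
      using degree_mod_less[OF False] .
    hence "(if a mod b = 0 then 0 else Suc (degree (a mod b))) < (if b = 0 then 0 else Suc (degree b))"
      using False by auto
    from less.hyps[OF this] obtain d r s where d: "d dvd b" "d dvd a mod b" "d = r * b + s * (a mod b)"
      by blast
    have "d dvd a" using d(1,2) dvd_mod_iff by blast
    moreover have "r * b + s * (x - y * b) = s * x + (r - s * y) * b" for x y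
      by (simp add: algebra_simps)
    hence "d = s * a + (r - s * (a div b)) * b"
      unfolding d(3) minus_div_mult_eq_mod[symmetric] by blast
    ultimately show ?thesis using d(1) by blast
  qed
qed

lemma field_poly_coprime_bezout:
  fixes a b :: "'a::field poly"
  shows "coprime a b \<longleftrightarrow> (\<exists>r s. r * a + s * b = 1)"
proof
  assume cop: "coprime a b"
  obtain d r s where d: "d dvd a" "d dvd b" "d = r * a + s * b"
    using field_poly_bezout by blast
  then obtain u where "1 = d * u" using cop coprime_common_divisor by blast
  hence "(u * r) * a + (u * s) * b = 1" using d(3) by (simp add: algebra_simps)
  thus "\<exists>r s. r * a + s * b = 1" by blast
next
  assume "\<exists>r s. r * a + s * b = 1"
  then obtain r s where "r * a + s * b = 1" by blast
  thus "coprime a b" by (metis coprimeI dvd_add dvd_mult)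
qed

lemma field_poly_coprime_mult:
  fixes a b c :: "'a::field poly"
  assumes "coprime a b" "coprime a c"
  shows "coprime a (b * c)"
proof -
  obtain r s where "r * a + s * b = 1" using assms field_poly_coprime_bezout by blast
  moreover obtain t u where "t * a + u * c = 1" using assms field_poly_coprime_bezout by blast
  ultimately have "1 = (r * a + s * b) * (t * a + u * c)" by simp
  also have "\<dots> = (r * (t * a + u * c) + s * b * t) * a + (s * u) * (b * c)"
    by (simp add: algebra_simps)
  finally show ?thesis using field_poly_coprime_bezout by metis
qed

lemma field_poly_coprime_power:
  fixes a b :: "'a::field poly"
  assumes "coprime a b"
  shows "coprime (a ^ m) (b ^ n)"
proof -
  have "coprime a (b ^ n)" by (induction n) (simp_all add: assms field_poly_coprime_mult)
  hence "coprime (b ^ n) (a ^ m)"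
    by (induction m) (simp_all add: coprime_commute field_poly_coprime_mult)
  thus ?thesis by (simp add: coprime_commute)
qed

lemma field_poly_coprime_prod:
  fixes a :: "'a::field poly"
  assumes "\<And>i. i \<in> I \<Longrightarrow> coprime a (b i)"
  shows "coprime a (prod b I)"
  using assms by (induction I rule: infinite_finite_induct) (simp_all add: field_poly_coprime_mult)

lemma irreducible_coprime:
  fixes f :: "'a::field poly"
  assumes "irreducible f" "\<not> f dvd p"
  shows "coprime f p"
  using assms by (metis coprimeI dvd_trans irreducibleD')

lemma coprime_power_dvd_mult_cancel:
  fixes f :: "'a::field poly"
  assumes "coprime f u" "f ^ n dvd u * p"
  shows "f ^ n dvd p"
proof -
  have "coprime (f ^ n) (u ^ 1)" by (rule field_poly_coprime_power[OF assms(1)])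
  then obtain r s where "r * f ^ n + s * u = 1" using field_poly_coprime_bezout[of "f ^ n" u] by auto
  hence "p = r * f ^ n * p + s * (u * p)" by (metis mult.assoc mult_1 distrib_right)
  thus ?thesis by (metis assms(2) dvd_add dvd_mult dvd_mult2 dvd_refl)
qed

lemma coprime_dvd_mult_cancel:
  fixes f :: "'a::field poly"
  assumes "coprime f u" "f dvd u * p"
  shows "f dvd p"
  using coprime_power_dvd_mult_cancel[OF assms(1), of 1 p] assms(2) by simp

lemma coprime_linear:
  fixes a b :: "'a::field"
  assumes "a \<noteq> b"
  shows "coprime [:- a, 1:] [:- b, 1:]"
proof -
  have "[:1 / (b - a):] * ([:- a, 1:] - [:- b, 1:]) = 1" using assms by (simp add: one_pCons)
  moreover have "r * x + (- r) * y = r * (x - y)" for r x y :: "'a poly" by (simp add: algebra_simps)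
  ultimately have "[:1 / (b - a):] * [:- a, 1:] + (- [:1 / (b - a):]) * [:- b, 1:] = 1"
    by (simp only:)
  thus ?thesis using field_poly_coprime_bezout by blast
qed

text \<open>The residues modulo a polynomial of degree \<open>m\<close>. Unlike a bound on
  \<open>degree\<close>, the condition on coefficients is also right for \<open>m = 0\<close>, where
  only the zero polynomial remains.\<close>

definition polys_below :: "nat \<Rightarrow> 'a::zero poly set" where
  "polys_below m = {p. \<forall>i\<ge>m. coeff p i = 0}"

lemma polys_below_iff: "p \<in> polys_below m \<longleftrightarrow> p = 0 \<or> degree p < m"
proof -
  have "p = 0 \<or> degree p < m" if "\<forall>i\<ge>m. coeff p i = 0"
    using that by (metis leading_coeff_0_iff linorder_not_le)
  thus ?thesis by (auto simp: polys_below_def coeff_eq_0)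
qed

lemma polys_below_Suc: "(polys_below (Suc m) :: 'a::zero poly set) = (\<lambda>(a, p). pCons a p) ` (UNIV \<times> polys_below m)"
proof (intro equalityI subsetI)
  fix p :: "'a poly"
  assume p: "p \<in> polys_below (Suc m)"
  obtain a p' where ap: "p = pCons a p'" by (metis pCons_cases)
  have "coeff p' i = 0" if "i \<ge> m" for i
  proof -
    have "coeff p (Suc i) = 0" using p that by (simp add: polys_below_def)
    thus ?thesis by (simp add: ap)
  qed
  hence "p' \<in> polys_below m" by (simp add: polys_below_def)
  thus "p \<in> (\<lambda>(a, p). pCons a p) ` (UNIV \<times> polys_below m)" by (auto simp: ap)
next
  fix p :: "'a poly"
  assume "p \<in> (\<lambda>(a, p). pCons a p) ` (UNIV \<times> polys_below m)"
  then obtain a p' where p': "p = pCons a p'" "\<And>i. i \<ge> m \<Longrightarrow> coeff p' i = 0"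
    by (auto simp: polys_below_def)
  have "coeff p i = 0" if "i \<ge> Suc m" for i
    using that p' by (cases i) simp_all
  thus "p \<in> polys_below (Suc m)" by (simp add: polys_below_def)
qed

lemma card_polys_below: "card (polys_below m :: 'a::finite_field poly set) = CARD('a) ^ m"
  and finite_polys_below: "finite (polys_below m :: 'a::finite_field poly set)"
proof -
  have "card (polys_below m :: 'a poly set) = CARD('a) ^ m \<and> finite (polys_below m :: 'a poly set)"
  proof (induction m)
    case 0
    have "polys_below 0 = {0 :: 'a poly}" by (auto simp: polys_below_iff)
    thus ?case by simp
  next
    case (Suc m)
    have "inj_on (\<lambda>(a, p). pCons a p) (UNIV \<times> polys_below m :: ('a \<times> 'a poly) set)"
      by (auto simp: inj_on_def)
    thus ?case using Suc by (simp add: polys_below_Suc card_image card_cartesian_product)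
  qed
  thus "card (polys_below m :: 'a poly set) = CARD('a) ^ m" "finite (polys_below m :: 'a poly set)"
    by blast+
qed

lemma diff_polys_below: "p \<in> polys_below m \<Longrightarrow> r \<in> polys_below m \<Longrightarrow> p - r \<in> polys_below m"
  for p r :: "'a::ab_group_add poly"
  by (simp add: polys_below_def)

lemma polys_below_dvd_eq_0:
  fixes p :: "'a::field poly"
  assumes "p \<in> polys_below (degree f)" "f dvd p"
  shows "p = 0"
  using assms by (auto simp: polys_below_iff dest: dvd_imp_degree_le)

lemma mod_polys_below: "f \<noteq> 0 \<Longrightarrow> p mod f \<in> polys_below (degree f)"
  for f p :: "'a::field poly"
  using degree_mod_less[of f p] by (auto simp: polys_below_iff)

section \<open>Conjugate roots of irreducible polynomials\<close>

lemma monom_mult_power_diff: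
  assumes "n > 0"
  shows "(monom 1 1 :: 'a::field poly) * (monom 1 1 ^ (n - 1) - 1) = monom 1 n - monom 1 1"
proof -
  have "y * (y ^ (n - 1) - 1) = y ^ n - y" for y :: "'a poly"
    using assms by (cases n) (simp_all add: right_diff_distrib)
  hence "monom 1 1 * (monom 1 1 ^ (n - 1) - 1) = monom 1 1 ^ n - (monom 1 1 :: 'a poly)" by blast
  also have "(monom 1 1 :: 'a poly) ^ n = monom 1 n" by (simp add: monom_power)
  finally show ?thesis .
qed

text \<open>Fermat's little theorem in the field \<open>K[x]/(f)\<close>.\<close>

lemma irreducible_dvd_monom_diff:
  fixes f :: "'a::finite_field poly"
  assumes f: "irreducible f"
  shows "f dvd monom 1 (CARD('a) ^ degree f) - monom 1 1"
proof (cases "f dvd monom 1 1")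
  case True
  have "monom 1 (CARD('a) ^ degree f) - monom 1 1
      = monom 1 1 * (monom 1 (CARD('a) ^ degree f - 1) - 1 :: 'a poly)"
    by (simp add: mult_monom right_diff_distrib)
  thus ?thesis using True by simp
next
  case False
  let ?x = "monom 1 1 :: 'a poly" and ?D = "polys_below (degree f) - {0 :: 'a poly}"
  have f0: "f \<noteq> 0" using f by auto
  have cop: "coprime f ?x" using irreducible_coprime[OF f False] .
  \<comment> \<open>Multiplication by \<open>x\<close> permutes the nonzero residues modulo
    \<open>f\<close>. Comparing the product of all residues before and after, and cancelling that
    product, which is coprime to \<open>f\<close>, gives \<open>x^(q^deg f - 1) = 1\<close> modulo
    \<open>f\<close>.\<close>
  have inj: "inj_on (\<lambda>p. (?x * p) mod f) ?D"
  proof (rule inj_onI)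
    fix p r assume pr: "p \<in> ?D" "r \<in> ?D" "(?x * p) mod f = (?x * r) mod f"
    hence "f dvd ?x * (p - r)" by (simp add: mod_eq_dvd_iff right_diff_distrib)
    hence "f dvd p - r" by (rule coprime_dvd_mult_cancel[OF cop])
    hence "p - r = 0" using pr diff_polys_below polys_below_dvd_eq_0 by blast
    thus "p = r" by simp
  qed
  have im: "(?x * p) mod f \<in> ?D" if "p \<in> ?D" for p
  proof -
    have "\<not> f dvd ?x * p"
      using that coprime_dvd_mult_cancel[OF cop, of p] polys_below_dvd_eq_0[of p f] by blast
    thus ?thesis using mod_polys_below[OF f0] by (auto simp: mod_eq_0_iff_dvd)
  qed
  have "(\<lambda>p. (?x * p) mod f) ` ?D = ?D"
  proof (rule card_subset_eq)
    show "finite ?D" by (simp add: finite_polys_below)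
    show "(\<lambda>p. (?x * p) mod f) ` ?D \<subseteq> ?D" by (rule image_subsetI) (rule im)
    show "card ((\<lambda>p. (?x * p) mod f) ` ?D) = card ?D" by (rule card_image[OF inj])
  qed
  hence "(\<Prod>p\<in>?D. (?x * p) mod f) = \<Prod>?D"
    using prod.reindex[OF inj, of "\<lambda>p. p"] by (simp only: comp_def)
  moreover have "(\<Prod>p\<in>?D. (?x * p) mod f) mod f = (\<Prod>p\<in>?D. ?x * p) mod f"
    by (rule mod_prod_eq)
  moreover have "(\<Prod>p\<in>?D. ?x * p) = ?x ^ card ?D * \<Prod>?D"
    by (simp only: prod.distrib prod_constant)
  ultimately have "(?x ^ card ?D * \<Prod>?D) mod f = \<Prod>?D mod f" by (simp only:)
  hence "f dvd ?x ^ card ?D * \<Prod>?D - \<Prod>?D" by (simp only: mod_eq_dvd_iff)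
  also have "?x ^ card ?D * \<Prod>?D - \<Prod>?D = \<Prod>?D * (?x ^ card ?D - 1)"
    by (simp only: right_diff_distrib mult.commute mult_1_right mult_1_left)
  finally have "f dvd \<Prod>?D * (?x ^ card ?D - 1)" .
  moreover have "coprime f (\<Prod>?D)"
    by (rule field_poly_coprime_prod, rule irreducible_coprime[OF f])
      (metis DiffE polys_below_dvd_eq_0 singletonI)
  ultimately have "f dvd ?x ^ card ?D - 1"
    by (rule coprime_dvd_mult_cancel[rotated])
  moreover have "card ?D = CARD('a) ^ degree f - 1"
  proof -
    have "0 \<in> (polys_below (degree f) :: 'a poly set)" by (simp add: polys_below_def)
    thus ?thesis by (simp only: card_Diff_singleton card_polys_below)
  qed
  ultimately have "f dvd ?x * (?x ^ (CARD('a) ^ degree f - 1) - 1)" by (metis dvd_mult)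
  thus ?thesis by (subst (asm) monom_mult_power_diff) (simp_all add: finite_UNIV_card_ge_0)
qed

text \<open>The difference of the two sides would have degree below \<open>c\<close> and yet the
  \<open>c\<close> distinct roots \<open>a i\<close>.\<close>

lemma monic_eq_prod_roots:
  fixes p :: "'a::field poly"
  assumes "monic p" "inj_on a {..<c}" "degree p = c" "\<And>i. i < c \<Longrightarrow> poly p (a i) = 0"
  shows "p = (\<Prod>i<c. [:- a i, 1:])"
proof (rule ccontr)
  let ?P = "\<Prod>i<c. [:- a i, 1:]"
  assume "p \<noteq> ?P"
  hence nz: "p - ?P \<noteq> 0" by simp
  have deg: "degree ?P = c" by (simp add: degree_prod_eq_sum_degree)
  have "monic ?P" by (rule monic_prod) simp
  hence "coeff (p - ?P) c = 0" using assms(1,3) deg by simp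
  moreover have "degree (p - ?P) \<le> c" using assms(3) deg by (intro degree_diff_le) auto
  ultimately have "degree (p - ?P) < c" using nz
    by (metis leading_coeff_0_iff le_neq_implies_less)
  moreover have "card (a ` {..<c}) \<le> card {z. poly (p - ?P) z = 0}"
    using assms(4) by (intro card_mono poly_roots_finite nz) (auto simp: poly_prod)
  ultimately show False
    using poly_roots_degree[OF nz] assms(2) by (simp add: card_image)
qed

text \<open>Used to see that the elements fixed by smaller powers of Frobenius cannot fill the field
  of \<open>q^c\<close> elements.\<close>

lemma sum_power_less: "(1::nat) < q \<Longrightarrow> (\<Sum>i\<in>{1..<c}. q ^ i) < q ^ c"
proof (induction c)
  case (Suc c)
  show ?case
  proof (cases "c = 0")
    case False
    hence "(\<Sum>i\<in>{1..<Suc c}. q ^ i) = (\<Sum>i\<in>{1..<c}. q ^ i) + q ^ c"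
      by (simp add: atLeastLessThanSuc)
    also have "\<dots> < 2 * q ^ c" using Suc by simp
    also have "\<dots> \<le> q ^ Suc c" using Suc.prems by simp
    finally show ?thesis .
  qed (use Suc in simp)
qed simp

section \<open>Frobenius orbits in the extension field and irreducible polynomials over the base
  field\<close>

locale finite_field_ext = field_hom \<iota> for \<iota> :: "'a::finite_field \<Rightarrow> 'b::finite_field" +
  fixes l :: nat
  assumes card_ext: "CARD('b) = CARD('a) ^ l"
begin

lemma hom_embedding: "field_hom \<iota>" by unfold_locales

sublocale P: map_poly_comm_ring_hom \<iota> ..

lemma l_pos: "l > 0"
  using card_ext CARD_field_gt_1[where 'a='b] by (cases l) auto

lemma q_gt_1: "CARD('a) > 1" by (rule CARD_field_gt_1)

lemma frob_add: "(x + y) ^ (CARD('a) ^ i) = x ^ (CARD('a) ^ i) + y ^ (CARD('a) ^ i)" for x y :: 'b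
  by (rule finite_field_power_card_add[OF card_ext])

lemma frob_sum: "(\<Sum>j\<in>J. g j) ^ (CARD('a) ^ i) = (\<Sum>j\<in>J. g j ^ (CARD('a) ^ i))" for g :: "'c \<Rightarrow> 'b"
proof -
  have "(0 :: 'b) ^ (CARD('a) ^ i) = 0" using q_gt_1 by (intro zero_power) simp
  thus ?thesis by (induction J rule: infinite_finite_induct) (simp_all add: frob_add)
qed

lemma frob_period: "x ^ (CARD('a) ^ l) = x" for x :: 'b
  using finite_field_power_card_eq_same[of x] card_ext by simp

lemma frob_inj: "x ^ (CARD('a) ^ i) = y ^ (CARD('a) ^ i) \<Longrightarrow> x = y" for x y :: 'b
proof -
  assume xy: "x ^ (CARD('a) ^ i) = y ^ (CARD('a) ^ i)"
  \<comment> \<open>A further \<open>l * i - i\<close> applications of Frobenius complete the given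
    \<open>i\<close> to a multiple of the period \<open>l\<close>.\<close>
  have *: "(x ^ (CARD('a) ^ i)) ^ (CARD('a) ^ (l * i - i)) = x" for x :: 'b
  proof -
    have "(x ^ (CARD('a) ^ i)) ^ (CARD('a) ^ (l * i - i)) = x ^ (CARD('a) ^ (i + (l * i - i)))"
      by (simp add: power_mult power_add)
    also have "i + (l * i - i) = l * i" using l_pos by simp
    also have "x ^ (CARD('a) ^ (l * i)) = x"
    proof (induction i)
      case (Suc i)
      have "x ^ (CARD('a) ^ (l * Suc i)) = (x ^ (CARD('a) ^ l)) ^ (CARD('a) ^ (l * i))" by (simp add: power_add power_mult)
      thus ?case using Suc frob_period by simp
    qed simp
    finally show ?thesis .
  qed
  show "x = y" by (metis * xy)
qed

lemma frob_embed: "\<iota> x ^ CARD('a) = \<iota> x"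
  by (metis finite_field_power_card_eq_same hom_power)

text \<open>Embedded elements are fixed by Frobenius, and the image and the fixed set both have
  \<open>CARD('a)\<close> elements. This is the descent criterion for scalars, coefficients and
  vectors.\<close>

lemma range_iff: "z \<in> range \<iota> \<longleftrightarrow> z ^ CARD('a) = z"
proof -
  have "range \<iota> = {z. z ^ CARD('a) = z}"
  proof (rule card_subset_eq)
    have "card (range \<iota>) = CARD('a)" by (simp add: card_image inj_f)
    thus "card (range \<iota>) = card {z :: 'b. z ^ CARD('a) = z}"
      using card_fixed_power[OF card_ext l_pos q_gt_1] by simp
  qed (auto simp: frob_embed)
  thus ?thesis by blast
qed

lemma poly_frob: "poly (map_poly \<iota> p) (z ^ (CARD('a) ^ i)) = poly (map_poly \<iota> p) z ^ (CARD('a) ^ i)"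
proof -
  have *: "poly (map_poly \<iota> p) (z ^ CARD('a)) = poly (map_poly \<iota> p) z ^ CARD('a)" for z
  proof (induction p)
    case (pCons a p)
    thus ?case using frob_add[of _ _ 1]
      by (simp add: frob_embed power_mult_distrib hom_distribs)
  qed simp
  show ?thesis
  proof (induction i)
    case (Suc i)
    have e: "y ^ (CARD('a) ^ Suc i) = (y ^ (CARD('a) ^ i)) ^ CARD('a)" for y :: 'b
      by (metis power_Suc2 power_mult)
    show ?case unfolding e * Suc ..
  qed simp
qed

lemma frob_eval_eq: "z ^ (CARD('a) ^ i) = z \<Longrightarrow> poly (map_poly \<iota> p) z ^ (CARD('a) ^ i) = poly (map_poly \<iota> p) z"
  using poly_frob[of p z i] by simp

lemma irreducible_dvd_if_common_root:
  assumes "irreducible f" "poly (map_poly \<iota> f) z = 0" "poly (map_poly \<iota> p) z = 0"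
  shows "f dvd p"
proof (rule ccontr)
  assume "\<not> f dvd p"
  then obtain r s where "r * f + s * p = 1"
    using irreducible_coprime[OF assms(1)] field_poly_coprime_bezout by blast
  hence "map_poly \<iota> r * map_poly \<iota> f + map_poly \<iota> s * map_poly \<iota> p = 1"
    by (metis P.hom_add P.hom_mult P.hom_one)
  hence "poly (map_poly \<iota> r * map_poly \<iota> f + map_poly \<iota> s * map_poly \<iota> p) z = 1" by simp
  thus False using assms(2,3) by simp
qed

definition conjugate_roots :: "'a poly \<Rightarrow> 'b \<Rightarrow> bool" where
  "conjugate_roots f z \<longleftrightarrow> inj_on (\<lambda>i. z ^ (CARD('a) ^ i)) {..<degree f} \<and> z ^ (CARD('a) ^ degree f) = z \<and>
     map_poly \<iota> f = (\<Prod>i<degree f. [:- (z ^ (CARD('a) ^ i)), 1:])"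

text \<open>As \<open>deg f\<close> divides \<open>l\<close>, the polynomial \<open>f\<close>
  divides \<open>x^Q - x\<close> with \<open>Q = CARD('b)\<close>, so it has a root
  \<open>z\<close>. If the orbit of \<open>z\<close> were shorter, some \<open>q^e\<close> with
  \<open>0 < e < deg f\<close> would fix \<open>z\<close> and with it all \<open>q^(deg f)\<close>
  values at \<open>z\<close> of residues modulo \<open>f\<close>; these values are distinct, but
  only \<open>q^e\<close> elements can be fixed.\<close>

lemma ex_conjugate_roots:
  assumes f: "irreducible f" "monic f" and dvd: "degree f dvd l"
  shows "\<exists>z. conjugate_roots f z"
proof -
  let ?c = "degree f" and ?F = "map_poly \<iota> f"
  have "\<not> is_unit f" "f \<noteq> 0" using f by auto
  hence c: "?c > 0" by (metis is_unit_iff_degree neq0_conv)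
  obtain k where k: "l = ?c * k" using dvd by blast
  have F: "degree ?F = ?c" "monic ?F" using f(2) by simp_all
  have fdvd: "f dvd monom 1 (CARD('a) ^ ?c) - monom 1 1" by (rule irreducible_dvd_monom_diff[OF f(1)])
  hence Fdvd: "?F dvd monom 1 (CARD('a) ^ ?c) - monom 1 1"
    using P.hom_dvd[OF fdvd] by (simp add: P.hom_minus map_poly_monom)
  also have "monom 1 (CARD('a) ^ ?c) - monom 1 1 dvd (monom 1 (CARD('b)) - monom 1 1 :: 'b poly)"
    unfolding card_ext k power_mult using l_pos k q_gt_1 by (intro monom_power_card_diff_dvd) auto
  finally have "card {z. poly ?F z = 0} = ?c" using card_roots_dvd F by metis
  then obtain z where z: "poly ?F z = 0" using c by (metis (mono_tags) card.empty empty_Collect_eq less_irrefl)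
  have "poly (monom 1 (CARD('a) ^ ?c) - monom 1 1) z = 0"
    using z Fdvd by (metis dvdE mult_zero_left poly_mult)
  hence per: "z ^ (CARD('a) ^ ?c) = z" by (simp add: poly_monom)
  have inj: "inj_on (\<lambda>i. z ^ (CARD('a) ^ i)) {..<?c}"
  proof (rule linorder_inj_onI')
    fix i j assume ij: "i \<in> {..<?c}" "j \<in> {..<?c}" "i < j"
    show "z ^ CARD('a) ^ i \<noteq> z ^ CARD('a) ^ j"
    proof
      assume eq: "z ^ (CARD('a) ^ i) = z ^ (CARD('a) ^ j)"
      define e where "e = j - i"
      have e: "0 < e" "e < ?c" using ij by (auto simp: e_def)
      have "z ^ (CARD('a) ^ j) = (z ^ (CARD('a) ^ e)) ^ (CARD('a) ^ i)"
        using ij by (simp add: e_def flip: power_mult power_add)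
      hence ze: "z ^ (CARD('a) ^ e) = z" using eq frob_inj by metis
      let ?ev = "\<lambda>p. poly (map_poly \<iota> p) z"
      have "inj_on ?ev (polys_below ?c)"
      proof (rule inj_onI)
        fix p r assume pr: "p \<in> polys_below ?c" "r \<in> polys_below ?c" "?ev p = ?ev r"
        hence "f dvd p - r"
          by (intro irreducible_dvd_if_common_root[OF f(1) z]) (simp add: P.hom_minus)
        hence "p - r = 0" using pr diff_polys_below polys_below_dvd_eq_0 by blast
        thus "p = r" by simp
      qed
      hence "CARD('a) ^ ?c = card (?ev ` polys_below ?c)" by (simp add: card_image card_polys_below)
      also have "\<dots> \<le> card {w :: 'b. poly (monom 1 (CARD('a) ^ e) - monom 1 1) w = 0}"
        using frob_eval_eq[OF ze] by (intro card_mono) (auto simp: poly_monom)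
      also have "\<dots> \<le> CARD('a) ^ e"
      proof -
        have "CARD('a) ^ e > 1" by (rule one_less_power[OF q_gt_1 e(1)])
        from degree_monom_diff[OF this] show ?thesis
          by (metis poly_roots_degree leading_coeff_0_iff zero_neq_one)
      qed
      finally show False using e q_gt_1 by simp
    qed
  qed
  have "?F = (\<Prod>i<?c. [:- (z ^ (CARD('a) ^ i)), 1:])"
    by (rule monic_eq_prod_roots[OF F(2) inj F(1)]) (use z q_gt_1 in \<open>simp add: poly_frob power_0_left\<close>)
  thus ?thesis using inj per unfolding conjugate_roots_def by blast
qed

text \<open>By counting, some \<open>z\<close> is fixed by the \<open>c\<close>-th power of
  Frobenius and by no smaller positive one. The product of the linear factors over its orbit is
  invariant under Frobenius, so its coefficients descend. It is irreducible because a factor that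
  vanishes at \<open>z\<close> vanishes on all \<open>c\<close> conjugates.\<close>

lemma ex_irreducible_of_degree:
  assumes c: "c > 0" and dvd: "c dvd l"
  shows "\<exists>f :: 'a poly. irreducible f \<and> monic f \<and> degree f = c"
proof -
  obtain k where k: "l = c * k" using dvd by blast
  let ?Fix = "\<lambda>i. {z :: 'b. z ^ (CARD('a) ^ i) = z}"
  have "card (?Fix c) = CARD('a) ^ c"
    by (rule card_fixed_power) (use card_ext k l_pos one_less_power[OF q_gt_1 c] in \<open>auto simp: power_mult\<close>)
  moreover have "card (\<Union>i\<in>{1..<c}. ?Fix i) < CARD('a) ^ c"
  proof -
    have "card (?Fix i) \<le> CARD('a) ^ i" if "i > 0" for i
    proof -
      have "CARD('a) ^ i > 1" by (rule one_less_power[OF q_gt_1 that])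
      from degree_monom_diff[OF this, where 'b='b]
      have "card {z :: 'b. poly (monom 1 (CARD('a) ^ i) - monom 1 1) z = 0} \<le> CARD('a) ^ i"
        by (metis poly_roots_degree leading_coeff_0_iff zero_neq_one)
      thus ?thesis by (simp add: poly_monom)
    qed
    hence "(\<Sum>i\<in>{1..<c}. card (?Fix i)) \<le> (\<Sum>i\<in>{1..<c}. CARD('a) ^ i)"
      by (intro sum_mono) auto
    moreover have "card (\<Union>i\<in>{1..<c}. ?Fix i) \<le> (\<Sum>i\<in>{1..<c}. card (?Fix i))"
      by (rule card_UN_le) simp
    ultimately show ?thesis using sum_power_less[OF q_gt_1, of c] by linarith
  qed
  ultimately have "\<not> ?Fix c \<subseteq> (\<Union>i\<in>{1..<c}. ?Fix i)"
    by (metis (no_types, lifting) card_mono finite linorder_not_le)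
  then obtain z where zc: "z \<in> ?Fix c" "z \<notin> (\<Union>i\<in>{1..<c}. ?Fix i)" by blast
  have zn: "z ^ (CARD('a) ^ i) \<noteq> z" if "1 \<le> i" "i < c" for i
    using zc that by (metis (mono_tags, lifting) UN_I atLeastLessThan_iff mem_Collect_eq)
  have zc': "z ^ (CARD('a) ^ c) = z" using zc(1) by simp
  have inj: "inj_on (\<lambda>i. z ^ (CARD('a) ^ i)) {..<c}"
  proof (rule linorder_inj_onI')
    fix i j assume ij: "i \<in> {..<c}" "j \<in> {..<c}" "i < j"
    have "z ^ (CARD('a) ^ j) = (z ^ (CARD('a) ^ (j - i))) ^ (CARD('a) ^ i)"
      using ij by (simp flip: power_mult power_add)
    moreover have "z ^ (CARD('a) ^ (j - i)) \<noteq> z" using ij by (intro zn) auto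
    ultimately show "z ^ (CARD('a) ^ i) \<noteq> z ^ (CARD('a) ^ j)" using frob_inj by metis
  qed
  let ?P = "\<Prod>i<c. [:- (z ^ (CARD('a) ^ i)), 1:]"
  have P: "degree ?P = c" "monic ?P"
    by (simp add: degree_prod_eq_sum_degree, rule monic_prod, simp)
  interpret fr: comm_ring_hom "\<lambda>x :: 'b. x ^ CARD('a)"
    using frob_add[of _ _ 1] q_gt_1 by unfold_locales (auto simp: power_mult_distrib)
  interpret Fr: map_poly_comm_ring_hom "\<lambda>x :: 'b. x ^ CARD('a)" ..
  have "map_poly (\<lambda>x. x ^ CARD('a)) ?P = (\<Prod>i<c. map_poly (\<lambda>x. x ^ CARD('a)) [:- (z ^ (CARD('a) ^ i)), 1:])"
    by (rule Fr.hom_prod)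
  also have "\<dots> = (\<Prod>i<c. [:- (z ^ (CARD('a) ^ Suc i)), 1:])"
  proof (intro prod.cong refl)
    fix i
    have "(z ^ (CARD('a) ^ i)) ^ CARD('a) = z ^ (CARD('a) ^ Suc i)" by (metis power_Suc2 power_mult)
    thus "map_poly (\<lambda>x. x ^ CARD('a)) [:- (z ^ (CARD('a) ^ i)), 1:] = [:- (z ^ (CARD('a) ^ Suc i)), 1:]"
      using fr.hom_uminus[of "z ^ (CARD('a) ^ i)"] by (simp add: Fr.map_poly_pCons_hom)
  qed
  \<comment> \<open>Frobenius only shifts the factors cyclically. The shifted product is compared
    with the original one by multiplying with the factor of index 0, which is also that of index
    \<open>c\<close>, and cancelling it.\<close>
  also have "\<dots> = ?P"
  proof -
    let ?L = "\<lambda>i. [:- (z ^ (CARD('a) ^ i)), 1:]"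
    have "?L 0 * (\<Prod>i<c. ?L (Suc i)) = (\<Prod>i<Suc c. ?L i)"
      by (rule prod.lessThan_Suc_shift[symmetric])
    also have "\<dots> = ?P * ?L c" by (rule prod.lessThan_Suc)
    also have "?L c = ?L 0" using zc' by simp
    also have "?P * ?L 0 = ?L 0 * ?P" by (rule mult.commute)
    finally show ?thesis using mult_left_cancel[of "?L 0"] by simp
  qed
  finally have frP: "map_poly (\<lambda>x. x ^ CARD('a)) ?P = ?P" .
  have *: "coeff ?P n \<in> range \<iota>" for n
    unfolding range_iff using arg_cong[OF frP, of "\<lambda>p. coeff p n"] q_gt_1 by (simp add: coeff_map_poly)
  define f where "f = map_poly (inv_into UNIV \<iota>) ?P"
  have "inv_into UNIV \<iota> 0 = 0" by (metis hom_zero inj_f inv_f_f)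
  hence f: "map_poly \<iota> f = ?P"
    by (intro poly_eqI) (simp add: f_def coeff_map_poly f_inv_into_f[OF *])
  have deg: "degree f = c" and mon: "monic f" using P f
    by (metis degree_map_poly_hom, metis degree_map_poly_hom coeff_map_poly_hom hom_1_iff)
  have "irreducible f"
  proof (rule irreducibleI)
    show "f \<noteq> 0" using mon by auto
    show "\<not> is_unit f" using deg c \<open>f \<noteq> 0\<close> by (simp add: is_unit_iff_degree)
    fix g h assume gh: "f = g * h"
    have unit: "is_unit h" if gh: "f = g * h" and r: "poly (map_poly \<iota> g) z = 0" for g h
    proof -
      have nz: "g \<noteq> 0" "h \<noteq> 0" using gh \<open>f \<noteq> 0\<close> by auto
      hence nz': "map_poly \<iota> g \<noteq> 0" by simp
      have "c = card ((\<lambda>i. z ^ (CARD('a) ^ i)) ` {..<c})" using inj by (simp add: card_image)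
      also have "\<dots> \<le> card {w. poly (map_poly \<iota> g) w = 0}"
        using r q_gt_1 by (intro card_mono) (auto simp: poly_frob power_0_left)
      also have "\<dots> \<le> degree g" using poly_roots_degree[OF nz'] by simp
      finally have "degree h = 0" using deg gh nz by (simp add: degree_mult_eq)
      thus ?thesis using nz by (simp add: is_unit_iff_degree)
    qed
    have "poly ?P z = 0" using c by (simp add: poly_prod) (metis power_one_right power_0 lessThan_iff)
    hence "poly (map_poly \<iota> g) z = 0 \<or> poly (map_poly \<iota> h) z = 0"
      unfolding f[symmetric] gh by (simp add: P.hom_mult)
    thus "is_unit g \<or> is_unit h" using unit[of g h] unit[of h g] gh by (auto simp: mult.commute)
  qed
  thus ?thesis using deg mon by blast
qed

end

section \<open>Primary modules over a polynomial ring\<close>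

locale operator = vector_space scale
  for scale :: "'k::field \<Rightarrow> 'v::ab_group_add \<Rightarrow> 'v" (infixr \<open>*s\<close> 75) +
  fixes A :: "'v \<Rightarrow> 'v"
  assumes A_add: "A (x + y) = A x + A y"
    and A_scale: "A (a *s x) = a *s A x"
begin

text \<open>The sum has the shape of the scalar multiplication in \<open>matrix_module\<close>, so
  that a coordinate map matches the two term by term.\<close>

definition act :: "'k poly \<Rightarrow> 'v \<Rightarrow> 'v" where
  "act p v = (\<Sum>i\<le>degree p. coeff p i *s (A ^^ i) v)"

lemma A_zero [simp]: "A 0 = 0"
  using A_add[of 0 0] by simp

lemma A_sum: "A (\<Sum>j\<in>J. x j) = (\<Sum>j\<in>J. A (x j))"
  by (induction J rule: infinite_finite_induct) (simp_all add: A_add)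

lemma act_altdef: "degree p \<le> n \<Longrightarrow> act p v = (\<Sum>i\<le>n. coeff p i *s (A ^^ i) v)"
  unfolding act_def by (rule sum.mono_neutral_left) (auto simp: coeff_eq_0)

lemma act_0 [simp]: "act 0 v = 0"
  by (simp add: act_def)

lemma act_pCons: "act (pCons a p) v = a *s v + A (act p v)"
proof -
  have "act (pCons a p) v = (\<Sum>i\<le>Suc (degree p). coeff (pCons a p) i *s (A ^^ i) v)"
    by (rule act_altdef) (simp add: degree_pCons_le)
  also have "\<dots> = a *s v + (\<Sum>i\<le>degree p. coeff p i *s (A ^^ Suc i) v)"
    by (subst sum.atMost_Suc_shift) simp
  also have "(\<Sum>i\<le>degree p. coeff p i *s (A ^^ Suc i) v) = A (act p v)"
    by (simp add: act_def A_sum A_scale)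
  finally show ?thesis .
qed

lemma act_1 [simp]: "act 1 v = v"
  by (simp add: one_pCons act_pCons)

lemma act_add: "act (p + r) v = act p v + act r v"
proof -
  let ?n = "max (degree p) (degree r)"
  have "act (p + r) v = (\<Sum>i\<le>?n. coeff (p + r) i *s (A ^^ i) v)"
    by (rule act_altdef) (rule degree_add_le_max)
  thus ?thesis by (simp add: act_altdef[of p ?n] act_altdef[of r ?n] scale_left_distrib sum.distrib)
qed

lemma act_smult: "act (Polynomial.smult a p) v = a *s act p v"
  by (induction p) (simp_all add: act_pCons scale_right_distrib A_scale)

lemma act_uminus: "act (- p) v = - act p v"
  using act_smult[of "-1" p v] by simp

lemma act_diff: "act (p - r) v = act p v - act r v"
  using act_add[of p "- r" v] by (simp add: act_uminus)

lemma act_mult: "act (p * r) v = act p (act r v)"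
  by (induction p) (simp_all add: act_pCons act_add act_smult)

lemma act_add_right: "act p (v + w) = act p v + act p w"
  by (induction p) (simp_all add: act_pCons scale_right_distrib A_add algebra_simps)

lemma act_scale_right: "act p (a *s v) = a *s act p v"
  by (induction p) (simp_all add: act_pCons scale_right_distrib A_scale mult.commute)

lemma act_zero_right [simp]: "act p 0 = 0"
  using act_add_right[of p 0 0] by simp

lemma act_diff_right: "act p (v - w) = act p v - act p w"
  using act_add_right[of p "v - w" w] by (simp add: algebra_simps)

lemma act_sum_right: "act p (\<Sum>j\<in>J. x j) = (\<Sum>j\<in>J. act p (x j))"
  by (induction J rule: infinite_finite_induct) (simp_all add: act_add_right)

lemma act_sum: "act (\<Sum>j\<in>J. p j) v = (\<Sum>j\<in>J. act (p j) v)"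
  by (induction J rule: infinite_finite_induct) (simp_all add: act_add)

lemma act_dvd_eq_0: "p dvd r \<Longrightarrow> act p v = 0 \<Longrightarrow> act r v = 0"
  by (auto simp: act_mult mult.commute[of p])

lemma act_coprime_eq_0:
  assumes "coprime p r" "act p v = 0" "act r v = 0"
  shows "v = 0"
proof -
  obtain s t where "s * p + t * r = 1" using assms(1) field_poly_coprime_bezout by blast
  hence "v = act (s * p + t * r) v" by simp
  also have "\<dots> = 0" using assms(2,3) by (simp add: act_add act_mult)
  finally show ?thesis .
qed

lemma act_commute:
  assumes "\<And>x y. B (x + y) = B x + B y" "\<And>a x. B (a *s x) = a *s B x" "\<And>x. B (A x) = A (B x)"
  shows "B (act p v) = act p (B v)"
proof -
  have "B 0 = 0" using assms(1)[of 0 0] by simp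
  thus ?thesis by (induction p) (simp_all add: act_pCons assms)
qed

end

lemma not_power_dvd_decompose:
  fixes f :: "'a::field poly"
  assumes "\<not> f ^ k dvd p"
  shows "\<exists>a u. a < k \<and> p = f ^ a * u \<and> \<not> f dvd u"
  using assms
proof (induction k arbitrary: p)
  case (Suc k)
  show ?case
  proof (cases "f dvd p")
    case True
    then obtain p' where p': "p = f * p'" by blast
    hence "\<not> f ^ k dvd p'" using Suc.prems by (auto simp: dvd_def mult.assoc)
    then obtain a u where "a < k" "p' = f ^ a * u" "\<not> f dvd u" using Suc.IH by blast
    thus ?thesis using p' by (intro exI[of _ "Suc a"] exI[of _ u]) (simp add: mult.assoc)
  qed (auto intro: exI[of _ 0])
qed simp

text \<open>The module is a subset \<open>V\<close> and not a whole type, because coordinate spaces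
  of every dimension, \<open>K^n\<close> inside \<open>L^n\<close>, and the spaces
  \<open>part t\<close> must all live in one type of functions.\<close>

locale finite_module = operator scale A
  for scale :: "'k::finite_field \<Rightarrow> 'v::ab_group_add \<Rightarrow> 'v" (infixr \<open>*s\<close> 75) and A +
  fixes V :: "'v set"
  assumes V_subspace: "subspace V"
    and V_invariant: "x \<in> V \<Longrightarrow> A x \<in> V"
    and V_finite: "finite V"
begin

lemma act_closed: "v \<in> V \<Longrightarrow> act p v \<in> V"
  by (induction p)
    (simp_all add: act_pCons V_subspace subspace_0 subspace_add subspace_scale V_invariant)

lemma sum_closed: "(\<And>i. i \<in> I \<Longrightarrow> x i \<in> V) \<Longrightarrow> (\<Sum>i\<in>I. x i) \<in> V"
  by (rule subspace_sum[OF V_subspace])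

text \<open>Here \<open>k i\<close> is only an upper bound for the order of \<open>g i\<close>; the
  sum of these bounds is the quantity that gets minimised.\<close>

definition generators :: "'k poly \<Rightarrow> 'i set \<Rightarrow> ('i \<Rightarrow> 'v) \<Rightarrow> ('i \<Rightarrow> nat) \<Rightarrow> bool" where
  "generators f I g k \<longleftrightarrow> finite I \<and> (\<forall>i\<in>I. g i \<in> V \<and> act (f ^ k i) (g i) = 0) \<and>
     (\<forall>v\<in>V. \<exists>p. v = (\<Sum>i\<in>I. act (p i) (g i)))"

text \<open>The internal form of an isomorphism with the direct sum of the modules
  \<open>K[x]/(f^(k i))\<close>: every relation between the generators follows from their
  annihilators.\<close>

definition primary_basis :: "'k poly \<Rightarrow> 'i set \<Rightarrow> ('i \<Rightarrow> 'v) \<Rightarrow> ('i \<Rightarrow> nat) \<Rightarrow> bool" where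
  "primary_basis f I g k \<longleftrightarrow> generators f I g k \<and>
     (\<forall>p. (\<Sum>i\<in>I. act (p i) (g i)) = 0 \<longrightarrow> (\<forall>i\<in>I. f ^ k i dvd p i))"

text \<open>A relation that is not a consequence of \<open>f\<^sup>k\<^sup>i g\<^sub>i = 0\<close> lets us replace one generator by one of smaller order.\<close>

lemma generators_improve:
  assumes f: "irreducible f" and gen: "generators f I g k"
    and rel: "(\<Sum>i\<in>I. act (p i) (g i)) = 0" and bad: "i0 \<in> I" "\<not> f ^ k i0 dvd p i0"
  shows "\<exists>g' k'. generators f I g' k' \<and> sum k' I < sum k I"
proof -
  have fin: "finite I" and gI: "\<And>i. i \<in> I \<Longrightarrow> g i \<in> V" "\<And>i. i \<in> I \<Longrightarrow> act (f ^ k i) (g i) = 0"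
    and span: "\<And>v. v \<in> V \<Longrightarrow> \<exists>p. v = (\<Sum>i\<in>I. act (p i) (g i))"
    using gen by (auto simp: generators_def)
  define J where "J = {i \<in> I. \<not> f ^ k i dvd p i}"
  have J: "finite J" "J \<subseteq> I" "i0 \<in> J" using fin bad by (auto simp: J_def)
  have "\<forall>i\<in>J. \<exists>a u. a < k i \<and> p i = f ^ a * u \<and> \<not> f dvd u"
    using not_power_dvd_decompose by (auto simp: J_def)
  then obtain a u where au: "\<And>i. i \<in> J \<Longrightarrow> a i < k i" "\<And>i. i \<in> J \<Longrightarrow> p i = f ^ a i * u i"
    "\<And>i. i \<in> J \<Longrightarrow> \<not> f dvd u i" by metis
  \<comment> \<open>With the least exponent \<open>a j\<close>, the power \<open>f^(a j)\<close> can
    be taken out of all terms that matter. What remains of the relation is \<open>v'\<close>, which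
    \<open>f^(a j)\<close> kills; it will replace \<open>g j\<close>.\<close>
  obtain j where j: "j \<in> J" "\<And>i. i \<in> J \<Longrightarrow> a j \<le> a i"
    using ex_min_if_finite[of "a ` J"] J by (metis arg_min_if_finite(1) arg_min_least empty_iff)
  hence jI: "j \<in> I" using J by blast
  define w where "w i = f ^ (a i - a j) * u i" for i
  define v' where "v' = (\<Sum>i\<in>J. act (w i) (g i))"
  have v'V: "v' \<in> V" unfolding v'_def using gI J by (intro sum_closed act_closed) auto
  have "act (f ^ a j) v' = (\<Sum>i\<in>J. act (f ^ a j * w i) (g i))"
    by (simp add: v'_def act_sum_right act_mult)
  also have "\<dots> = (\<Sum>i\<in>J. act (p i) (g i))"
    using j(2) au(2) by (intro sum.cong refl) (simp add: w_def mult.assoc[symmetric] flip: power_add)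
  also have "\<dots> = (\<Sum>i\<in>I. act (p i) (g i))"
    using J fin gI(2) by (intro sum.mono_neutral_left) (auto simp: J_def intro: act_dvd_eq_0)
  finally have v'0: "act (f ^ a j) v' = 0" using rel by simp
  define g' where "g' = g(j := v')"
  define k' where "k' = k(j := a j)"
  have wj: "w j = u j" by (simp add: w_def)
  \<comment> \<open>The coefficient \<open>u j\<close> of \<open>g j\<close> in \<open>v'\<close> is
    invertible modulo \<open>f^(k j)\<close>, so \<open>g j\<close> can be recovered from
    \<open>v'\<close> and the other generators.\<close>
  have "coprime (f ^ k j) (u j ^ 1)"
    using irreducible_coprime[OF f au(3)[OF j(1)]] by (rule field_poly_coprime_power)
  then obtain r s where rs: "r * f ^ k j + s * u j = 1"
    using field_poly_coprime_bezout[of "f ^ k j" "u j"] by auto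
  have "g j = act (r * f ^ k j + s * u j) (g j)" using rs by simp
  also have "\<dots> = act s (act (u j) (g j))" using gI(2)[OF jI] by (simp add: act_add act_mult)
  also have "act (u j) (g j) = v' - (\<Sum>i\<in>J - {j}. act (w i) (g i))"
    unfolding v'_def using sum.remove[OF J(1) j(1), of "\<lambda>i. act (w i) (g i)"] wj by simp
  finally have gj: "g j = act s v' - (\<Sum>i\<in>J - {j}. act (s * w i) (g i))"
    by (simp add: act_diff_right act_sum_right act_mult)
  have "generators f I g' k'"
    unfolding generators_def
  proof (intro conjI ballI fin)
    fix i assume "i \<in> I"
    thus "g' i \<in> V" "act (f ^ k' i) (g' i) = 0"
      using v'V v'0 gI by (auto simp: g'_def k'_def)
  next
    fix v assume "v \<in> V"
    then obtain t where t: "v = (\<Sum>i\<in>I. act (t i) (g i))" using span by blast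
    define t' where "t' i = (if i = j then t j * s else t i - (if i \<in> J then t j * s * w i else 0))" for i
    have "v = act (t j) (g j) + (\<Sum>i\<in>I - {j}. act (t i) (g i))"
      using t sum.remove[OF fin jI, of "\<lambda>i. act (t i) (g i)"] by simp
    also have "act (t j) (g j) = act (t j * s) v' - (\<Sum>i\<in>J - {j}. act (t j * s * w i) (g i))"
      by (subst gj) (simp add: act_diff_right act_sum_right act_mult mult.assoc)
    also have "(\<Sum>i\<in>J - {j}. act (t j * s * w i) (g i))
        = (\<Sum>i\<in>I - {j}. act (if i \<in> J then t j * s * w i else 0) (g i))"
      using J fin by (intro sum.mono_neutral_cong_left) auto
    also have "act (t j * s) v' - \<dots> + (\<Sum>i\<in>I - {j}. act (t i) (g i))
        = act (t j * s) v' + (\<Sum>i\<in>I - {j}. act (t i - (if i \<in> J then t j * s * w i else 0)) (g i))"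
      by (simp add: act_diff sum_subtractf)
    also have "\<dots> = act (t' j) (g' j) + (\<Sum>i\<in>I - {j}. act (t' i) (g' i))"
      by (intro arg_cong2[of _ _ _ _ "(+)"] sum.cong) (auto simp: t'_def g'_def)
    also have "\<dots> = (\<Sum>i\<in>I. act (t' i) (g' i))"
      using sum.remove[OF fin jI, of "\<lambda>i. act (t' i) (g' i)"] by simp
    finally show "\<exists>p. v = (\<Sum>i\<in>I. act (p i) (g' i))" by blast
  qed
  moreover have "sum k' I < sum k I"
    using au(1)[OF j(1)] fin jI by (intro sum_strict_mono_ex1) (auto simp: k'_def)
  ultimately show ?thesis by blast
qed

text \<open>All elements of the finite \<open>V\<close>, each with the bound \<open>s\<close>, form
  a generating family. One whose bounds have the least sum admits no improvement, so it has no
  unforced relations. Its generators with bound 0 are zero and are dropped.\<close>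

lemma primary_basis_exists:
  assumes f: "irreducible f" and nil: "\<And>v. v \<in> V \<Longrightarrow> act (f ^ s) v = 0"
  shows "\<exists>(I :: 'v set) g k. primary_basis f I g k \<and> (\<forall>i\<in>I. k i > 0)"
proof -
  let ?P = "\<lambda>(g, k). generators f V g k"
  have "v = (\<Sum>i\<in>V. act (if i = v then 1 else 0) i)" if "v \<in> V" for v
  proof -
    have "(\<Sum>i\<in>V. act (if i = v then 1 else 0) i) = (\<Sum>i\<in>V. if i = v then v else 0)"
      by (intro sum.cong) auto
    thus ?thesis using that V_finite by simp
  qed
  hence "\<exists>p. v = (\<Sum>i\<in>V. act (p i) i)" if "v \<in> V" for v
    using that by (intro exI[of _ "\<lambda>i. if i = v then 1 else 0"])
  hence "generators f V (\<lambda>v. v) (\<lambda>_. s)"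
    unfolding generators_def using nil V_finite by simp
  hence "?P (\<lambda>v. v, \<lambda>_. s)" by simp
  from ex_has_least_nat[of ?P, OF this, of "\<lambda>(g, k). sum k V"] obtain x where
    x: "?P x" "\<forall>y. ?P y \<longrightarrow> (\<lambda>(g, k). sum k V) x \<le> (\<lambda>(g, k). sum k V) y" by blast
  obtain g k where gk': "x = (g, k)" by (cases x)
  have gk: "generators f V g k" using x(1) gk' by simp
  have least: "sum k V \<le> sum k' V" if "generators f V g' k'" for g' k'
    using x(2)[rule_format, of "(g', k')"] that gk' by simp
  have indep: "f ^ k i dvd p i" if "(\<Sum>i\<in>V. act (p i) (g i)) = 0" "i \<in> V" for p i
    using generators_improve[OF f gk that] least by (metis linorder_not_le)
  define I where "I = {i \<in> V. k i > 0}"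
  have g0: "g i = 0" if "i \<in> V" "i \<notin> I" for i
    using gk that by (auto simp: generators_def I_def)
  have sumI: "(\<Sum>i\<in>V. act (p i) (g i)) = (\<Sum>i\<in>I. act (p i) (g i))" for p
    using g0 V_finite by (intro sum.mono_neutral_right) (auto simp: I_def)
  have "primary_basis f I g k"
    using gk indep V_finite unfolding primary_basis_def generators_def sumI by (auto simp: I_def)
  thus ?thesis by (auto simp: I_def)
qed

text \<open>In \<open>K[x]/(f^k)\<close> the kernel of \<open>f^r\<close> consists of the multiples
  of \<open>f^(k - r)\<close>, each given by a unique cofactor of degree below
  \<open>deg f * min r k\<close>. For \<open>r\<close> above \<open>k\<close> the truncated
  difference is 0 and the kernel is everything, as it should be.\<close>

lemma card_kernel_power:
  assumes f: "irreducible f" and pb: "primary_basis f I g k"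
  shows "card {v \<in> V. act (f ^ r) v = 0} = CARD('k) ^ (degree f * (\<Sum>i\<in>I. min r (k i)))"
proof -
  let ?c = "degree f" and ?D = "\<lambda>i. polys_below (degree f * min r (k i)) :: 'k poly set"
  have fin: "finite I" and gI: "\<And>i. i \<in> I \<Longrightarrow> g i \<in> V" "\<And>i. i \<in> I \<Longrightarrow> act (f ^ k i) (g i) = 0"
    and span: "\<And>v. v \<in> V \<Longrightarrow> \<exists>p. v = (\<Sum>i\<in>I. act (p i) (g i))"
    and indep: "\<And>p i. (\<Sum>i\<in>I. act (p i) (g i)) = 0 \<Longrightarrow> i \<in> I \<Longrightarrow> f ^ k i dvd p i"
    using pb by (auto simp: primary_basis_def generators_def)
  have f0: "f \<noteq> 0" using f by auto
  have degf: "degree (f ^ n) = degree f * n" for n using f0 by (simp add: degree_power_eq mult.commute)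
  define F where "F s = (\<Sum>i\<in>I. act (f ^ (k i - r) * s i) (g i))" for s
  have split: "f ^ k i = f ^ (k i - r) * f ^ min r (k i)" for i
  proof -
    have "k i - r + min r (k i) = k i" by simp
    thus ?thesis by (metis power_add)
  qed
  have "bij_betw F (PiE I ?D) {v \<in> V. act (f ^ r) v = 0}"
    unfolding bij_betw_def
  proof (intro conjI inj_onI equalityI subsetI)
    fix s t assume st: "s \<in> PiE I ?D" "t \<in> PiE I ?D" "F s = F t"
    have "(\<Sum>i\<in>I. act (f ^ (k i - r) * (s i - t i)) (g i)) = 0"
      using st(3) by (simp add: F_def right_diff_distrib act_diff sum_subtractf)
    hence d: "f ^ k i dvd f ^ (k i - r) * (s i - t i)" if "i \<in> I" for i
      using indep[of "\<lambda>i. f ^ (k i - r) * (s i - t i)"] that by blast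
    have "s i = t i" if "i \<in> I" for i
    proof -
      have "f ^ min r (k i) dvd s i - t i" using d[OF that] f0 unfolding split by simp
      moreover have "s i - t i \<in> polys_below (degree (f ^ min r (k i)))"
        unfolding degf using st(1,2) that by (intro diff_polys_below) auto
      ultimately have "s i - t i = 0" using polys_below_dvd_eq_0 by blast
      thus ?thesis by simp
    qed
    thus "s = t" using st(1,2) by (intro PiE_ext) auto
  next
    fix v assume "v \<in> F ` PiE I ?D"
    then obtain s where s: "v = F s" by blast
    have "act (f ^ r) (act (f ^ (k i - r) * s i) (g i)) = 0" if "i \<in> I" for i
    proof -
      have "f ^ k i dvd f ^ r * (f ^ (k i - r) * s i)"
        unfolding mult.assoc[symmetric] power_add[symmetric] by (intro dvd_mult2 le_imp_power_dvd) simp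
      thus ?thesis using act_dvd_eq_0 gI(2)[OF that] by (metis act_mult)
    qed
    moreover have "v \<in> V" unfolding s F_def using gI by (intro sum_closed act_closed) auto
    ultimately show "v \<in> {v \<in> V. act (f ^ r) v = 0}" by (simp add: s F_def act_sum_right)
  next
    fix v assume v: "v \<in> {v \<in> V. act (f ^ r) v = 0}"
    then obtain p where p: "v = (\<Sum>i\<in>I. act (p i) (g i))" using span by blast
    have "(\<Sum>i\<in>I. act (f ^ r * p i) (g i)) = 0" using v p by (simp add: act_sum_right act_mult)
    hence d: "f ^ k i dvd f ^ r * p i" if "i \<in> I" for i
      using indep[of "\<lambda>i. f ^ r * p i"] that by blast
    have "\<exists>u. p i = f ^ (k i - r) * u" if "i \<in> I" for i
    proof (cases "k i \<le> r")
      case False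
      hence "f ^ r * f ^ (k i - r) dvd f ^ r * p i" using d[OF that] by (simp flip: power_add)
      thus ?thesis using f0 by (simp add: dvd_def)
    qed simp
    then obtain u where u: "\<And>i. i \<in> I \<Longrightarrow> p i = f ^ (k i - r) * u i" by metis
    define s where "s = (\<lambda>i\<in>I. u i mod f ^ min r (k i))"
    have "s \<in> PiE I ?D"
      using mod_polys_below[of "f ^ min r (k _)"] f0 by (auto simp: s_def degf)
    moreover have "v = F s"
      unfolding p F_def
    proof (intro sum.cong refl)
      fix i assume i: "i \<in> I"
      have "p i - f ^ (k i - r) * s i = f ^ (k i - r) * (u i - u i mod f ^ min r (k i))"
        using i u by (simp add: s_def right_diff_distrib)
      also have "f ^ k i dvd \<dots>" unfolding split by (intro mult_dvd_mono dvd_refl dvd_minus_mod)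
      finally have "act (p i - f ^ (k i - r) * s i) (g i) = 0" using gI(2)[OF i] act_dvd_eq_0 by blast
      thus "act (p i) (g i) = act (f ^ (k i - r) * s i) (g i)" by (simp add: act_diff)
    qed
    ultimately show "v \<in> F ` PiE I ?D" by blast
  qed
  hence "card {v \<in> V. act (f ^ r) v = 0} = card (PiE I ?D)" by (simp add: bij_betw_same_card)
  also have "\<dots> = (\<Prod>i\<in>I. CARD('k) ^ (?c * min r (k i)))"
    by (simp add: card_PiE fin card_polys_below)
  also have "\<dots> = CARD('k) ^ (?c * (\<Sum>i\<in>I. min r (k i)))"
    by (simp add: power_sum sum_distrib_left)
  finally show ?thesis .
qed

end

section \<open>Primary types and primary bases\<close>

definition poly_coset :: "'a::field poly \<Rightarrow> 'a poly \<Rightarrow> 'a poly set" where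
  "poly_coset f p = {y. f dvd y - p}"

lemma poly_coset_self: "p \<in> poly_coset f p"
  by (simp add: poly_coset_def)

lemma poly_coset_eq_iff: "poly_coset f p = poly_coset f r \<longleftrightarrow> f dvd p - r"
proof
  assume "poly_coset f p = poly_coset f r"
  thus "f dvd p - r" using poly_coset_self[of p f] by (simp add: poly_coset_def)
next
  assume d: "f dvd p - r"
  have "f dvd y - p \<longleftrightarrow> f dvd y - r" for y
    using dvd_add_left_iff[OF d, of "y - p"] by simp
  thus "poly_coset f p = poly_coset f r" by (simp add: poly_coset_def)
qed

lemma a_r_coset_eq_poly_coset:
  "PIdl\<^bsub>class_ring\<^esub> f +>\<^bsub>class_ring\<^esub> p = poly_coset f p" for f p :: "'a::field poly"
proof (intro equalityI subsetI)
  fix y assume "y \<in> PIdl\<^bsub>class_ring\<^esub> f +>\<^bsub>class_ring\<^esub> p"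
  then obtain x where "y = x * f + p" by (auto simp: a_r_coset_def' cgenideal_def)
  thus "y \<in> poly_coset f p" by (simp add: poly_coset_def)
next
  fix y assume "y \<in> poly_coset f p"
  hence "f dvd y - p" by (simp add: poly_coset_def)
  then obtain x where "y - p = f * x" by (rule dvdE)
  hence "y = x * f + p" by (simp add: algebra_simps)
  thus "y \<in> PIdl\<^bsub>class_ring\<^esub> f +>\<^bsub>class_ring\<^esub> p" by (auto simp: a_r_coset_def' cgenideal_def)
qed

abbreviation poly_quotient :: "'a::field poly \<Rightarrow> ('a poly, 'a poly set) module" where
  "poly_quotient f \<equiv> quotient_module class_ring (PIdl\<^bsub>class_ring\<^esub> f)"

lemma carrier_poly_quotient: "carrier (poly_quotient f) = range (poly_coset f)"
  by (auto simp: quotient_module_def FactRing_def A_RCOSETS_def' a_r_coset_eq_poly_coset)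

lemma add_poly_quotient:
  "poly_coset f p \<oplus>\<^bsub>poly_quotient f\<^esub> poly_coset f r = poly_coset f (p + r)"
proof -
  have "poly_coset f p \<oplus>\<^bsub>poly_quotient f\<^esub> poly_coset f r
      = {x + y | x y. x \<in> poly_coset f p \<and> y \<in> poly_coset f r}"
    by (auto simp: quotient_module_def FactRing_def set_add_def' )
  also have "\<dots> = poly_coset f (p + r)"
  proof (intro equalityI subsetI)
    fix z assume "z \<in> {x + y | x y. x \<in> poly_coset f p \<and> y \<in> poly_coset f r}"
    then obtain x y where "z = x + y" "f dvd x - p" "f dvd y - r" by (auto simp: poly_coset_def)
    moreover have "x + y - (p + r) = (x - p) + (y - r)" by simp
    ultimately show "z \<in> poly_coset f (p + r)" by (simp only: poly_coset_def mem_Collect_eq dvd_add)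
  next
    fix z assume "z \<in> poly_coset f (p + r)"
    hence "z - r \<in> poly_coset f p" by (simp add: poly_coset_def algebra_simps)
    thus "z \<in> {x + y | x y. x \<in> poly_coset f p \<and> y \<in> poly_coset f r}"
      using poly_coset_self[of r f] by force
  qed
  finally show ?thesis .
qed

text \<open>The product of two cosets is defined as the union of the cosets of all products of
  representatives; these coincide, and the union is not empty.\<close>

lemma smult_poly_quotient:
  "p \<odot>\<^bsub>poly_quotient f\<^esub> poly_coset f r = poly_coset f (p * r)"
proof -
  have "poly_coset f (x * y) = poly_coset f (p * r)"
    if "x \<in> poly_coset f p" "y \<in> poly_coset f r" for x y
  proof -
    have "x * y - p * r = (x - p) * y + p * (y - r)" by (simp add: algebra_simps)
    thus ?thesis using that by (simp only: poly_coset_eq_iff) (simp add: poly_coset_def)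
  qed
  hence "(\<Union>x\<in>poly_coset f p. \<Union>y\<in>poly_coset f r. poly_coset f (x * y))
      = (\<Union>x\<in>poly_coset f p. \<Union>y\<in>poly_coset f r. poly_coset f (p * r))"
    by (intro SUP_cong refl)
  also have "\<dots> = poly_coset f (p * r)" using poly_coset_self by (metis SUP_const empty_iff)
  finally have "(\<Union>x\<in>poly_coset f p. \<Union>y\<in>poly_coset f r. poly_coset f (x * y)) = poly_coset f (p * r)" .
  thus ?thesis
    by (simp add: quotient_module_def FactRing_def rcoset_mult_def a_r_coset_eq_poly_coset)
qed

lemma ex_bij_betw_nth:
  assumes "finite I" "image_mset k (mset_set I) = mset xs"
  shows "\<exists>b. bij_betw b {..<length xs} I \<and> (\<forall>j<length xs. k (b j) = xs ! j)"
proof -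
  obtain ys where ys: "set ys = I" "distinct ys" using finite_distinct_list[OF assms(1)] by blast
  hence "mset_set I = mset ys" using mset_set_set[of ys] by simp
  hence "mset xs = mset (map k ys)" using assms(2) by (simp only: mset_map)
  hence "\<exists>b. bij_betw b {..<length xs} {..<length (map k ys)} \<and> (\<forall>i<length xs. xs ! i = map k ys ! b i)"
    by (rule permutation_Ex_bij)
  then obtain b where b: "bij_betw b {..<length xs} {..<length ys}"
    "\<And>i. i < length xs \<Longrightarrow> xs ! i = map k ys ! b i" unfolding length_map by blast
  have "bij_betw (\<lambda>j. ys ! b j) {..<length xs} I"
    using bij_betw_trans[OF b(1) bij_betw_nth[OF ys(2) refl ys(1)[symmetric]]] by (simp add: comp_def)
  moreover have "k (ys ! b j) = xs ! j" if "j < length xs" for j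
    using b(2)[OF that] bij_betwE[OF b(1)] that by auto
  ultimately show ?thesis by blast
qed

lemma conj_sum_mset_nth: "conj_sum (mset xs) r = (\<Sum>i<length xs. min r (xs ! i))"
proof -
  have "conj_sum (mset xs) r = sum_list (map (min r) xs)"
    by (simp add: conj_sum_def flip: sum_mset_sum_list)
  also have "\<dots> = (\<Sum>i<length xs. min r (xs ! i))"
    by (simp add: sum_list_sum_nth atLeast0LessThan)
  finally show ?thesis .
qed

section \<open>Primary bases recognised by the cardinalities of kernels\<close>

context finite_module
begin

lemma generators_annihilate:
  assumes "generators f I g k" "\<And>i. i \<in> I \<Longrightarrow> k i \<le> r" "v \<in> V"
  shows "act (f ^ r) v = 0"
proof -
  obtain p where p: "v = (\<Sum>i\<in>I. act (p i) (g i))" using assms by (auto simp: generators_def)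
  have "act (f ^ r) (act (p i) (g i)) = 0" if "i \<in> I" for i
  proof -
    have "act (f ^ r) (g i) = 0"
      using assms(1,2) that by (intro act_dvd_eq_0[OF le_imp_power_dvd[of "k i" r f]]) (auto simp: generators_def)
    thus ?thesis by (simp add: mult.commute flip: act_mult) (simp add: act_mult)
  qed
  thus ?thesis by (simp add: p act_sum_right)
qed

lemma primary_basis_reindex:
  assumes "primary_basis f I g k" "bij_betw b J I" "\<And>j. j \<in> J \<Longrightarrow> k' j = k (b j)"
  shows "primary_basis f J (\<lambda>j. g (b j)) k'"
proof -
  have indep: "f ^ k i dvd p i" if "(\<Sum>i\<in>I. act (p i) (g i)) = 0" "i \<in> I" for p i
    using assms(1) that unfolding primary_basis_def by blast
  have bI: "\<And>j. j \<in> J \<Longrightarrow> b j \<in> I" using assms(2) bij_betwE by blast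
  have fin: "finite J" using assms by (auto simp: primary_basis_def generators_def bij_betw_finite)
  have sum: "(\<Sum>i\<in>I. act (p i) (g i)) = (\<Sum>j\<in>J. act (p (b j)) (g (b j)))" for p
    using sum.reindex_bij_betw[OF assms(2), of "\<lambda>i. act (p i) (g i)"] by simp
  have "f ^ k' j dvd p j" if "(\<Sum>j\<in>J. act (p j) (g (b j))) = 0" "j \<in> J" for p j
  proof -
    have inv: "inv_into J b (b j) = j" if "j \<in> J" for j
      using assms(2) that by (meson bij_betw_inv_into_left)
    have "(\<Sum>i\<in>I. act (p (inv_into J b i)) (g i)) = (\<Sum>j\<in>J. act (p j) (g (b j)))"
      unfolding sum by (intro sum.cong refl) (simp add: inv)
    hence "f ^ k (b j) dvd p (inv_into J b (b j))"
      using that(1) by (intro indep bI that(2)) simp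
    thus ?thesis by (simp only: inv[OF that(2)] assms(3)[OF that(2)])
  qed
  moreover have "generators f J (\<lambda>j. g (b j)) k'"
    unfolding generators_def
  proof (intro conjI ballI fin)
    fix v assume "v \<in> V"
    then obtain p where "v = (\<Sum>i\<in>I. act (p i) (g i))"
      using assms(1) by (auto simp: primary_basis_def generators_def)
    hence "v = (\<Sum>j\<in>J. act (p (b j)) (g (b j)))" unfolding sum .
    thus "\<exists>p. v = (\<Sum>j\<in>J. act (p j) (g (b j)))" by (rule exI[of _ "\<lambda>j. p (b j)"])
  qed (use assms bI in \<open>auto simp: primary_basis_def generators_def\<close>)
  ultimately show ?thesis unfolding primary_basis_def by blast
qed

text \<open>From left to right this is the kernel count. Conversely, the cardinalities force some
  power of \<open>f\<close> to vanish on \<open>V\<close>, so some primary basis exists; its orders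
  have the same \<open>conj_sum\<close> as the partition, hence are its parts up to a
  reindexing.\<close>

lemma primary_basis_iff_card_kernel:
  assumes f: "irreducible f" and \<nu>: "is_partition \<nu>"
  shows "(\<exists>g. primary_basis f {..<length \<nu>} g (\<lambda>i. \<nu> ! i)) \<longleftrightarrow>
    card V = CARD('k) ^ (degree f * sum_list \<nu>) \<and>
    (\<forall>r. card {v \<in> V. act (f ^ r) v = 0} = CARD('k) ^ (degree f * conj_sum (mset \<nu>) r))"
    (is "?L \<longleftrightarrow> ?R")
proof
  assume ?L
  then obtain g where pb: "primary_basis f {..<length \<nu>} g (\<lambda>i. \<nu> ! i)" by blast
  have cards: "card {v \<in> V. act (f ^ r) v = 0} = CARD('k) ^ (degree f * conj_sum (mset \<nu>) r)" for r
    unfolding conj_sum_mset_nth by (rule card_kernel_power[OF f pb])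
  \<comment> \<open>This exponent bounds every part, so the kernel of \<open>f^?r\<close> is already
    all of \<open>V\<close>.\<close>
  let ?r = "sum_list \<nu>"
  have le: "k \<le> ?r" if "k \<in> set \<nu>" for k using that member_le_sum_list by blast
  have "act (f ^ ?r) v = 0" if "v \<in> V" for v
    using pb that le by (intro generators_annihilate[of f "{..<length \<nu>}" g "\<lambda>i. \<nu> ! i"])
      (auto simp: primary_basis_def)
  hence "{v \<in> V. act (f ^ ?r) v = 0} = V" by blast
  moreover have "conj_sum (mset \<nu>) ?r = sum_list \<nu>"
    using le conj_sum_eventually[of "mset \<nu>" ?r] by (simp add: sum_mset_sum_list)
  ultimately show ?R using cards cards[of ?r] by simp
next
  assume R: ?R
  let ?r = "sum_list \<nu>"
  have le: "k \<le> ?r" if "k \<in> set \<nu>" for k using that member_le_sum_list by blast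
  have "conj_sum (mset \<nu>) ?r = sum_list \<nu>"
    using le conj_sum_eventually[of "mset \<nu>" ?r] by (simp add: sum_mset_sum_list)
  hence "card {v \<in> V. act (f ^ ?r) v = 0} = card V" using R by simp
  hence "{v \<in> V. act (f ^ ?r) v = 0} = V" using V_finite by (intro card_subset_eq) auto
  hence "\<And>v. v \<in> V \<Longrightarrow> act (f ^ ?r) v = 0" by blast
  from primary_basis_exists[OF f this] obtain I :: "'v set" and g k where
    pb: "primary_basis f I g k" and k: "\<And>i. i \<in> I \<Longrightarrow> k i > 0" by blast
  have fin: "finite I" using pb by (simp add: primary_basis_def generators_def)
  have "degree f > 0" using f by (metis is_unit_iff_degree irreducible_def neq0_conv)
  have "(\<Sum>i\<in>I. min r (k i)) = conj_sum (mset \<nu>) r" for r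
  proof -
    have "CARD('k) ^ (degree f * (\<Sum>i\<in>I. min r (k i))) = CARD('k) ^ (degree f * conj_sum (mset \<nu>) r)"
      using card_kernel_power[OF f pb, of r] R by simp
    hence "degree f * (\<Sum>i\<in>I. min r (k i)) = degree f * conj_sum (mset \<nu>) r"
      by (rule power_inject_exp[OF CARD_field_gt_1, THEN iffD1])
    thus ?thesis using \<open>degree f > 0\<close> by simp
  qed
  hence "conj_sum (image_mset k (mset_set I)) r = conj_sum (mset \<nu>) r" for r
    by (simp add: conj_sum_def[of "image_mset k (mset_set I)"] sum_unfold_sum_mset comp_def
        image_mset.compositionality)
  hence "repeat_mset 1 (image_mset k (mset_set I)) = repeat_mset 1 (mset \<nu>)"
  proof (intro conj_sum_eq_imp)
    have "k i \<noteq> 0" if "i \<in> I" for i using k[OF that] by simp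
    thus "0 \<notin># image_mset k (mset_set I)" using fin by fastforce
    show "0 \<notin># mset \<nu>" using \<nu> by (auto simp: is_partition_def)
  qed simp
  hence "image_mset k (mset_set I) = mset \<nu>" by simp
  from ex_bij_betw_nth[OF fin this] obtain b where
    "bij_betw b {..<length \<nu>} I" "\<And>j. j < length \<nu> \<Longrightarrow> k (b j) = \<nu> ! j" by blast
  thus ?L using primary_basis_reindex[OF pb, of b "{..<length \<nu>}" "\<lambda>i. \<nu> ! i"] by auto
qed

end

section \<open>Matrices of operators on abstract finite modules, and sums of cyclic modules\<close>

locale matrix_rep = finite_module scale A V
  for scale :: "'k::finite_field \<Rightarrow> 'v::ab_group_add \<Rightarrow> 'v" (infixr \<open>*s\<close> 75) and A V +
  fixes n :: nat and M :: "'k mat" and \<rho> :: "'k vec \<Rightarrow> 'v"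
  assumes M: "M \<in> carrier_mat n n"
    and \<rho>_bij: "bij_betw \<rho> (carrier_vec n) V"
    and \<rho>_add: "u \<in> carrier_vec n \<Longrightarrow> v \<in> carrier_vec n \<Longrightarrow> \<rho> (u + v) = \<rho> u + \<rho> v"
    and \<rho>_smult: "v \<in> carrier_vec n \<Longrightarrow> \<rho> (a \<cdot>\<^sub>v v) = a *s \<rho> v"
    and \<rho>_mult: "v \<in> carrier_vec n \<Longrightarrow> \<rho> (M *\<^sub>v v) = A (\<rho> v)"
begin

lemma \<rho>_zero: "\<rho> (0\<^sub>v n) = 0"
  using \<rho>_add[of "0\<^sub>v n" "0\<^sub>v n"] by simp

lemma \<rho>_finsum:
  "finite F \<Longrightarrow> (\<And>i. i \<in> F \<Longrightarrow> x i \<in> carrier_vec n) \<Longrightarrow>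
    \<rho> (finsum_vec TYPE('k) n x F) = (\<Sum>i\<in>F. \<rho> (x i))"
proof (induction F rule: finite_induct)
  case empty
  thus ?case by (simp add: finsum_vec_empty \<rho>_zero)
next
  case (insert i F)
  have "finsum_vec TYPE('k) n x (insert i F) = x i + finsum_vec TYPE('k) n x F"
    using insert by (intro finsum_vec_insert) auto
  moreover have "finsum_vec TYPE('k) n x F \<in> carrier_vec n"
    using insert by (intro finsum_vec_closed) auto
  ultimately show ?case using insert by (simp add: \<rho>_add)
qed

lemma pow_closed: "v \<in> carrier_vec n \<Longrightarrow> (M ^\<^sub>m i) *\<^sub>v v \<in> carrier_vec n"
  using M by (auto intro!: mult_mat_vec_carrier pow_carrier_mat)

lemma \<rho>_pow: "v \<in> carrier_vec n \<Longrightarrow> \<rho> ((M ^\<^sub>m i) *\<^sub>v v) = (A ^^ i) (\<rho> v)"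
proof (induction i arbitrary: v)
  case 0
  thus ?case using M by simp
next
  case (Suc i)
  have "(M ^\<^sub>m Suc i) *\<^sub>v v = (M ^\<^sub>m i) *\<^sub>v (M *\<^sub>v v)"
    using M Suc.prems by (simp add: assoc_mult_mat_vec[of _ n n _ n])
  moreover have "M *\<^sub>v v \<in> carrier_vec n" using M Suc.prems by (rule mult_mat_vec_carrier)
  ultimately show ?case using Suc by (simp add: \<rho>_mult funpow_swap1)
qed

lemma smult_matrix_module:
  assumes "v \<in> carrier_vec n"
  shows "p \<odot>\<^bsub>matrix_module M\<^esub> v \<in> carrier_vec n" "\<rho> (p \<odot>\<^bsub>matrix_module M\<^esub> v) = act p (\<rho> v)"
proof -
  have eq: "p \<odot>\<^bsub>matrix_module M\<^esub> v
      = finsum_vec TYPE('k) n (\<lambda>i. coeff p i \<cdot>\<^sub>v ((M ^\<^sub>m i) *\<^sub>v v)) {..degree p}"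
    using M by (simp add: matrix_module_def Let_def)
  have cl: "coeff p i \<cdot>\<^sub>v ((M ^\<^sub>m i) *\<^sub>v v) \<in> carrier_vec n" for i
    using pow_closed[OF assms] by (rule smult_carrier_vec[THEN iffD2])
  show "p \<odot>\<^bsub>matrix_module M\<^esub> v \<in> carrier_vec n"
    unfolding eq using cl by (intro finsum_vec_closed) auto
  show "\<rho> (p \<odot>\<^bsub>matrix_module M\<^esub> v) = act p (\<rho> v)"
    unfolding eq act_def using cl pow_closed[OF assms] assms
    by (subst \<rho>_finsum) (auto simp: \<rho>_smult \<rho>_pow)
qed

lemma carrier_matrix_module: "carrier (matrix_module M) = carrier_vec n"
  using M by (simp add: matrix_module_def Let_def)

lemma add_matrix_module: "u \<oplus>\<^bsub>matrix_module M\<^esub> v = u + v"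
  by (simp add: matrix_module_def Let_def)

context
  fixes J :: "nat set" and N :: "nat \<Rightarrow> 'k poly"
begin

abbreviation DS where "DS \<equiv> direct_sum_module J (\<lambda>j. poly_quotient (N j))"

definition cosets :: "(nat \<Rightarrow> 'k poly) \<Rightarrow> nat \<Rightarrow> 'k poly set" where
  "cosets p = (\<lambda>j\<in>J. poly_coset (N j) (p j))"

lemma carrier_DS: "carrier DS = range cosets"
proof (intro equalityI subsetI)
  fix x assume x: "x \<in> carrier DS"
  hence "\<forall>j\<in>J. \<exists>p. x j = poly_coset (N j) p"
    by (auto simp: direct_sum_module_def carrier_poly_quotient PiE_iff)
  then obtain p where "\<And>j. j \<in> J \<Longrightarrow> x j = poly_coset (N j) (p j)" by metis
  hence "x = cosets p" using x
    by (intro ext) (auto simp: cosets_def direct_sum_module_def PiE_iff extensional_def)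
  thus "x \<in> range cosets" by blast
qed (auto simp: direct_sum_module_def carrier_poly_quotient cosets_def)

lemma add_DS: "cosets p \<oplus>\<^bsub>DS\<^esub> cosets r = cosets (\<lambda>j. p j + r j)"
  by (auto simp: direct_sum_module_def cosets_def add_poly_quotient intro!: restrict_ext)

lemma smult_DS: "s \<odot>\<^bsub>DS\<^esub> cosets r = cosets (\<lambda>j. s * r j)"
  by (auto simp: direct_sum_module_def cosets_def smult_poly_quotient intro!: restrict_ext)

lemma cosets_eq_iff: "cosets p = cosets r \<longleftrightarrow> (\<forall>j\<in>J. N j dvd p j - r j)"
proof
  assume eq: "cosets p = cosets r"
  show "\<forall>j\<in>J. N j dvd p j - r j"
  proof
    fix j assume "j \<in> J"
    thus "N j dvd p j - r j" using fun_cong[OF eq, of j] by (simp add: cosets_def poly_coset_eq_iff)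
  qed
next
  assume "\<forall>j\<in>J. N j dvd p j - r j"
  thus "cosets p = cosets r" unfolding cosets_def
    by (intro restrict_ext) (simp only: poly_coset_eq_iff)
qed

text \<open>A vector is sent to the cosets of the coefficients in any expansion of it. Two
  expansions have the same sum exactly if their coset tuples agree, which gives both
  well-definedness and injectivity.\<close>

lemma isomorphic_DS_if_basis:
  assumes gV: "\<And>j. j \<in> J \<Longrightarrow> g j \<in> V" and ann: "\<And>j. j \<in> J \<Longrightarrow> act (N j) (g j) = 0"
    and span: "\<And>v. v \<in> V \<Longrightarrow> \<exists>p. v = (\<Sum>j\<in>J. act (p j) (g j))"
    and indep: "\<And>p j. (\<Sum>j\<in>J. act (p j) (g j)) = 0 \<Longrightarrow> j \<in> J \<Longrightarrow> N j dvd p j"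
  shows "module_isomorphic class_ring (matrix_module M) DS"
proof -
  let ?s = "\<lambda>p. \<Sum>j\<in>J. act (p j) (g j)"
  have s_eq_iff: "?s p = ?s r \<longleftrightarrow> cosets p = cosets r" for p r
  proof -
    have "?s p - ?s r = ?s (\<lambda>j. p j - r j)" by (simp add: act_diff sum_subtractf)
    moreover have "?s (\<lambda>j. p j - r j) = 0 \<longleftrightarrow> (\<forall>j\<in>J. N j dvd p j - r j)"
    proof
      assume "?s (\<lambda>j. p j - r j) = 0"
      thus "\<forall>j\<in>J. N j dvd p j - r j" using indep[of "\<lambda>j. p j - r j"] by blast
    next
      assume "\<forall>j\<in>J. N j dvd p j - r j"
      hence "act (p j - r j) (g j) = 0" if "j \<in> J" for j
        using that ann[OF that] act_dvd_eq_0 by blast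
      thus "?s (\<lambda>j. p j - r j) = 0" by (intro sum.neutral ballI)
    qed
    ultimately show ?thesis unfolding cosets_eq_iff using right_minus_eq[of "?s p" "?s r"] by argo
  qed
  define \<phi> where "\<phi> v = cosets (SOME p. \<rho> v = ?s p)" for v
  have \<phi>: "\<phi> v = cosets p" if "\<rho> v = ?s p" for v p
  proof -
    have "\<rho> v = ?s (SOME p. \<rho> v = ?s p)" using that by (rule someI[of "\<lambda>p. \<rho> v = ?s p"])
    hence "?s (SOME p. \<rho> v = ?s p) = ?s p" using that by (rule trans[OF sym])
    thus ?thesis unfolding \<phi>_def by (rule s_eq_iff[THEN iffD1])
  qed
  have rep: "\<exists>p. \<rho> v = ?s p" if "v \<in> carrier_vec n" for v
    using span[of "\<rho> v"] bij_betwE[OF \<rho>_bij] that by blast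
  have "\<phi> \<in> module_hom class_ring (matrix_module M) DS"
    unfolding module_hom_def carrier_matrix_module carrier_DS
  proof (intro CollectI conjI allI impI)
    show "\<phi> \<in> carrier_vec n \<rightarrow> range cosets" by (auto simp: \<phi>_def)
  next
    fix v w :: "'k vec" assume "v \<in> carrier_vec n \<and> w \<in> carrier_vec n"
    hence v: "v \<in> carrier_vec n" and w: "w \<in> carrier_vec n" by auto
    obtain p r where pr: "\<rho> v = ?s p" "\<rho> w = ?s r" using rep v w by meson
    have "\<rho> (v + w) = ?s (\<lambda>j. p j + r j)" using v w pr by (simp add: \<rho>_add act_add sum.distrib)
    from \<phi>[OF this] show "\<phi> (v \<oplus>\<^bsub>matrix_module M\<^esub> w) = \<phi> v \<oplus>\<^bsub>DS\<^esub> \<phi> w"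
      unfolding \<phi>[OF pr(1)] \<phi>[OF pr(2)] add_DS add_matrix_module .
  next
    fix s :: "'k poly" and v :: "'k vec" assume "s \<in> carrier class_ring \<and> v \<in> carrier_vec n"
    hence v: "v \<in> carrier_vec n" by simp
    obtain p where p: "\<rho> v = ?s p" using rep v by meson
    have "\<rho> (s \<odot>\<^bsub>matrix_module M\<^esub> v) = ?s (\<lambda>j. s * p j)"
      by (simp add: smult_matrix_module[OF v] p act_sum_right act_mult)
    from \<phi>[OF this] show "\<phi> (s \<odot>\<^bsub>matrix_module M\<^esub> v) = s \<odot>\<^bsub>DS\<^esub> \<phi> v"
      unfolding \<phi>[OF p] smult_DS .
  qed
  moreover have "bij_betw \<phi> (carrier_vec n) (range cosets)"
    unfolding bij_betw_def
  proof (intro conjI inj_onI equalityI subsetI)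
    fix v w assume vw: "v \<in> carrier_vec n" "w \<in> carrier_vec n" "\<phi> v = \<phi> w"
    obtain p r where pr: "\<rho> v = ?s p" "\<rho> w = ?s r" using rep vw by meson
    hence "cosets p = cosets r" using vw(3) unfolding \<phi>[OF pr(1)] \<phi>[OF pr(2)] by simp
    hence "\<rho> v = \<rho> w" unfolding pr by (rule s_eq_iff[THEN iffD2])
    thus "v = w" using \<rho>_bij vw(1,2) by (auto simp: bij_betw_def inj_on_def)
  next
    fix x assume "x \<in> range cosets"
    then obtain p where p: "x = cosets p" by blast
    have "?s p \<in> V" using gV by (intro sum_closed act_closed)
    then obtain v where v: "v \<in> carrier_vec n" "?s p = \<rho> v"
      unfolding bij_betw_imp_surj_on[OF \<rho>_bij, symmetric] by (rule imageE)
    have "x = \<phi> v" unfolding p using \<phi>[OF v(2)[symmetric]] by (rule sym)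
    thus "x \<in> \<phi> ` carrier_vec n" using v(1) by (rule image_eqI)
  qed (auto simp: \<phi>_def)
  ultimately show ?thesis
    unfolding module_isomorphic_def carrier_matrix_module carrier_DS by blast
qed

text \<open>The basis consists of the preimages of the tuples with one entry 1 and all others
  0.\<close>

lemma basis_if_isomorphic_DS:
  assumes fin: "finite J" and iso: "module_isomorphic class_ring (matrix_module M) DS"
  shows "\<exists>g. (\<forall>j\<in>J. g j \<in> V \<and> act (N j) (g j) = 0) \<and> (\<forall>v\<in>V. \<exists>p. v = (\<Sum>j\<in>J. act (p j) (g j))) \<and>
    (\<forall>p. (\<Sum>j\<in>J. act (p j) (g j)) = 0 \<longrightarrow> (\<forall>j\<in>J. N j dvd p j))"
proof -
  obtain \<phi> where hom: "\<phi> \<in> module_hom class_ring (matrix_module M) DS"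
    and bij: "bij_betw \<phi> (carrier_vec n) (range cosets)"
    using iso unfolding module_isomorphic_def carrier_matrix_module carrier_DS by blast
  define \<sigma> where "\<sigma> = inv_into (carrier_vec n) \<rho>"
  have \<sigma>: "\<sigma> v \<in> carrier_vec n" "\<rho> (\<sigma> v) = v" if "v \<in> V" for v
    using \<rho>_bij that unfolding \<sigma>_def by (auto simp: bij_betw_def inv_into_into f_inv_into_f)
  have \<sigma>_eq: "\<sigma> (\<rho> u) = u" if "u \<in> carrier_vec n" for u
    using \<rho>_bij that unfolding \<sigma>_def by (simp add: bij_betw_def)
  define \<chi> where "\<chi> v = \<phi> (\<sigma> v)" for v
  have "bij_betw \<sigma> V (carrier_vec n)" unfolding \<sigma>_def by (rule bij_betw_inv_into[OF \<rho>_bij])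
  hence \<chi>_bij: "bij_betw \<chi> V (range cosets)"
    using bij_betw_trans[OF _ bij, of \<sigma> V] by (simp add: \<chi>_def[abs_def] comp_def)
  have \<chi>_add: "\<chi> (v + w) = \<chi> v \<oplus>\<^bsub>DS\<^esub> \<chi> w" if "v \<in> V" "w \<in> V" for v w
  proof -
    have "\<sigma> (v + w) = \<sigma> v + \<sigma> w"
      using \<sigma>_eq[of "\<sigma> v + \<sigma> w"] \<sigma>[OF that(1)] \<sigma>[OF that(2)] by (simp add: \<rho>_add)
    thus ?thesis using module_hom_add[OF hom, of "\<sigma> v" "\<sigma> w"] \<sigma> that
      by (simp add: \<chi>_def add_matrix_module carrier_matrix_module)
  qed
  have \<chi>_act: "\<chi> (act p v) = p \<odot>\<^bsub>DS\<^esub> \<chi> v" if "v \<in> V" for p v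
  proof -
    have "\<sigma> (act p v) = p \<odot>\<^bsub>matrix_module M\<^esub> \<sigma> v"
      using \<sigma>_eq[of "p \<odot>\<^bsub>matrix_module M\<^esub> \<sigma> v"] smult_matrix_module[of "\<sigma> v" p] \<sigma>[OF that] by simp
    thus ?thesis using module_hom_smult[OF hom, of p "\<sigma> v"] \<sigma> that
      by (simp add: \<chi>_def carrier_matrix_module)
  qed
  have \<chi>_0: "\<chi> 0 = cosets (\<lambda>_. 0)"
  proof -
    have "0 \<in> V" by (rule subspace_0[OF V_subspace])
    moreover from this obtain p where "\<chi> 0 = cosets p" using \<chi>_bij by (auto simp: bij_betw_def)
    ultimately show ?thesis using \<chi>_act[of 0 0] by (simp add: smult_DS)
  qed
  have "\<forall>j. \<exists>v\<in>V. \<chi> v = cosets (\<lambda>i. if i = j then 1 else 0)"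
  proof
    fix j
    have "cosets (\<lambda>i. if i = j then 1 else 0) \<in> \<chi> ` V"
      unfolding bij_betw_imp_surj_on[OF \<chi>_bij] by (rule rangeI)
    thus "\<exists>v\<in>V. \<chi> v = cosets (\<lambda>i. if i = j then 1 else 0)" by (rule imageE) (rule bexI, rule sym)
  qed
  from choice[OF this[unfolded Bex_def]] obtain g where
    g: "\<forall>j. g j \<in> V \<and> \<chi> (g j) = cosets (\<lambda>i. if i = j then 1 else 0)" by (rule exE)
  have gV: "g j \<in> V" and \<chi>g: "\<chi> (g j) = cosets (\<lambda>i. if i = j then 1 else 0)" for j
    using g by blast+
  \<comment> \<open>Partial index sets \<open>S\<close> are allowed for the sake of the induction;
    coefficients outside \<open>S\<close> count as 0.\<close>
  have \<chi>_sum: "\<chi> (\<Sum>j\<in>S. act (p j) (g j)) = cosets (\<lambda>i. if i \<in> S then p i else 0)" if "finite S" for S p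
    using that
  proof (induction S rule: finite_induct)
    case empty
    thus ?case by (simp add: \<chi>_0)
  next
    case (insert j S)
    have "\<chi> (\<Sum>i\<in>insert j S. act (p i) (g i)) = \<chi> (act (p j) (g j)) \<oplus>\<^bsub>DS\<^esub> \<chi> (\<Sum>i\<in>S. act (p i) (g i))"
      using insert gV by (simp add: \<chi>_add act_closed sum_closed)
    also have "\<dots> = cosets (\<lambda>i. p j * (if i = j then 1 else 0) + (if i \<in> S then p i else 0))"
      by (simp add: \<chi>_act gV \<chi>g smult_DS insert.IH add_DS)
    also have "(\<lambda>i. p j * (if i = j then 1 else 0) + (if i \<in> S then p i else 0))
        = (\<lambda>i. if i \<in> insert j S then p i else 0)"
      using insert by (intro ext) auto
    finally show ?case .
  qed
  have sumJ: "\<chi> (\<Sum>j\<in>J. act (p j) (g j)) = cosets p" for p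
    unfolding \<chi>_sum[OF fin] by (auto simp: cosets_eq_iff)
  have sV: "(\<Sum>j\<in>J. act (p j) (g j)) \<in> V" for p using gV by (intro sum_closed act_closed)
  have inj: "v = w" if "\<chi> v = \<chi> w" "v \<in> V" "w \<in> V" for v w
    using \<chi>_bij that by (auto simp: bij_betw_def inj_on_def)
  have V0: "0 \<in> V" by (rule subspace_0[OF V_subspace])
  show ?thesis
  proof (intro exI[of _ g] conjI ballI allI impI)
    fix j assume "j \<in> J"
    show "g j \<in> V" by (rule gV)
    have "\<chi> (act (N j) (g j)) = \<chi> 0"
      by (simp add: \<chi>_act gV \<chi>g smult_DS \<chi>_0 cosets_eq_iff)
    thus "act (N j) (g j) = 0" using inj act_closed gV V0 by blast
  next
    fix v assume v: "v \<in> V"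
    then obtain p where "\<chi> v = cosets p" using \<chi>_bij by (auto simp: bij_betw_def)
    hence "v = (\<Sum>j\<in>J. act (p j) (g j))" by (intro inj v sV) (simp only: sumJ)
    thus "\<exists>p. v = (\<Sum>j\<in>J. act (p j) (g j))" by blast
  next
    fix p j assume "(\<Sum>j\<in>J. act (p j) (g j)) = 0" "j \<in> J"
    hence "cosets p = cosets (\<lambda>_. 0)" using sumJ[of p] \<chi>_0 by simp
    thus "N j dvd p j" using \<open>j \<in> J\<close> by (simp add: cosets_eq_iff)
  qed
qed

end

lemma has_primary_type_iff_basis:
  "has_primary_type M (c, \<nu>) \<longleftrightarrow> (\<exists>f g. monic f \<and> irreducible f \<and> degree f = c \<and>
     primary_basis f {..<length \<nu>} g (\<lambda>i. \<nu> ! i))"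
proof -
  have "square_mat M" using M by auto
  moreover have "module_isomorphic class_ring (matrix_module M)
      (direct_sum_module {..<length \<nu>} (\<lambda>j. poly_quotient (f ^ (\<nu> ! j)))) \<longleftrightarrow>
    (\<exists>g. primary_basis f {..<length \<nu>} g (\<lambda>i. \<nu> ! i))" for f
  proof
    assume "module_isomorphic class_ring (matrix_module M)
      (direct_sum_module {..<length \<nu>} (\<lambda>j. poly_quotient (f ^ (\<nu> ! j))))"
    from basis_if_isomorphic_DS[OF finite_lessThan this]
    show "\<exists>g. primary_basis f {..<length \<nu>} g (\<lambda>i. \<nu> ! i)"
      unfolding primary_basis_def generators_def by simp
  next
    assume "\<exists>g. primary_basis f {..<length \<nu>} g (\<lambda>i. \<nu> ! i)"
    then obtain g where "primary_basis f {..<length \<nu>} g (\<lambda>i. \<nu> ! i)" by blast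
    thus "module_isomorphic class_ring (matrix_module M)
      (direct_sum_module {..<length \<nu>} (\<lambda>j. poly_quotient (f ^ (\<nu> ! j))))"
      unfolding primary_basis_def generators_def
      by (intro isomorphic_DS_if_basis[of "{..<length \<nu>}" g]) auto
  qed
  ultimately show ?thesis by auto
qed

theorem has_primary_type_iff_card:
  assumes "is_partition \<nu>"
  shows "has_primary_type M (c, \<nu>) \<longleftrightarrow> (\<exists>f. monic f \<and> irreducible f \<and> degree f = c \<and>
     card V = CARD('k) ^ (c * sum_list \<nu>) \<and>
     (\<forall>r. card {v \<in> V. act (f ^ r) v = 0} = CARD('k) ^ (c * conj_sum (mset \<nu>) r)))"
  unfolding has_primary_type_iff_basis
proof (rule arg_cong[where f = Ex], rule ext)
  fix f :: "'k poly"
  show "(\<exists>g. monic f \<and> irreducible f \<and> degree f = c \<and> primary_basis f {..<length \<nu>} g (\<lambda>i. \<nu> ! i)) \<longleftrightarrow>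
    monic f \<and> irreducible f \<and> degree f = c \<and> card V = CARD('k) ^ (c * sum_list \<nu>) \<and>
    (\<forall>r. card {v \<in> V. act (f ^ r) v = 0} = CARD('k) ^ (c * conj_sum (mset \<nu>) r))"
    using primary_basis_iff_card_kernel[OF _ assms, of f] by (cases "irreducible f") auto
qed

end

section \<open>Matrices of linear operators\<close>

lemma bij_betw_vec_PiE: "bij_betw (\<lambda>v. \<lambda>i\<in>{..<n}. v $ i) (carrier_vec n :: 'a vec set) (PiE {..<n} (\<lambda>_. UNIV))"
proof (rule bij_betw_byWitness[where f' = "\<lambda>x. vec n x"])
  show "\<forall>v\<in>(carrier_vec n :: 'a vec set). vec n (\<lambda>i\<in>{..<n}. v $ i) = v"
    by (intro ballI eq_vecI) simp_all
  show "\<forall>x\<in>PiE {..<n} (\<lambda>_. UNIV :: 'a set). (\<lambda>i\<in>{..<n}. vec n x $ i) = x"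
  proof
    fix x :: "nat \<Rightarrow> 'a" assume "x \<in> PiE {..<n} (\<lambda>_. UNIV)"
    thus "(\<lambda>i\<in>{..<n}. vec n x $ i) = x"
      by (intro PiE_ext[of "restrict (($) (vec n x)) {..<n}" "{..<n}" "\<lambda>_. UNIV"]) simp_all
  qed
  show "(\<lambda>v. \<lambda>i\<in>{..<n}. v $ i) ` (carrier_vec n :: 'a vec set) \<subseteq> PiE {..<n} (\<lambda>_. UNIV)"
    by (intro image_subsetI restrict_PiE_iff[THEN iffD2] ballI UNIV_I)
  show "vec n ` PiE {..<n} (\<lambda>_. UNIV :: 'a set) \<subseteq> carrier_vec n"
    by (intro image_subsetI vec_carrier)
qed

lemma card_carrier_vec: "card (carrier_vec n :: 'a::finite vec set) = CARD('a) ^ n"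
  using bij_betw_same_card[OF bij_betw_vec_PiE[of n, where 'a = 'a]] by (simp add: card_PiE)

lemma finite_carrier_vec: "finite (carrier_vec n :: 'a::finite vec set)"
proof -
  have "finite (PiE {..<n} (\<lambda>_. UNIV) :: (nat \<Rightarrow> 'a) set)" by (intro finite_PiE) auto
  thus ?thesis using bij_betw_finite[OF bij_betw_vec_PiE[of n, where 'a = 'a]] by simp
qed

lemma ex_mat_of_linear:
  fixes T :: "'a::field vec \<Rightarrow> 'a vec"
  assumes cl: "\<And>v. v \<in> carrier_vec n \<Longrightarrow> T v \<in> carrier_vec n"
    and add: "\<And>u v. u \<in> carrier_vec n \<Longrightarrow> v \<in> carrier_vec n \<Longrightarrow> T (u + v) = T u + T v"
    and smult: "\<And>a v. v \<in> carrier_vec n \<Longrightarrow> T (a \<cdot>\<^sub>v v) = a \<cdot>\<^sub>v T v"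
  shows "\<exists>P\<in>carrier_mat n n. \<forall>v\<in>carrier_vec n. P *\<^sub>v v = T v"
proof (intro bexI ballI)
  define P where "P = mat n n (\<lambda>(i, j). T (unit_vec n j) $ i)"
  show "P \<in> carrier_mat n n" by (simp add: P_def)
  fix v :: "'a vec" assume v: "v \<in> carrier_vec n"
  \<comment> \<open>\<open>w k\<close> is \<open>v\<close> cut off after its first \<open>k\<close>
    coordinates, so the expansion of \<open>T v\<close> is built up one unit vector at a
    time.\<close>
  define w where "w k = vec n (\<lambda>i. if i < k then v $ i else 0)" for k
  have w: "w k \<in> carrier_vec n" for k by (simp add: w_def)
  have T0: "T (0\<^sub>v n) = 0\<^sub>v n"
  proof -
    have "0 \<cdot>\<^sub>v w = 0\<^sub>v n" if "w \<in> carrier_vec n" for w :: "'a vec"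
      using that by (intro eq_vecI) auto
    thus ?thesis using smult[of "0\<^sub>v n" 0] cl[of "0\<^sub>v n"] by simp
  qed
  have partial: "T (w k) $ i = (\<Sum>j<k. P $$ (i, j) * v $ j)" if "k \<le> n" "i < n" for k i
    using that(1)
  proof (induction k)
    case 0
    have "w 0 = 0\<^sub>v n" by (auto simp: w_def)
    thus ?case using T0 that(2) by simp
  next
    case (Suc k)
    have "w (Suc k) = w k + v $ k \<cdot>\<^sub>v unit_vec n k"
      using Suc.prems by (intro eq_vecI) (auto simp: w_def unit_vec_def less_Suc_eq)
    hence "T (w (Suc k)) = T (w k) + v $ k \<cdot>\<^sub>v T (unit_vec n k)"
      using w by (simp add: add smult)
    moreover have "T (unit_vec n k) \<in> carrier_vec n" "T (w k) \<in> carrier_vec n" using cl w by auto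
    ultimately show ?case
      using Suc that(2) by (simp add: P_def mult.commute)
  qed
  have "w n = v" using v by (intro eq_vecI) (auto simp: w_def)
  hence Tv: "T v $ i = (\<Sum>j<n. P $$ (i, j) * v $ j)" if "i < n" for i
    using partial[of n i] that by simp
  show "P *\<^sub>v v = T v"
  proof (rule eq_vecI)
    show "dim_vec (P *\<^sub>v v) = dim_vec (T v)" using cl[OF v] by (simp add: P_def)
    fix i assume "i < dim_vec (T v)"
    hence i: "i < n" using cl[OF v] by simp
    have "(P *\<^sub>v v) $ i = (\<Sum>j<n. P $$ (i, j) * v $ j)"
      using i v by (simp add: P_def scalar_prod_def atLeast0LessThan)
    thus "(P *\<^sub>v v) $ i = T v $ i" using Tv[OF i] by simp
  qed
qed

lemma mat_eqI_mult_vec: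
  fixes A B :: "'a::field mat"
  assumes "A \<in> carrier_mat n n" "B \<in> carrier_mat n n"
    "\<And>v. v \<in> carrier_vec n \<Longrightarrow> A *\<^sub>v v = B *\<^sub>v v"
  shows "A = B"
proof (rule eq_matI)
  fix i j assume "i < dim_row B" "j < dim_col B"
  hence ij: "i < n" "j < n" using assms by auto
  have "(A *\<^sub>v unit_vec n j) $ i = (B *\<^sub>v unit_vec n j) $ i" using assms(3) by simp
  thus "A $$ (i, j) = B $$ (i, j)" using assms(1,2) ij by simp
qed (use assms in auto)

context vector_space
begin

definition coord_map :: "'b set \<Rightarrow> nat \<Rightarrow> ('a vec \<Rightarrow> 'b) \<Rightarrow> bool" where
  "coord_map V n \<rho> \<longleftrightarrow> bij_betw \<rho> (carrier_vec n) V \<and>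
    (\<forall>u\<in>carrier_vec n. \<forall>v\<in>carrier_vec n. \<rho> (u + v) = \<rho> u + \<rho> v) \<and>
    (\<forall>a. \<forall>v\<in>carrier_vec n. \<rho> (a \<cdot>\<^sub>v v) = scale a (\<rho> v))"

end

lemma (in matrix_rep) coord_map: "coord_map V n \<rho>"
  unfolding coord_map_def using \<rho>_bij \<rho>_add \<rho>_smult by blast

text \<open>Two cases are needed: the identity for \<open>B\<close> gives a change of coordinates,
  and equal coordinate maps give the matrix of an operator.\<close>

lemma (in finite_module) transition_matrix:
  assumes "coord_map V n \<rho>" "coord_map V n \<rho>'" "\<And>x y. B (x + y) = B x + B y"
    "\<And>a x. B (a *s x) = a *s B x" "\<And>x. x \<in> V \<Longrightarrow> B x \<in> V"
  shows "\<exists>P\<in>carrier_mat n n. \<forall>v\<in>carrier_vec n. \<rho>' (P *\<^sub>v v) = B (\<rho> v)"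
proof -
  define \<tau> where "\<tau> = inv_into (carrier_vec n) \<rho>'"
  have b: "bij_betw \<rho> (carrier_vec n) V" "bij_betw \<rho>' (carrier_vec n) V"
    using assms(1,2) by (auto simp: coord_map_def)
  have \<rho>V: "\<rho> v \<in> V" if "v \<in> carrier_vec n" for v using b(1) that bij_betwE by blast
  have \<tau>: "\<tau> x \<in> carrier_vec n" "\<rho>' (\<tau> x) = x" if "x \<in> V" for x
    using b(2) that unfolding \<tau>_def by (auto simp: bij_betw_def inv_into_into f_inv_into_f)
  have \<tau>_eq: "\<tau> (\<rho>' u) = u" if "u \<in> carrier_vec n" for u
    using b(2) that unfolding \<tau>_def by (simp add: bij_betw_def)
  have \<tau>_add: "\<tau> (x + y) = \<tau> x + \<tau> y" if "x \<in> V" "y \<in> V" for x y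
  proof -
    have "\<rho>' (\<tau> x + \<tau> y) = x + y" using \<tau>[OF that(1)] \<tau>[OF that(2)] assms(2) by (simp add: coord_map_def)
    thus ?thesis using \<tau>_eq[of "\<tau> x + \<tau> y"] \<tau>[OF that(1)] \<tau>[OF that(2)] by simp
  qed
  have \<tau>_scale: "\<tau> (a *s x) = a \<cdot>\<^sub>v \<tau> x" if "x \<in> V" for a x
  proof -
    have "\<rho>' (a \<cdot>\<^sub>v \<tau> x) = a *s x" using \<tau>[OF that] assms(2) by (simp add: coord_map_def)
    thus ?thesis using \<tau>_eq[of "a \<cdot>\<^sub>v \<tau> x"] \<tau>[OF that] by simp
  qed
  have "\<exists>P\<in>carrier_mat n n. \<forall>v\<in>carrier_vec n. P *\<^sub>v v = \<tau> (B (\<rho> v))"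
  proof (rule ex_mat_of_linear)
    fix v :: "'k vec" assume "v \<in> carrier_vec n"
    thus "\<tau> (B (\<rho> v)) \<in> carrier_vec n" by (intro \<tau> assms(5) \<rho>V)
  next
    fix u v :: "'k vec" assume uv: "u \<in> carrier_vec n" "v \<in> carrier_vec n"
    have "\<rho> (u + v) = \<rho> u + \<rho> v" using assms(1) uv by (simp add: coord_map_def)
    thus "\<tau> (B (\<rho> (u + v))) = \<tau> (B (\<rho> u)) + \<tau> (B (\<rho> v))"
      by (simp add: assms(3,5) \<tau>_add \<rho>V uv)
  next
    fix a and v :: "'k vec" assume v: "v \<in> carrier_vec n"
    have "\<rho> (a \<cdot>\<^sub>v v) = a *s \<rho> v" using assms(1) v by (simp add: coord_map_def)
    thus "\<tau> (B (\<rho> (a \<cdot>\<^sub>v v))) = a \<cdot>\<^sub>v \<tau> (B (\<rho> v))"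
      by (simp add: assms(4,5) \<tau>_scale \<rho>V v)
  qed
  then obtain P where P: "P \<in> carrier_mat n n" "\<And>v. v \<in> carrier_vec n \<Longrightarrow> P *\<^sub>v v = \<tau> (B (\<rho> v))"
    by blast
  have "\<rho>' (P *\<^sub>v v) = B (\<rho> v)" if "v \<in> carrier_vec n" for v
    unfolding P(2)[OF that] by (intro \<tau>(2) assms(5) \<rho>V that)
  thus ?thesis using P(1) by blast
qed

lemma (in finite_module) matrix_rep_exists:
  assumes "coord_map V n \<rho>"
  shows "\<exists>M. matrix_rep scale A V n M \<rho>"
proof -
  obtain M where M: "M \<in> carrier_mat n n" "\<forall>v\<in>carrier_vec n. \<rho> (M *\<^sub>v v) = A (\<rho> v)"
    using transition_matrix[OF assms assms, of A] A_add A_scale V_invariant by blast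
  have "matrix_rep scale A V n M \<rho>"
    using M assms by unfold_locales (auto simp: coord_map_def)
  thus ?thesis by blast
qed

lemma (in finite_module) coord_map_card:
  assumes "coord_map V n \<rho>"
  shows "card V = CARD('k) ^ n"
  using assms bij_betw_same_card[of \<rho> "carrier_vec n" V]
  by (simp add: coord_map_def card_carrier_vec)

lemma (in finite_module) similar_if_matrix_reps:
  assumes r1: "matrix_rep scale A V n M \<rho>" and r2: "matrix_rep scale A V n' M' \<rho>'"
  shows "similar_mat M M'"
proof -
  interpret r1: matrix_rep scale A V n M \<rho> by (rule r1)
  interpret r2: matrix_rep scale A V n' M' \<rho>' by (rule r2)
  have "CARD('k) ^ n = CARD('k) ^ n'"
    using coord_map_card[OF r1.coord_map] coord_map_card[OF r2.coord_map] by simp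
  hence nn: "n' = n" by (simp add: power_inject_exp[OF CARD_field_gt_1])
  note c2 = r2.coord_map[unfolded nn]
  have M': "M' \<in> carrier_mat n n" using r2.M nn by simp
  obtain P where P: "P \<in> carrier_mat n n" "\<And>v. v \<in> carrier_vec n \<Longrightarrow> \<rho> (P *\<^sub>v v) = \<rho>' v"
    using transition_matrix[OF c2 r1.coord_map, of "\<lambda>x. x"] by auto
  obtain Q where Q: "Q \<in> carrier_mat n n" "\<And>v. v \<in> carrier_vec n \<Longrightarrow> \<rho>' (Q *\<^sub>v v) = \<rho> v"
    using transition_matrix[OF r1.coord_map c2, of "\<lambda>x. x"] by auto
  have inj: "u = v" if "\<rho> u = \<rho> v" "u \<in> carrier_vec n" "v \<in> carrier_vec n" for u v
    using r1.\<rho>_bij that by (auto simp: bij_betw_def inj_on_def)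
  have inj': "u = v" if "\<rho>' u = \<rho>' v" "u \<in> carrier_vec n" "v \<in> carrier_vec n" for u v
    using r2.\<rho>_bij that nn by (auto simp: bij_betw_def inj_on_def)
  have cl: "X *\<^sub>v v \<in> carrier_vec n" if "X \<in> carrier_mat n n" "v \<in> carrier_vec n" for X :: "'k mat" and v
    using that by (rule mult_mat_vec_carrier)
  have PQ: "P * Q = 1\<^sub>m n"
  proof (rule mat_eqI_mult_vec)
    fix v :: "'k vec" assume v: "v \<in> carrier_vec n"
    have "\<rho> (P *\<^sub>v (Q *\<^sub>v v)) = \<rho> v" using P(2)[OF cl[OF Q(1) v]] Q(2)[OF v] by simp
    hence "P *\<^sub>v (Q *\<^sub>v v) = v" using P(1) Q(1) v by (intro inj cl) auto
    thus "P * Q *\<^sub>v v = 1\<^sub>m n *\<^sub>v v" using assoc_mult_mat_vec[OF P(1) Q(1) v] v by simp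
  qed (use P Q in auto)
  have QP: "Q * P = 1\<^sub>m n"
  proof (rule mat_eqI_mult_vec)
    fix v :: "'k vec" assume v: "v \<in> carrier_vec n"
    have "\<rho>' (Q *\<^sub>v (P *\<^sub>v v)) = \<rho>' v" using Q(2)[OF cl[OF P(1) v]] P(2)[OF v] by simp
    hence "Q *\<^sub>v (P *\<^sub>v v) = v" using P(1) Q(1) v by (intro inj' cl) auto
    thus "Q * P *\<^sub>v v = 1\<^sub>m n *\<^sub>v v" using assoc_mult_mat_vec[OF Q(1) P(1) v] v by simp
  qed (use P Q in auto)
  have "M = P * M' * Q"
  proof (rule mat_eqI_mult_vec)
    fix v :: "'k vec" assume v: "v \<in> carrier_vec n"
    have "\<rho> (P *\<^sub>v (M' *\<^sub>v (Q *\<^sub>v v))) = \<rho>' (M' *\<^sub>v (Q *\<^sub>v v))"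
      using P(2) cl M' Q(1) v by simp
    also have "\<dots> = A (\<rho>' (Q *\<^sub>v v))" using r2.\<rho>_mult[of "Q *\<^sub>v v"] cl[OF Q(1) v] nn by simp
    also have "\<dots> = \<rho> (M *\<^sub>v v)" using Q(2)[OF v] r1.\<rho>_mult[OF v] by simp
    finally have "P *\<^sub>v (M' *\<^sub>v (Q *\<^sub>v v)) = M *\<^sub>v v"
      using P(1) Q(1) M' r1.M v by (intro inj cl)
    moreover have "P * M' * Q *\<^sub>v v = P *\<^sub>v (M' *\<^sub>v (Q *\<^sub>v v))"
      using assoc_mult_mat_vec[OF mult_carrier_mat[OF P(1) M'] Q(1) v]
        assoc_mult_mat_vec[OF P(1) M' cl[OF Q(1) v]] by simp
    ultimately show "M *\<^sub>v v = P * M' * Q *\<^sub>v v" by simp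
  qed (use P Q M' r1.M in auto)
  from similar_mat_witI[OF PQ QP this r1.M M' P(1) Q(1)] show ?thesis
    unfolding similar_mat_def by blast
qed

lemma matrix_reps_commute:
  assumes "matrix_rep scale A V n M \<rho>" "matrix_rep scale B V n N \<rho>"
    and comm: "\<And>x. x \<in> V \<Longrightarrow> A (B x) = B (A x)"
  shows "M * N = N * M"
proof -
  interpret a: matrix_rep scale A V n M \<rho> by (rule assms)
  interpret b: matrix_rep scale B V n N \<rho> by (rule assms)
  show ?thesis
  proof (rule mat_eqI_mult_vec)
    fix v :: "'a vec" assume v: "v \<in> carrier_vec n"
    have Mv: "M *\<^sub>v v \<in> carrier_vec n" and Nv: "N *\<^sub>v v \<in> carrier_vec n"
      using a.M b.M v by (auto intro: mult_mat_vec_carrier)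
    have "\<rho> v \<in> V" using a.\<rho>_bij v bij_betwE by blast
    hence "\<rho> (M *\<^sub>v (N *\<^sub>v v)) = \<rho> (N *\<^sub>v (M *\<^sub>v v))"
      using comm by (simp add: a.\<rho>_mult[OF Nv] b.\<rho>_mult[OF Mv] a.\<rho>_mult[OF v] b.\<rho>_mult[OF v])
    moreover have "M *\<^sub>v (N *\<^sub>v v) \<in> carrier_vec n" "N *\<^sub>v (M *\<^sub>v v) \<in> carrier_vec n"
      using a.M b.M Mv Nv by (auto intro: mult_mat_vec_carrier)
    ultimately have "M *\<^sub>v (N *\<^sub>v v) = N *\<^sub>v (M *\<^sub>v v)"
      using a.\<rho>_bij by (auto simp: bij_betw_def inj_on_def)
    thus "M * N *\<^sub>v v = N * M *\<^sub>v v"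
      using assoc_mult_mat_vec[OF a.M b.M v] assoc_mult_mat_vec[OF b.M a.M v] by simp
  qed (use a.M b.M in auto)
qed

section \<open>Nilpotent classes\<close>

abbreviation nilpotent_jordan_matrix :: "nat list \<Rightarrow> 'a::field mat" where
  "nilpotent_jordan_matrix \<nu> \<equiv> jordan_matrix (map (\<lambda>k. (k, 0)) \<nu>)"

lemma carrier_nilpotent_jordan_matrix:
  "nilpotent_jordan_matrix \<nu> \<in> carrier_mat (sum_list \<nu>) (sum_list \<nu>)"
proof -
  have "sum_list (map fst (map (\<lambda>k. (k, 0 :: 'a)) \<nu>)) = sum_list \<nu>" by (simp add: comp_def)
  thus ?thesis using jordan_matrix_carrier[of "map (\<lambda>k. (k, 0 :: 'a)) \<nu>"] by metis
qed

lemma nilpotent_jordan_matrix_Cons_mult: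
  fixes v :: "'a::field vec"
  assumes v: "v \<in> carrier_vec (k + sum_list \<nu>)"
  shows "nilpotent_jordan_matrix (k # \<nu>) *\<^sub>v v
    = (jordan_block k 0 *\<^sub>v vec_first v k) @\<^sub>v (nilpotent_jordan_matrix \<nu> *\<^sub>v vec_last v (sum_list \<nu>))"
proof -
  have "nilpotent_jordan_matrix (k # \<nu>) = four_block_mat (jordan_block k 0) (0\<^sub>m k (sum_list \<nu>))
      (0\<^sub>m (sum_list \<nu>) k) (nilpotent_jordan_matrix \<nu> :: 'a mat)"
    by (simp add: jordan_matrix_Cons comp_def)
  moreover have "four_block_mat (jordan_block k 0) (0\<^sub>m k (sum_list \<nu>))
      (0\<^sub>m (sum_list \<nu>) k) (nilpotent_jordan_matrix \<nu>) *\<^sub>v (vec_first v k @\<^sub>v vec_last v (sum_list \<nu>))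
    = (jordan_block k 0 *\<^sub>v vec_first v k) @\<^sub>v (nilpotent_jordan_matrix \<nu> *\<^sub>v vec_last v (sum_list \<nu>))"
    by (rule mult_mat_vec_split) (auto intro: carrier_nilpotent_jordan_matrix)
  ultimately show ?thesis using vec_first_last_append[OF v] by simp
qed

lemma jordan_block_zero_pow_mult:
  fixes v :: "'a::field vec"
  assumes "v \<in> carrier_vec k" "i < k"
  shows "((jordan_block k 0 ^\<^sub>m r) *\<^sub>v v) $ i = (if i + r < k then v $ (i + r) else 0)"
proof -
  have "((jordan_block k 0 ^\<^sub>m r) *\<^sub>v v) $ i = (\<Sum>j<k. (if j \<ge> i \<and> j - i = r then 1 else 0) * v $ j)"
    using assms by (simp add: jordan_block_zero_pow scalar_prod_def atLeast0LessThan)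
  also have "\<dots> = (\<Sum>j<k. if j = i + r then v $ j else 0)"
    by (intro sum.cong) auto
  finally show ?thesis by simp
qed

lemma vec_eq_zero_iff: "x \<in> carrier_vec k \<Longrightarrow> x = 0\<^sub>v k \<longleftrightarrow> (\<forall>i<k. x $ i = 0)"
proof
  assume "x \<in> carrier_vec k" "\<forall>i<k. x $ i = 0"
  thus "x = 0\<^sub>v k" by (intro eq_vecI) simp_all
qed simp

text \<open>The \<open>r\<close>-th power of the block shifts coordinates by \<open>r\<close>, so
  its kernel consists of the vectors that are supported on the first \<open>min r k\<close>
  coordinates.\<close>

lemma card_kernel_jordan_block:
  "card {v \<in> carrier_vec k. (jordan_block k (0 :: 'a::finite_field) ^\<^sub>m r) *\<^sub>v v = 0\<^sub>v k} = CARD('a) ^ min r k"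
  (is "card ?K = _")
proof -
  let ?Z = "{v \<in> carrier_vec k. \<forall>i. r \<le> i \<and> i < k \<longrightarrow> v $ i = 0} :: 'a vec set"
  have K: "?K = ?Z"
  proof (intro Collect_cong conj_cong refl)
    fix v :: "'a vec" assume v: "v \<in> carrier_vec k"
    have "jordan_block k (0 :: 'a) ^\<^sub>m r \<in> carrier_mat k k" by (rule pow_carrier_mat) simp
    hence "(jordan_block k 0 ^\<^sub>m r) *\<^sub>v v \<in> carrier_vec k" using v by (rule mult_mat_vec_carrier)
    hence "(jordan_block k 0 ^\<^sub>m r) *\<^sub>v v = 0\<^sub>v k \<longleftrightarrow> (\<forall>i<k. ((jordan_block k 0 ^\<^sub>m r) *\<^sub>v v) $ i = 0)"
      by (rule vec_eq_zero_iff)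
    also have "\<dots> \<longleftrightarrow> (\<forall>i<k. (if i + r < k then v $ (i + r) else 0) = 0)"
      by (intro all_cong) (simp only: jordan_block_zero_pow_mult[OF v])
    also have "\<dots> \<longleftrightarrow> (\<forall>i. r \<le> i \<and> i < k \<longrightarrow> v $ i = 0)"
    proof (intro iffI allI impI)
      fix i assume H: "\<forall>i<k. (if i + r < k then v $ (i + r) else 0) = 0" and i: "r \<le> i \<and> i < k"
      show "v $ i = 0" using H[rule_format, of "i - r", OF less_imp_diff_less] i by simp
    next
      fix i assume H: "\<forall>i. r \<le> i \<and> i < k \<longrightarrow> v $ i = 0" and i: "i < k"
      show "(if i + r < k then v $ (i + r) else 0) = 0" using H[rule_format, of "i + r"] by simp
    qed
    finally show "(jordan_block k 0 ^\<^sub>m r) *\<^sub>v v = 0\<^sub>v k \<longleftrightarrow> (\<forall>i. r \<le> i \<and> i < k \<longrightarrow> v $ i = 0)" .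
  qed
  have "bij_betw (\<lambda>v. vec (min r k) (\<lambda>i. v $ i)) ?Z (carrier_vec (min r k))"
  proof (rule bij_betw_byWitness[where f' = "\<lambda>w. vec k (\<lambda>i. if i < r then w $ i else 0)"])
    show "\<forall>v\<in>?Z. vec k (\<lambda>i. if i < r then vec (min r k) (\<lambda>i. v $ i) $ i else 0) = v"
    proof
      fix v :: "'a vec" assume "v \<in> ?Z"
      hence v: "v \<in> carrier_vec k" "\<And>i. r \<le> i \<Longrightarrow> i < k \<Longrightarrow> v $ i = 0" by blast+
      show "vec k (\<lambda>i. if i < r then vec (min r k) (\<lambda>i. v $ i) $ i else 0) = v"
      proof (rule eq_vecI)
        fix i assume "i < dim_vec v"
        hence i: "i < k" using v(1) by simp
        show "vec k (\<lambda>i. if i < r then vec (min r k) (\<lambda>i. v $ i) $ i else 0) $ i = v $ i"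
          using i v(2)[of i] by (cases "i < r") simp_all
      qed (use v(1) in simp)
    qed
    show "\<forall>w\<in>(carrier_vec (min r k) :: 'a vec set).
        vec (min r k) (\<lambda>i. vec k (\<lambda>i. if i < r then w $ i else 0) $ i) = w"
      by (intro ballI eq_vecI) simp_all
    show "(\<lambda>v. vec (min r k) (\<lambda>i. v $ i)) ` ?Z \<subseteq> carrier_vec (min r k)"
      by (intro image_subsetI vec_carrier)
    show "(\<lambda>w. vec k (\<lambda>i. if i < r then w $ i else 0)) ` (carrier_vec (min r k) :: 'a vec set) \<subseteq> ?Z"
      by (intro image_subsetI CollectI conjI vec_carrier) simp
  qed
  thus ?thesis unfolding K by (simp add: bij_betw_same_card card_carrier_vec)
qed

lemma card_kernel_nilpotent_jordan_matrix:
  "card {v \<in> carrier_vec (sum_list \<nu>). ((nilpotent_jordan_matrix \<nu> :: 'a::finite_field mat) ^\<^sub>m r) *\<^sub>v v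
      = 0\<^sub>v (sum_list \<nu>)} = CARD('a) ^ conj_sum (mset \<nu>) r"
  (is "card (?K \<nu>) = _")
proof (induction \<nu>)
  case Nil
  have "?K [] = {0\<^sub>v 0 :: 'a vec}" by (auto simp: jordan_matrix_def)
  thus ?case by simp
next
  case (Cons k \<nu>)
  let ?J = "nilpotent_jordan_matrix \<nu> :: 'a mat" and ?m = "sum_list \<nu>"
  have J: "?J ^\<^sub>m r \<in> carrier_mat ?m ?m"
    using carrier_nilpotent_jordan_matrix by (rule pow_carrier_mat)
  have B: "jordan_block k (0::'a) ^\<^sub>m r \<in> carrier_mat k k" by (rule pow_carrier_mat) simp
  have eq: "nilpotent_jordan_matrix (k # \<nu>) ^\<^sub>m r = four_block_mat (jordan_block k 0 ^\<^sub>m r) (0\<^sub>m k ?m) (0\<^sub>m ?m k) (?J ^\<^sub>m r)"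
    using J B by (simp add: jordan_matrix_pow Let_def)
  let ?K1 = "{v \<in> carrier_vec k. (jordan_block k 0 ^\<^sub>m r) *\<^sub>v v = 0\<^sub>v k} :: 'a vec set"
  have split: "four_block_mat (jordan_block k 0 ^\<^sub>m r) (0\<^sub>m k ?m) (0\<^sub>m ?m k) (?J ^\<^sub>m r) *\<^sub>v (a @\<^sub>v d)
      = ((jordan_block k 0 ^\<^sub>m r) *\<^sub>v a) @\<^sub>v ((?J ^\<^sub>m r) *\<^sub>v d)"
    if "a \<in> carrier_vec k" "d \<in> carrier_vec ?m" for a d
    by (rule mult_mat_vec_split[OF B J that])
  have zero: "x @\<^sub>v y = 0\<^sub>v (k + ?m) \<longleftrightarrow> x = 0\<^sub>v k \<and> y = 0\<^sub>v ?m"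
    if "x \<in> carrier_vec k" for x y :: "'a vec"
  proof -
    have "0\<^sub>v (k + ?m) = 0\<^sub>v k @\<^sub>v (0\<^sub>v ?m :: 'a vec)" by (intro eq_vecI) auto
    thus ?thesis using append_vec_eq[OF that zero_carrier_vec] by simp
  qed
  have "bij_betw (\<lambda>(a, d). a @\<^sub>v d) (?K1 \<times> ?K \<nu>) (?K (k # \<nu>))"
  proof (rule bij_betw_byWitness[where f' = "\<lambda>v. (vec_first v k, vec_last v ?m)"])
    show "\<forall>x\<in>?K1 \<times> ?K \<nu>. (\<lambda>v. (vec_first v k, vec_last v ?m)) (case x of (a, d) \<Rightarrow> a @\<^sub>v d) = x"
      by (auto simp: vec_first_def vec_last_def intro!: eq_vecI)
    show "\<forall>v\<in>?K (k # \<nu>). (case (vec_first v k, vec_last v ?m) of (a, d) \<Rightarrow> a @\<^sub>v d) = v" by simp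
    show "(\<lambda>(a, d). a @\<^sub>v d) ` (?K1 \<times> ?K \<nu>) \<subseteq> ?K (k # \<nu>)"
    proof (intro image_subsetI)
      fix x assume "x \<in> ?K1 \<times> ?K \<nu>"
      then obtain a d where x: "x = (a, d)" and a: "a \<in> carrier_vec k" "(jordan_block k 0 ^\<^sub>m r) *\<^sub>v a = 0\<^sub>v k"
        and d: "d \<in> carrier_vec ?m" "(?J ^\<^sub>m r) *\<^sub>v d = 0\<^sub>v ?m" by blast
      have "(nilpotent_jordan_matrix (k # \<nu>) ^\<^sub>m r) *\<^sub>v (a @\<^sub>v d) = 0\<^sub>v (k + ?m)"
        unfolding eq split[OF a(1) d(1)] a(2) d(2) using zero[of "0\<^sub>v k" "0\<^sub>v ?m"] by simp
      moreover have "a @\<^sub>v d \<in> carrier_vec (k + ?m)" using a(1) d(1) by (rule append_carrier_vec)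
      ultimately show "(case x of (a, d) \<Rightarrow> a @\<^sub>v d) \<in> ?K (k # \<nu>)" unfolding x by simp
    qed
    show "(\<lambda>v. (vec_first v k, vec_last v ?m)) ` ?K (k # \<nu>) \<subseteq> ?K1 \<times> ?K \<nu>"
    proof
      fix x assume "x \<in> (\<lambda>v. (vec_first v k, vec_last v ?m)) ` ?K (k # \<nu>)"
      then obtain v where v: "v \<in> ?K (k # \<nu>)" "x = (vec_first v k, vec_last v ?m)" by blast
      have "four_block_mat (jordan_block k 0 ^\<^sub>m r) (0\<^sub>m k ?m) (0\<^sub>m ?m k) (?J ^\<^sub>m r) *\<^sub>v
          (vec_first v k @\<^sub>v vec_last v ?m) = 0\<^sub>v (k + ?m)"
        using v(1) eq by simp
      hence "(jordan_block k 0 ^\<^sub>m r) *\<^sub>v vec_first v k = 0\<^sub>v k \<and> (?J ^\<^sub>m r) *\<^sub>v vec_last v ?m = 0\<^sub>v ?m"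
        using zero[of "(jordan_block k 0 ^\<^sub>m r) *\<^sub>v vec_first v k"] B
        by (simp add: split mult_mat_vec_carrier[OF B])
      thus "x \<in> ?K1 \<times> ?K \<nu>" using v(2) by simp
    qed
  qed
  hence "card (?K (k # \<nu>)) = card ?K1 * card (?K \<nu>)"
    by (simp add: bij_betw_same_card[symmetric] card_cartesian_product)
  thus ?case using Cons.IH by (simp add: card_kernel_jordan_block power_add)
qed

lemma card_kernel_nilpotent_class:
  fixes N :: "'a::finite_field mat"
  assumes N: "N \<in> nilpotent_class \<nu>" and m: "N \<in> carrier_mat m m"
  shows "m = sum_list \<nu>"
    "card {v \<in> carrier_vec m. (N ^\<^sub>m r) *\<^sub>v v = 0\<^sub>v m} = CARD('a) ^ conj_sum (mset \<nu>) r"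
proof -
  let ?J = "nilpotent_jordan_matrix \<nu> :: 'a mat"
  have sim: "similar_mat N ?J" using N by (simp add: nilpotent_class_def jordan_nf_def)
  then obtain P Q where wit: "similar_mat_wit N ?J P Q" by (auto simp: similar_mat_def)
  note w = similar_mat_witD2[OF m wit]
  show mm: "m = sum_list \<nu>" using w(5) carrier_nilpotent_jordan_matrix[of \<nu>] by (metis carrier_matD(1))
  have wr: "similar_mat_wit (N ^\<^sub>m r) (?J ^\<^sub>m r) P Q" by (rule similar_mat_wit_pow[OF wit])
  have Nr: "N ^\<^sub>m r \<in> carrier_mat m m" using m by (rule pow_carrier_mat)
  note wr = similar_mat_witD2[OF Nr wr]
  have cl: "X *\<^sub>v v \<in> carrier_vec m" if "X \<in> carrier_mat m m" "v \<in> carrier_vec m" for X :: "'a mat" and v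
    using that by (rule mult_mat_vec_carrier)
  have PQ: "P *\<^sub>v (Q *\<^sub>v v) = v" "Q *\<^sub>v (P *\<^sub>v v) = v" if "v \<in> carrier_vec m" for v
    using w that by (simp_all flip: assoc_mult_mat_vec[of _ m m _ m])
  have QN: "Q *\<^sub>v ((N ^\<^sub>m r) *\<^sub>v v) = (?J ^\<^sub>m r) *\<^sub>v (Q *\<^sub>v v)" if v: "v \<in> carrier_vec m" for v
  proof -
    have "(N ^\<^sub>m r) *\<^sub>v v = (P * (?J ^\<^sub>m r) * Q) *\<^sub>v v" using wr(3) by simp
    also have "\<dots> = P *\<^sub>v ((?J ^\<^sub>m r) *\<^sub>v (Q *\<^sub>v v))"
      using assoc_mult_mat_vec[OF mult_carrier_mat[OF w(6) wr(5)] w(7) v]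
        assoc_mult_mat_vec[OF w(6) wr(5) cl[OF w(7) v]] by simp
    finally show ?thesis using PQ(2)[OF cl[OF wr(5) cl[OF w(7) v]]] by simp
  qed
  have "bij_betw (\<lambda>v. Q *\<^sub>v v) {v \<in> carrier_vec m. (N ^\<^sub>m r) *\<^sub>v v = 0\<^sub>v m}
      {v \<in> carrier_vec m. (?J ^\<^sub>m r) *\<^sub>v v = 0\<^sub>v m}"
  proof (rule bij_betw_byWitness[where f' = "\<lambda>v. P *\<^sub>v v"])
    show "(\<lambda>v. Q *\<^sub>v v) ` {v \<in> carrier_vec m. (N ^\<^sub>m r) *\<^sub>v v = 0\<^sub>v m}
        \<subseteq> {v \<in> carrier_vec m. (?J ^\<^sub>m r) *\<^sub>v v = 0\<^sub>v m}"
      using QN w(7) cl by (auto simp flip: QN)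
    show "(\<lambda>v. P *\<^sub>v v) ` {v \<in> carrier_vec m. (?J ^\<^sub>m r) *\<^sub>v v = 0\<^sub>v m}
        \<subseteq> {v \<in> carrier_vec m. (N ^\<^sub>m r) *\<^sub>v v = 0\<^sub>v m}"
    proof (intro image_subsetI CollectI conjI)
      fix v assume v: "v \<in> {v \<in> carrier_vec m. (?J ^\<^sub>m r) *\<^sub>v v = 0\<^sub>v m}"
      thus Pv: "P *\<^sub>v v \<in> carrier_vec m" using w(6) cl by simp
      have "Q *\<^sub>v ((N ^\<^sub>m r) *\<^sub>v (P *\<^sub>v v)) = 0\<^sub>v m" using QN[OF Pv] PQ v by simp
      hence "P *\<^sub>v (Q *\<^sub>v ((N ^\<^sub>m r) *\<^sub>v (P *\<^sub>v v))) = P *\<^sub>v 0\<^sub>v m" by simp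
      also have "P *\<^sub>v 0\<^sub>v m = 0\<^sub>v m" using w(6) by (intro eq_vecI) auto
      finally have "P *\<^sub>v (Q *\<^sub>v ((N ^\<^sub>m r) *\<^sub>v (P *\<^sub>v v))) = 0\<^sub>v m" .
      thus "(N ^\<^sub>m r) *\<^sub>v (P *\<^sub>v v) = 0\<^sub>v m" using PQ(1) cl[OF Nr Pv] by simp
    qed
  qed (use PQ in auto)
  thus "card {v \<in> carrier_vec m. (N ^\<^sub>m r) *\<^sub>v v = 0\<^sub>v m} = CARD('a) ^ conj_sum (mset \<nu>) r"
    using card_kernel_nilpotent_jordan_matrix[of \<nu> r, where 'a = 'a] mm by (simp add: bij_betw_same_card)
qed

text \<open>Nilpotent operators are thereby the case \<open>f = x\<close> of the theory of primary
  modules, with \<open>degree f = 1\<close>.\<close>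

lemma irreducible_monom_1: "irreducible (monom 1 1 :: 'a::field poly)"
proof -
  have d: "degree (monom 1 1 :: 'a poly) = 1" by (simp add: degree_monom_eq)
  show ?thesis
  proof (rule irreducibleI)
    show nz: "monom 1 1 \<noteq> (0 :: 'a poly)" by simp
    show "\<not> is_unit (monom 1 1 :: 'a poly)" using d nz by (simp add: is_unit_iff_degree)
    fix a b :: "'a poly" assume ab: "monom 1 1 = a * b"
    hence ne: "a \<noteq> 0" "b \<noteq> 0" using nz by auto
    have "degree a + degree b = 1" using d unfolding ab degree_mult_eq[OF ne] .
    hence "degree a = 0 \<or> degree b = 0" by linarith
    thus "is_unit a \<or> is_unit b" using ne by (simp add: is_unit_iff_degree)
  qed
qed

lemma vec_last_index: "v \<in> carrier_vec (k + m) \<Longrightarrow> i < m \<Longrightarrow> vec_last v m $ i = v $ (k + i)"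
  by (simp add: vec_last_def)

lemma vec_last_append: "a \<in> carrier_vec k \<Longrightarrow> d \<in> carrier_vec m \<Longrightarrow> vec_last (a @\<^sub>v d) m = d"
  by (intro eq_vecI) (auto simp: vec_last_def)

section \<open>Jordan bases of nilpotent operators\<close>

context operator
begin

lemma act_monom: "act (monom a n) v = a *s (A ^^ n) v"
proof (induction n)
  case 0
  thus ?case by (simp add: monom_0 act_pCons)
next
  case (Suc n)
  thus ?case by (simp add: monom_Suc act_pCons A_scale)
qed

lemma act_monom_1_power: "act (monom 1 (Suc 0) ^ r) v = (A ^^ r) v"
  by (simp add: monom_power act_monom)

text \<open>The image of the \<open>j\<close>-th block of basis vectors is \<open>A\<^sup>k\<^sup>-\<^sup>1 (g j), \<dots>, A (g j), g j\<close>, in this order.\<close>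

primrec jordan_map :: "nat list \<Rightarrow> (nat \<Rightarrow> 'v) \<Rightarrow> 'k vec \<Rightarrow> 'v" where
  "jordan_map [] = (\<lambda>g v. 0)"
| "jordan_map (k # \<nu>) = (\<lambda>g v. (\<Sum>t<k. v $ t *s (A ^^ (k - 1 - t)) (g 0)) +
     jordan_map \<nu> (\<lambda>j. g (Suc j)) (vec_last v (sum_list \<nu>)))"

lemma jordan_map_add:
  "u \<in> carrier_vec (sum_list \<nu>) \<Longrightarrow> v \<in> carrier_vec (sum_list \<nu>) \<Longrightarrow>
    jordan_map \<nu> g (u + v) = jordan_map \<nu> g u + jordan_map \<nu> g v"
proof (induction \<nu> arbitrary: g u v)
  case (Cons k \<nu>)
  let ?m = "sum_list \<nu>"
  have uv: "u \<in> carrier_vec (k + ?m)" "v \<in> carrier_vec (k + ?m)" using Cons.prems by auto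
  have last: "vec_last (u + v) ?m = vec_last u ?m + vec_last v ?m"
    using uv by (intro eq_vecI) (auto simp: vec_last_def)
  have IH: "jordan_map \<nu> (\<lambda>j. g (Suc j)) (vec_last (u + v) ?m) =
      jordan_map \<nu> (\<lambda>j. g (Suc j)) (vec_last u ?m) + jordan_map \<nu> (\<lambda>j. g (Suc j)) (vec_last v ?m)"
    unfolding last by (rule Cons.IH) auto
  have "(\<Sum>t<k. (u + v) $ t *s (A ^^ (k - 1 - t)) (g 0))
      = (\<Sum>t<k. u $ t *s (A ^^ (k - 1 - t)) (g 0)) + (\<Sum>t<k. v $ t *s (A ^^ (k - 1 - t)) (g 0))"
    unfolding sum.distrib[symmetric] using uv by (intro sum.cong refl) (auto simp: scale_left_distrib)
  thus ?case by (simp add: IH)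
qed simp

lemma jordan_map_smult:
  "v \<in> carrier_vec (sum_list \<nu>) \<Longrightarrow> jordan_map \<nu> g (a \<cdot>\<^sub>v v) = a *s jordan_map \<nu> g v"
proof (induction \<nu> arbitrary: g v)
  case (Cons k \<nu>)
  let ?m = "sum_list \<nu>"
  have v: "v \<in> carrier_vec (k + ?m)" using Cons.prems by auto
  have last: "vec_last (a \<cdot>\<^sub>v v) ?m = a \<cdot>\<^sub>v vec_last v ?m"
    using v by (intro eq_vecI) (auto simp: vec_last_def)
  have IH: "jordan_map \<nu> (\<lambda>j. g (Suc j)) (vec_last (a \<cdot>\<^sub>v v) ?m) = a *s jordan_map \<nu> (\<lambda>j. g (Suc j)) (vec_last v ?m)"
    unfolding last by (rule Cons.IH) auto
  have "(\<Sum>t<k. (a \<cdot>\<^sub>v v) $ t *s (A ^^ (k - 1 - t)) (g 0)) = a *s (\<Sum>t<k. v $ t *s (A ^^ (k - 1 - t)) (g 0))"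
    unfolding scale_sum_right using v by (intro sum.cong refl) auto
  thus ?case by (simp add: IH scale_right_distrib)
qed simp

text \<open>A Jordan block shifts the coordinates by one place, which raises the power of
  \<open>A\<close> at each of them by one. The coordinate that is shifted out would have met the
  full power \<open>A ^^ k\<close>, which kills the generator.\<close>

lemma jordan_map_mult:
  "v \<in> carrier_vec (sum_list \<nu>) \<Longrightarrow> (\<And>j. j < length \<nu> \<Longrightarrow> (A ^^ (\<nu> ! j)) (g j) = 0) \<Longrightarrow>
    jordan_map \<nu> g (nilpotent_jordan_matrix \<nu> *\<^sub>v v) = A (jordan_map \<nu> g v)"
proof (induction \<nu> arbitrary: g v)
  case (Cons k \<nu>)
  let ?m = "sum_list \<nu>" and ?J = "nilpotent_jordan_matrix \<nu> :: 'k mat"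
  have v: "v \<in> carrier_vec (k + ?m)" using Cons.prems by auto
  have J: "?J \<in> carrier_mat ?m ?m" by (rule carrier_nilpotent_jordan_matrix)
  let ?a = "jordan_block k 0 *\<^sub>v vec_first v k" and ?d = "?J *\<^sub>v vec_last v ?m"
  have a: "?a \<in> carrier_vec k" by (rule mult_mat_vec_carrier) auto
  have d: "?d \<in> carrier_vec ?m" using J by (rule mult_mat_vec_carrier) auto
  have eq: "nilpotent_jordan_matrix (k # \<nu>) *\<^sub>v v = ?a @\<^sub>v ?d"
    by (rule nilpotent_jordan_matrix_Cons_mult[OF v])
  have last: "vec_last (?a @\<^sub>v ?d) ?m = ?d"
    using a d by (rule vec_last_append)
  have comp: "(?a @\<^sub>v ?d) $ t = (if Suc t < k then v $ Suc t else 0)" if "t < k" for t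
  proof -
    have "(?a @\<^sub>v ?d) $ t = ?a $ t" using that a d by simp
    also have "\<dots> = (if t + 1 < k then vec_first v k $ (t + 1) else 0)"
      using jordan_block_zero_pow_mult[of "vec_first v k" k t 1] that by simp
    finally show ?thesis using that v by (simp add: vec_first_def)
  qed
  have Ag: "(A ^^ k) (g 0) = 0" using Cons.prems(2)[of 0] by simp
  have IH: "jordan_map \<nu> (\<lambda>j. g (Suc j)) ?d = A (jordan_map \<nu> (\<lambda>j. g (Suc j)) (vec_last v ?m))"
  proof (rule Cons.IH)
    fix j assume "j < length \<nu>"
    thus "(A ^^ (\<nu> ! j)) (g (Suc j)) = 0" using Cons.prems(2)[of "Suc j"] by simp
  qed auto
  have "(\<Sum>t<k. (?a @\<^sub>v ?d) $ t *s (A ^^ (k - 1 - t)) (g 0)) = A (\<Sum>t<k. v $ t *s (A ^^ (k - 1 - t)) (g 0))"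
  proof (cases k)
    case (Suc k')
    have "(\<Sum>t<k. (?a @\<^sub>v ?d) $ t *s (A ^^ (k - 1 - t)) (g 0))
        = (\<Sum>t<k. (if Suc t < k then v $ Suc t else 0) *s (A ^^ (k - 1 - t)) (g 0))"
      by (rule sum.cong[OF refl]) (simp only: comp lessThan_iff)
    also have "\<dots> = (\<Sum>t<k'. v $ Suc t *s (A ^^ (k' - t)) (g 0))"
      by (simp add: Suc)
    also have "\<dots> = (\<Sum>t<k'. A (v $ Suc t *s (A ^^ (k' - Suc t)) (g 0)))"
      by (intro sum.cong refl) (simp add: A_scale flip: funpow.simps(2)[unfolded comp_def] Suc_diff_Suc)
    also have "\<dots> = (\<Sum>t<k. A (v $ t *s (A ^^ (k - 1 - t)) (g 0)))"
      using Ag unfolding Suc by (subst sum.lessThan_Suc_shift) (simp add: A_scale)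
    finally show ?thesis by (simp add: A_sum)
  qed simp
  thus ?case unfolding eq by (simp add: last IH A_add)
qed simp

text \<open>Coordinate \<open>t\<close> of a block of size \<open>k\<close> is read as the
  coefficient of \<open>x^(k - 1 - t)\<close>. The degree bound and the last clause let independence
  of a primary basis imply injectivity of \<open>jordan_map\<close>.\<close>

lemma jordan_map_polys:
  "v \<in> carrier_vec (sum_list \<nu>) \<Longrightarrow> \<exists>p. jordan_map \<nu> g v = (\<Sum>j<length \<nu>. act (p j) (g j)) \<and>
    (\<forall>j<length \<nu>. p j \<in> polys_below (\<nu> ! j)) \<and>
    ((\<forall>j<length \<nu>. p j = 0) \<longrightarrow> v = 0\<^sub>v (sum_list \<nu>))"
proof (induction \<nu> arbitrary: g v)
  case (Cons k \<nu>)
  let ?m = "sum_list \<nu>"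
  have v: "v \<in> carrier_vec (k + ?m)" using Cons.prems by auto
  obtain p where p: "jordan_map \<nu> (\<lambda>j. g (Suc j)) (vec_last v ?m) = (\<Sum>j<length \<nu>. act (p j) (g (Suc j)))"
    "\<And>j. j < length \<nu> \<Longrightarrow> p j \<in> polys_below (\<nu> ! j)"
    "(\<forall>j<length \<nu>. p j = 0) \<Longrightarrow> vec_last v ?m = 0\<^sub>v ?m"
    using Cons.IH[of "vec_last v ?m" "\<lambda>j. g (Suc j)"] by auto
  define P where "P = (\<Sum>t<k. monom (v $ t) (k - 1 - t))"
  define p' where "p' j = (case j of 0 \<Rightarrow> P | Suc j \<Rightarrow> p j)" for j
  have coeffP: "coeff P (k - 1 - t) = v $ t" if "t < k" for t
  proof -
    have "coeff P (k - 1 - t) = (\<Sum>s<k. if s = t then v $ s else 0)"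
      unfolding P_def coeff_sum using that by (intro sum.cong refl) auto
    thus ?thesis using that by simp
  qed
  have P: "P \<in> polys_below k"
    unfolding polys_below_def P_def by (auto simp: coeff_sum intro!: sum.neutral)
  have "act P (g 0) = (\<Sum>t<k. v $ t *s (A ^^ (k - 1 - t)) (g 0))"
    by (simp add: P_def act_sum act_monom)
  hence "jordan_map (k # \<nu>) g v = act P (g 0) + (\<Sum>j<length \<nu>. act (p j) (g (Suc j)))"
    by (simp add: p(1))
  also have "\<dots> = (\<Sum>j<length (k # \<nu>). act (p' j) (g j))"
    by (simp add: sum.lessThan_Suc_shift p'_def del: sum.lessThan_Suc)
  finally have 1: "jordan_map (k # \<nu>) g v = (\<Sum>j<length (k # \<nu>). act (p' j) (g j))" .
  have 2: "\<forall>j<length (k # \<nu>). p' j \<in> polys_below ((k # \<nu>) ! j)"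
    using P p(2) by (auto simp: p'_def split: nat.splits)
  have 3: "v = 0\<^sub>v (sum_list (k # \<nu>))" if z: "\<forall>j<length (k # \<nu>). p' j = 0"
  proof -
    have "P = 0" using z[rule_format, of 0] by (simp add: p'_def)
    hence first: "v $ t = 0" if "t < k" for t using coeffP[OF that] by simp
    have "p j = 0" if "j < length \<nu>" for j using z[rule_format, of "Suc j"] that by (simp add: p'_def)
    hence "vec_last v ?m = 0\<^sub>v ?m" by (intro p(3)) blast
    hence last: "v $ (k + i) = 0" if "i < ?m" for i
      using vec_last_index[OF v that] that by simp
    show ?thesis
    proof (rule eq_vecI)
      fix i assume "i < dim_vec (0\<^sub>v (sum_list (k # \<nu>)) :: 'k vec)"
      hence i: "i < k + ?m" by simp
      have "v $ i = 0"
      proof (cases "i < k")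
        case False
        thus ?thesis using last[of "i - k"] i by simp
      qed (rule first)
      thus "v $ i = 0\<^sub>v (sum_list (k # \<nu>)) $ i" using i by simp
    qed (use v in simp)
  qed
  show ?case using 1 2 3 by blast
qed auto

end

context finite_module
begin

lemma card_if_primary_basis:
  assumes f: "irreducible f" and pb: "primary_basis f I g k"
  shows "card V = CARD('k) ^ (degree f * sum k I)"
proof -
  have fin: "finite I" using pb by (simp add: primary_basis_def generators_def)
  hence le: "k i \<le> sum k I" if "i \<in> I" for i using that by (intro member_le_sum) auto
  have "act (f ^ sum k I) v = 0" if "v \<in> V" for v
    using pb le that by (intro generators_annihilate[of f I g k]) (auto simp: primary_basis_def)
  hence "{v \<in> V. act (f ^ sum k I) v = 0} = V" by blast
  moreover have "(\<Sum>i\<in>I. min (sum k I) (k i)) = sum k I"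
    using le by (intro sum.cong refl) (simp add: min_absorb2)
  ultimately show ?thesis using card_kernel_power[OF f pb, of "sum k I"] by simp
qed

text \<open>Independence of the basis makes the coordinate map injective, and equal cardinalities
  then make it surjective onto \<open>V\<close>.\<close>

lemma matrix_rep_jordan_map:
  assumes pb: "primary_basis (monom 1 1) {..<length \<nu>} g (\<lambda>i. \<nu> ! i)"
  shows "matrix_rep scale A V (sum_list \<nu>) (nilpotent_jordan_matrix \<nu>) (jordan_map \<nu> g)"
proof -
  let ?n = "sum_list \<nu>" and ?\<rho> = "jordan_map \<nu> g"
  have gV: "g j \<in> V" and ann: "(A ^^ (\<nu> ! j)) (g j) = 0" if "j < length \<nu>" for j
    using pb that by (auto simp: primary_basis_def generators_def act_monom_1_power)
  have indep: "monom 1 1 ^ (\<nu> ! j) dvd p j" if "(\<Sum>i<length \<nu>. act (p i) (g i)) = 0" "j < length \<nu>" for p j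
    using pb that by (auto simp: primary_basis_def)
  have img: "?\<rho> v \<in> V" if v: "v \<in> carrier_vec ?n" for v
  proof -
    obtain p where p: "?\<rho> v = (\<Sum>j<length \<nu>. act (p j) (g j))" using jordan_map_polys[OF v, of g] by blast
    show ?thesis unfolding p by (rule sum_closed, rule act_closed, rule gV) simp
  qed
  have ker: "v = 0\<^sub>v ?n" if v: "v \<in> carrier_vec ?n" and 0: "?\<rho> v = 0" for v
  proof -
    obtain p where p: "?\<rho> v = (\<Sum>j<length \<nu>. act (p j) (g j))"
      "\<And>j. j < length \<nu> \<Longrightarrow> p j \<in> polys_below (\<nu> ! j)"
      "(\<forall>j<length \<nu>. p j = 0) \<Longrightarrow> v = 0\<^sub>v ?n"
      using jordan_map_polys[OF v, of g] by blast
    have "p j = 0" if "j < length \<nu>" for j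
    proof (rule polys_below_dvd_eq_0)
      show "monom 1 1 ^ (\<nu> ! j) dvd p j" by (rule indep[OF _ that]) (use p(1) 0 in \<open>simp only:\<close>)
      show "p j \<in> polys_below (degree (monom 1 1 ^ (\<nu> ! j) :: 'k poly))"
        using p(2)[OF that] by (simp add: monom_power degree_monom_eq)
    qed
    thus ?thesis using p(3) by blast
  qed
  have inj: "inj_on ?\<rho> (carrier_vec ?n)"
  proof (rule inj_onI)
    fix u v assume uv: "u \<in> carrier_vec ?n" "v \<in> carrier_vec ?n" "?\<rho> u = ?\<rho> v"
    have w: "u + (- 1) \<cdot>\<^sub>v v \<in> carrier_vec ?n" using uv by auto
    have "?\<rho> (u + (- 1) \<cdot>\<^sub>v v) = ?\<rho> u + (- 1) *s ?\<rho> v"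
      using uv by (simp add: jordan_map_add jordan_map_smult)
    hence "u + (- 1) \<cdot>\<^sub>v v = 0\<^sub>v ?n" using uv(3) by (intro ker[OF w]) simp
    hence z: "(u + (- 1) \<cdot>\<^sub>v v) $ i = 0" if "i < ?n" for i using that by simp
    show "u = v"
    proof (rule eq_vecI)
      fix i assume "i < dim_vec v"
      thus "u $ i = v $ i" using z[of i] uv(1,2) by simp
    qed (use uv in simp)
  qed
  have "card V = CARD('k) ^ ?n"
    using card_if_primary_basis[OF irreducible_monom_1 pb]
    by (simp add: degree_monom_eq sum_list_sum_nth atLeast0LessThan)
  hence "?\<rho> ` carrier_vec ?n = V"
    using img inj V_finite by (intro card_subset_eq) (auto simp: card_image card_carrier_vec)
  hence "bij_betw ?\<rho> (carrier_vec ?n) V" using inj by (simp add: bij_betw_def)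
  thus ?thesis
    using ann by unfold_locales
      (auto simp: carrier_nilpotent_jordan_matrix jordan_map_add jordan_map_smult jordan_map_mult)
qed

lemma nilpotent_partition_exists:
  assumes nil: "\<And>v. v \<in> V \<Longrightarrow> (A ^^ s) v = 0"
  shows "\<exists>\<nu> \<rho>. is_partition \<nu> \<and> matrix_rep scale A V (sum_list \<nu>) (nilpotent_jordan_matrix \<nu>) \<rho> \<and>
    (\<forall>r. card {v \<in> V. (A ^^ r) v = 0} = CARD('k) ^ conj_sum (mset \<nu>) r)"
proof -
  obtain I :: "'v set" and g k where pb: "primary_basis (monom 1 1) I g k" and k: "\<And>i. i \<in> I \<Longrightarrow> k i > 0"
    using primary_basis_exists[OF irreducible_monom_1, of s] nil by (auto simp: act_monom_1_power)
  have fin: "finite I" using pb by (simp add: primary_basis_def generators_def)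
  define \<nu> where "\<nu> = rev (sorted_list_of_multiset (image_mset k (mset_set I)))"
  have m: "image_mset k (mset_set I) = mset \<nu>" by (simp add: \<nu>_def)
  have part: "is_partition \<nu>"
    unfolding is_partition_def
  proof
    show "sorted_wrt (\<ge>) \<nu>" by (simp add: \<nu>_def sorted_wrt_rev)
    have "set \<nu> = k ` I" using arg_cong[OF m, of set_mset] fin by simp
    thus "\<forall>k\<in>set \<nu>. 0 < k" using k by auto
  qed
  obtain b where b: "bij_betw b {..<length \<nu>} I" "\<And>j. j < length \<nu> \<Longrightarrow> k (b j) = \<nu> ! j"
    using ex_bij_betw_nth[OF fin m] by blast
  have pb': "primary_basis (monom 1 1) {..<length \<nu>} (\<lambda>j. g (b j)) (\<lambda>i. \<nu> ! i)"
    by (rule primary_basis_reindex[OF pb b(1)]) (simp add: b(2))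
  have "card {v \<in> V. (A ^^ r) v = 0} = CARD('k) ^ conj_sum (mset \<nu>) r" for r
    using card_kernel_power[OF irreducible_monom_1 pb', of r]
    by (simp add: act_monom_1_power degree_monom_eq conj_sum_mset_nth)
  thus ?thesis using part matrix_rep_jordan_map[OF pb'] by blast
qed

lemma nilpotent_class_exists:
  assumes rep: "matrix_rep scale A V n N \<rho>" and nil: "\<And>v. v \<in> V \<Longrightarrow> (A ^^ s) v = 0"
  shows "\<exists>\<nu>. is_partition \<nu> \<and> N \<in> nilpotent_class \<nu> \<and>
    (\<forall>r. card {v \<in> V. (A ^^ r) v = 0} = CARD('k) ^ conj_sum (mset \<nu>) r)"
proof -
  obtain \<nu> \<rho>' where \<nu>: "is_partition \<nu>"
    "matrix_rep scale A V (sum_list \<nu>) (nilpotent_jordan_matrix \<nu>) \<rho>'"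
    "\<forall>r. card {v \<in> V. (A ^^ r) v = 0} = CARD('k) ^ conj_sum (mset \<nu>) r"
    using nilpotent_partition_exists[OF nil] by blast
  have "similar_mat N (nilpotent_jordan_matrix \<nu>)" by (rule similar_if_matrix_reps[OF rep \<nu>(2)])
  hence "N \<in> nilpotent_class \<nu>"
    using \<nu>(1) by (auto simp: nilpotent_class_def jordan_nf_def is_partition_def)
  thus ?thesis using \<nu> by blast
qed

lemma zero_operator: "finite_module scale (\<lambda>_. 0) V"
  using subspace_0[OF V_subspace] V_subspace V_finite
  by (intro finite_module.intro operator.intro operator_axioms.intro finite_module_axioms.intro vector_space_axioms)
    simp_all

text \<open>The zero operator is nilpotent, so its Jordan basis supplies linear coordinates on any
  finite module.\<close>

lemma coord_map_exists: "\<exists>n \<rho>. coord_map V n \<rho>"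
proof -
  have "((\<lambda>_. 0) ^^ Suc 0) v = (0 :: 'v)" for v :: 'v by simp
  from finite_module.nilpotent_partition_exists[OF zero_operator this] obtain \<nu> \<rho> where
    rep: "matrix_rep scale (\<lambda>_. 0) V (sum_list \<nu>) (nilpotent_jordan_matrix \<nu>) \<rho>" by blast
  show ?thesis by (intro exI, rule matrix_rep.coord_map[OF rep])
qed

end

section \<open>Coordinate spaces as function spaces\<close>

text \<open>Vectors are functions on the natural numbers; along an embedding \<open>\<iota>\<close> of fields they form a
  vector space over the smaller field, and \<open>\<iota> = id\<close> gives the usual structure.\<close>

definition fscale :: "('k \<Rightarrow> 'b) \<Rightarrow> 'k \<Rightarrow> (nat \<Rightarrow> 'b) \<Rightarrow> nat \<Rightarrow> 'b::field" where
  "fscale \<iota> a v = (\<lambda>i. \<iota> a * v i)"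

definition mat_op :: "nat \<Rightarrow> 'b::field mat \<Rightarrow> (nat \<Rightarrow> 'b) \<Rightarrow> nat \<Rightarrow> 'b" where
  "mat_op n M v = (\<lambda>i. if i < n then \<Sum>j<n. M $$ (i, j) * v j else 0)"

text \<open>With \<open>R = range \<iota>\<close> this is \<open>K^n\<close>, with
  \<open>R = UNIV\<close> it is \<open>L^n\<close>. Both lie in the same type, so the inclusion of
  one in the other is literal.\<close>

definition fvecs :: "nat \<Rightarrow> 'b::field set \<Rightarrow> (nat \<Rightarrow> 'b) set" where
  "fvecs n R = {v. (\<forall>i<n. v i \<in> R) \<and> (\<forall>i\<ge>n. v i = 0)}"

definition fvec :: "('k \<Rightarrow> 'b::field) \<Rightarrow> nat \<Rightarrow> 'k vec \<Rightarrow> nat \<Rightarrow> 'b" where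
  "fvec \<iota> n w = (\<lambda>i. if i < n then \<iota> (w $ i) else 0)"

lemma sum_fun_apply: "(\<Sum>j\<in>J. g j) i = (\<Sum>j\<in>J. g j i)"
  by (induction J rule: infinite_finite_induct) simp_all

lemma vector_space_fscale:
  fixes \<iota> :: "'k::field \<Rightarrow> 'b::field"
  assumes "field_hom \<iota>"
  shows "vector_space (fscale \<iota>)"
proof -
  interpret field_hom \<iota> by (rule assms)
  show ?thesis
    by unfold_locales (simp_all add: fscale_def fun_eq_iff hom_add hom_mult distrib_left distrib_right)
qed

lemma mat_op_add: "mat_op n M (x + y) = mat_op n M x + mat_op n M y"
  by (simp add: mat_op_def fun_eq_iff distrib_left sum.distrib)

lemma mat_op_fscale: "mat_op n M (fscale \<iota> a x) = fscale \<iota> a (mat_op n M x)"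
  by (simp add: mat_op_def fscale_def fun_eq_iff sum_distrib_left mult.left_commute)

lemma operator_mat_op:
  fixes \<iota> :: "'k::field \<Rightarrow> 'b::field"
  assumes "field_hom \<iota>"
  shows "operator (fscale \<iota>) (mat_op n M)"
  by (intro operator.intro operator_axioms.intro vector_space_fscale assms mat_op_add mat_op_fscale)

lemma mat_op_mult:
  assumes "M \<in> carrier_mat n n" "N \<in> carrier_mat n n"
  shows "mat_op n M (mat_op n N v) = mat_op n (M * N) v"
proof
  fix i
  show "mat_op n M (mat_op n N v) i = mat_op n (M * N) v i"
  proof (cases "i < n")
    case True
    have "mat_op n M (mat_op n N v) i = (\<Sum>j<n. \<Sum>k<n. M $$ (i, j) * (N $$ (j, k) * v k))"
      using True by (simp add: mat_op_def sum_distrib_left)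
    also have "\<dots> = (\<Sum>k<n. \<Sum>j<n. M $$ (i, j) * (N $$ (j, k) * v k))" by (rule sum.swap)
    also have "\<dots> = (\<Sum>k<n. (M * N) $$ (i, k) * v k)"
    proof (intro sum.cong refl)
      fix k assume "k \<in> {..<n}"
      hence "(M * N) $$ (i, k) = (\<Sum>j<n. M $$ (i, j) * N $$ (j, k))"
        using True assms by (simp add: scalar_prod_def atLeast0LessThan)
      thus "(\<Sum>j<n. M $$ (i, j) * (N $$ (j, k) * v k)) = (M * N) $$ (i, k) * v k"
        by (simp add: sum_distrib_right mult.assoc)
    qed
    finally show ?thesis using True by (simp add: mat_op_def)
  qed (simp add: mat_op_def)
qed

lemma finite_fvecs: "finite (fvecs n (R :: 'b::{field,finite} set))"
proof -
  have "v \<in> fvec id n ` carrier_vec n" if "v \<in> fvecs n R" for v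
    using that by (intro image_eqI[of _ _ "vec n v"]) (auto simp: fvec_def fvecs_def fun_eq_iff)
  hence "fvecs n R \<subseteq> fvec id n ` carrier_vec n" by blast
  thus ?thesis using finite_carrier_vec by (metis finite_imageI finite_subset)
qed

text \<open>Needed for two choices of \<open>\<iota>\<close>: an embedding realises a matrix over
  \<open>K\<close> on the copy of \<open>K^n\<close> inside \<open>L^n\<close>, and
  \<open>id\<close> realises a matrix over \<open>L\<close> on all of \<open>L^n\<close>.\<close>

lemma matrix_rep_fvec:
  fixes \<iota> :: "'k::finite_field \<Rightarrow> 'b::finite_field"
  assumes hom: "field_hom \<iota>" and M: "M \<in> carrier_mat n n"
  shows "matrix_rep (fscale \<iota>) (mat_op n (map_mat \<iota> M)) (fvecs n (range \<iota>)) n M (fvec \<iota> n)"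
proof -
  interpret h: field_hom \<iota> by (rule hom)
  interpret operator "fscale \<iota>" "mat_op n (map_mat \<iota> M)" by (rule operator_mat_op[OF hom])
  have addr: "x + y \<in> range \<iota>" if "x \<in> range \<iota>" "y \<in> range \<iota>" for x y
  proof -
    obtain a b where "x = \<iota> a" "y = \<iota> b" using \<open>x \<in> _\<close> \<open>y \<in> _\<close> by blast
    hence "x + y = \<iota> (a + b)" by (simp only: h.hom_add)
    thus ?thesis by (simp only: rangeI)
  qed
  have multr: "x * y \<in> range \<iota>" if "x \<in> range \<iota>" "y \<in> range \<iota>" for x y
  proof -
    obtain a b where "x = \<iota> a" "y = \<iota> b" using \<open>x \<in> _\<close> \<open>y \<in> _\<close> by blast
    hence "x * y = \<iota> (a * b)" by (simp only: h.hom_mult)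
    thus ?thesis by (simp only: rangeI)
  qed
  have zr: "0 \<in> range \<iota>" by (rule range_eqI[of _ _ 0]) simp
  have sumr: "(\<Sum>j\<in>J. y j) \<in> range \<iota>" if "\<And>j. j \<in> J \<Longrightarrow> y j \<in> range \<iota>" for J :: "nat set" and y
    using that
  proof (induction J rule: infinite_finite_induct)
    case (insert j J)
    have "(\<Sum>j\<in>J. y j) \<in> range \<iota>" "y j \<in> range \<iota>" using insert by blast+
    thus ?case unfolding sum.insert[OF insert(1,2)] by (intro addr)
  qed (simp_all add: zr)
  show ?thesis
  proof (intro matrix_rep.intro finite_module.intro operator_axioms finite_module_axioms.intro matrix_rep_axioms.intro M)
    show "subspace (fvecs n (range \<iota>))"
      by (rule subspaceI) (auto simp: fvecs_def fscale_def zr intro: addr multr)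
    show "finite (fvecs n (range \<iota>))" by (rule finite_fvecs)
    fix x assume x: "x \<in> fvecs n (range \<iota>)"
    show "mat_op n (map_mat \<iota> M) x \<in> fvecs n (range \<iota>)"
      using x M by (auto simp: fvecs_def mat_op_def intro!: sumr multr)
  next
    show "bij_betw (fvec \<iota> n) (carrier_vec n) (fvecs n (range \<iota>))"
    proof (rule bij_betw_imageI)
      show "inj_on (fvec \<iota> n) (carrier_vec n)"
      proof (rule inj_onI)
        fix u v assume uv: "u \<in> carrier_vec n" "v \<in> carrier_vec n" "fvec \<iota> n u = fvec \<iota> n v"
        show "u = v"
        proof (rule eq_vecI)
          fix i assume "i < dim_vec v"
          thus "u $ i = v $ i" using fun_cong[OF uv(3), of i] uv(2) by (simp add: fvec_def)
        qed (use uv in simp)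
      qed
      show "fvec \<iota> n ` carrier_vec n = fvecs n (range \<iota>)"
      proof (intro equalityI subsetI)
        fix v assume v: "v \<in> fvecs n (range \<iota>)"
        have "v = fvec \<iota> n (vec n (\<lambda>i. inv_into UNIV \<iota> (v i)))"
          using v by (auto simp: fun_eq_iff fvec_def fvecs_def f_inv_into_f)
        thus "v \<in> fvec \<iota> n ` carrier_vec n" by (rule image_eqI) simp
      qed (auto simp: fvec_def fvecs_def)
    qed
  next
    fix u v :: "'k vec" assume "u \<in> carrier_vec n" "v \<in> carrier_vec n"
    thus "fvec \<iota> n (u + v) = fvec \<iota> n u + fvec \<iota> n v"
      by (auto simp: fvec_def fun_eq_iff h.hom_add)
  next
    fix v :: "'k vec" and a assume "v \<in> carrier_vec n"
    thus "fvec \<iota> n (a \<cdot>\<^sub>v v) = fscale \<iota> a (fvec \<iota> n v)"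
      by (auto simp: fvec_def fscale_def fun_eq_iff h.hom_mult)
  next
    fix v :: "'k vec" assume v: "v \<in> carrier_vec n"
    show "fvec \<iota> n (M *\<^sub>v v) = mat_op n (map_mat \<iota> M) (fvec \<iota> n v)"
    proof
      fix i
      show "fvec \<iota> n (M *\<^sub>v v) i = mat_op n (map_mat \<iota> M) (fvec \<iota> n v) i"
        using v M by (simp add: fvec_def mat_op_def scalar_prod_def atLeast0LessThan h.hom_sum h.hom_mult)
    qed
  qed
qed

lemma field_hom_id: "field_hom (id :: 'a::field \<Rightarrow> 'a)"
  by unfold_locales auto

lemma map_mat_id: "map_mat id M = M"
  by (intro eq_matI) auto

lemma (in operator) act_map_poly:
  fixes \<kappa> :: "'c::field \<Rightarrow> 'k" and s :: "'c \<Rightarrow> 'v \<Rightarrow> 'v"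
  assumes "field_hom \<kappa>" "operator s A" "\<And>a x. s a x = \<kappa> a *s x"
  shows "operator.act s A p v = act (map_poly \<kappa> p) v"
proof -
  interpret h: field_hom \<kappa> by (rule assms)
  show ?thesis
  proof (induction p)
    case (pCons a p)
    have "operator.act s A (pCons a p) v = s a v + A (operator.act s A p v)" by (rule operator.act_pCons[OF assms(2)])
    also have "\<dots> = \<kappa> a *s v + A (act (map_poly \<kappa> p) v)" unfolding pCons.IH assms(3) ..
    also have "\<dots> = act (map_poly \<kappa> (pCons a p)) v"
    proof -
      have "map_poly \<kappa> (pCons a p) = pCons (\<kappa> a) (map_poly \<kappa> p)"
        by (intro poly_eqI) (simp add: coeff_map_poly coeff_pCons split: nat.split)
      thus ?thesis by (simp only: act_pCons)
    qed
    finally show ?case .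
  next
    case 0
    show ?case unfolding operator.act_0[OF assms(2)] by simp
  qed
qed

context matrix_rep
begin

lemma card_kernel_pow:
  "card {v \<in> V. (A ^^ r) v = 0} = card {w \<in> carrier_vec n. (M ^\<^sub>m r) *\<^sub>v w = 0\<^sub>v n}"
proof -
  have inj: "inj_on \<rho> (carrier_vec n)" and img: "\<rho> ` carrier_vec n = V"
    using \<rho>_bij by (auto simp: bij_betw_def)
  have "(A ^^ r) (\<rho> w) = 0 \<longleftrightarrow> (M ^\<^sub>m r) *\<^sub>v w = 0\<^sub>v n" if w: "w \<in> carrier_vec n" for w
  proof -
    have "(A ^^ r) (\<rho> w) = 0 \<longleftrightarrow> \<rho> ((M ^\<^sub>m r) *\<^sub>v w) = \<rho> (0\<^sub>v n)"
      by (simp add: \<rho>_pow[OF w] \<rho>_zero)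
    thus ?thesis using inj_on_eq_iff[OF inj pow_closed[OF w] zero_carrier_vec] by simp
  qed
  hence "{v \<in> V. (A ^^ r) v = 0} = \<rho> ` {w \<in> carrier_vec n. (M ^\<^sub>m r) *\<^sub>v w = 0\<^sub>v n}"
    using img by auto
  thus ?thesis using inj by (simp add: card_image inj_on_subset)
qed

lemma has_primary_typeD:
  assumes type: "has_primary_type M (c, \<nu>)" and part: "is_partition \<nu>"
  obtains f where "monic f" "irreducible f" "degree f = c"
    "\<And>r. card {v \<in> V. act (f ^ r) v = 0} = CARD('k) ^ (c * conj_sum (mset \<nu>) r)"
    "\<And>v. v \<in> V \<Longrightarrow> act (f ^ sum_list \<nu>) v = 0"
proof -
  obtain f where f: "monic f" "irreducible f" "degree f = c" "card V = CARD('k) ^ (c * sum_list \<nu>)"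
    "\<And>r. card {v \<in> V. act (f ^ r) v = 0} = CARD('k) ^ (c * conj_sum (mset \<nu>) r)"
    using type has_primary_type_iff_card[OF part] by blast
  have "k \<le> sum_list \<nu>" if "k \<in> set \<nu>" for k using that member_le_sum_list by blast
  hence "conj_sum (mset \<nu>) (sum_list \<nu>) = sum_list \<nu>"
    using conj_sum_eventually[of "mset \<nu>" "sum_list \<nu>"] by (simp add: sum_mset_sum_list)
  hence "card {v \<in> V. act (f ^ sum_list \<nu>) v = 0} = card V" using f(4,5) by simp
  hence "{v \<in> V. act (f ^ sum_list \<nu>) v = 0} = V" using V_finite by (intro card_subset_eq) auto
  hence "act (f ^ sum_list \<nu>) v = 0" if "v \<in> V" for v using that by blast
  thus ?thesis using that f by blast
qed

end

text \<open>The idempotents of the Chinese remainder theorem: where the product of all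
  \<open>p t\<close> acts as zero, the polynomial \<open>r t\<close> acts as the projection onto the
  kernel of \<open>p t\<close>.\<close>

lemma partition_of_unity:
  fixes p :: "'i \<Rightarrow> 'a::field poly"
  assumes "finite T" "T \<noteq> {}" "\<And>s t. s \<in> T \<Longrightarrow> t \<in> T \<Longrightarrow> s \<noteq> t \<Longrightarrow> coprime (p s) (p t)"
  shows "\<exists>r. (\<Sum>t\<in>T. r t) = 1 \<and> (\<forall>t\<in>T. prod p T dvd p t * r t) \<and>
    (\<forall>s\<in>T. \<forall>t\<in>T. s \<noteq> t \<longrightarrow> p s dvd r t)"
proof -
  have "\<exists>s. (\<Sum>t\<in>T. s t * prod p (T - {t})) = 1"
    using assms
  proof (induction T rule: finite_ne_induct)
    case (singleton x)
    show ?case by (intro exI[of _ "\<lambda>_. 1"]) simp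
  next
    case (insert x T)
    obtain s where s: "(\<Sum>t\<in>T. s t * prod p (T - {t})) = 1" using insert by auto
    have "coprime (p x) (prod p T)" using insert by (intro field_poly_coprime_prod) auto
    then obtain a b where ab: "a * p x + b * prod p T = 1" using field_poly_coprime_bezout by blast
    define s' where "s' t = (if t = x then b else a * s t)" for t
    have rem: "prod p (insert x T - {t}) = p x * prod p (T - {t})" if "t \<in> T" for t
    proof -
      have "insert x T - {t} = insert x (T - {t})" using that insert by auto
      thus ?thesis using insert by simp
    qed
    have "(\<Sum>t\<in>insert x T. s' t * prod p (insert x T - {t}))
        = b * prod p T + (\<Sum>t\<in>T. s' t * prod p (insert x T - {t}))"
      using insert by (simp add: s'_def)
    also have "(\<Sum>t\<in>T. s' t * prod p (insert x T - {t})) = (\<Sum>t\<in>T. (a * p x) * (s t * prod p (T - {t})))"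
      using insert by (intro sum.cong refl) (auto simp: s'_def rem algebra_simps)
    also have "\<dots> = a * p x" by (simp add: s flip: sum_distrib_left)
    finally show ?case using ab by (metis add.commute)
  qed
  then obtain s where s: "(\<Sum>t\<in>T. s t * prod p (T - {t})) = 1" by blast
  show ?thesis
  proof (intro exI[of _ "\<lambda>t. s t * prod p (T - {t})"] conjI ballI impI)
    fix t assume t: "t \<in> T"
    have "prod p T = p t * prod p (T - {t})" using assms(1) t by (rule prod.remove)
    thus "prod p T dvd p t * (s t * prod p (T - {t}))" by (simp add: mult.left_commute)
  next
    fix u t assume "u \<in> T" "t \<in> T" "u \<noteq> t"
    hence "p u dvd prod p (T - {t})" using assms(1) by (intro dvd_prodI) auto
    thus "p u dvd s t * prod p (T - {t})" by simp
  qed (rule s)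
qed

section \<open>Splitting a commuting pair over the extension field\<close>

text \<open>\<open>f\<close> and \<open>g\<close> have the roots \<open>\<alpha>\<^sub>t\<close> (\<open>t\<close> modulo \<open>deg f\<close>) and \<open>\<beta>\<^sub>t\<close> (\<open>t\<close> modulo \<open>deg g\<close>) in the extension field.
  The joint generalised eigenspaces for \<open>(\<alpha>\<^sub>t, \<beta>\<^sub>t\<^sub>+\<^sub>k)\<close>, \<open>k < gcd (deg f) (deg g)\<close>, add up to the space \<open>part t\<close>;
  Frobenius permutes these \<open>l\<close> spaces cyclically.\<close>

locale commuting_pair = finite_field_ext \<iota> l
  for \<iota> :: "'a::finite_field \<Rightarrow> 'b::finite_field" and l +
  fixes n N :: nat and X Y :: "'a mat" and f g :: "'a poly" and \<alpha> \<beta> :: 'b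
  assumes XY: "X \<in> carrier_mat n n" "Y \<in> carrier_mat n n" "X * Y = Y * X"
    and roots: "conjugate_roots f \<alpha>" "conjugate_roots g \<beta>"
    and deg_pos: "degree f > 0" "degree g > 0"
    and l: "l = lcm (degree f) (degree g)"
    and nil_X: "v \<in> fvecs n (range \<iota>) \<Longrightarrow> operator.act (fscale \<iota>) (mat_op n (map_mat \<iota> X)) (f ^ N) v = 0"
    and nil_Y: "v \<in> fvecs n (range \<iota>) \<Longrightarrow> operator.act (fscale \<iota>) (mat_op n (map_mat \<iota> Y)) (g ^ N) v = 0"
begin

abbreviation opX where "opX \<equiv> mat_op n (map_mat \<iota> X)"
abbreviation opY where "opY \<equiv> mat_op n (map_mat \<iota> Y)"
abbreviation W where "W \<equiv> fvecs n (UNIV :: 'b set)"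
abbreviation W0 where "W0 \<equiv> fvecs n (range \<iota>)"

sublocale X: finite_module "fscale id" opX W
proof -
  have "map_mat \<iota> X \<in> carrier_mat n n" using XY(1) by simp
  from matrix_rep_fvec[OF field_hom_id this] show "finite_module (fscale id) opX W"
    by (simp add: map_mat_id matrix_rep_def)
qed

sublocale Y: finite_module "fscale id" opY W
proof -
  have "map_mat \<iota> Y \<in> carrier_mat n n" using XY(2) by simp
  from matrix_rep_fvec[OF field_hom_id this] show "finite_module (fscale id) opY W"
    by (simp add: map_mat_id matrix_rep_def)
qed

lemma opX_opY: "opX (opY v) = opY (opX v)"
proof -
  have "map_mat \<iota> X * map_mat \<iota> Y = map_mat \<iota> Y * map_mat \<iota> X"
    using XY by (metis mat_hom_mult)
  thus ?thesis using XY by (simp add: mat_op_mult)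
qed

lemma actX_actY: "X.act p (Y.act r v) = Y.act r (X.act p v)"
proof -
  have *: "opX (Y.act r v) = Y.act r (opX v)" for v
    by (rule Y.act_commute, rule mat_op_add, rule mat_op_fscale, rule opX_opY)
  have "Y.act r (X.act p v) = X.act p (Y.act r v)"
    by (rule X.act_commute, rule Y.act_add_right, rule Y.act_scale_right, rule *[symmetric])
  thus ?thesis by (rule sym)
qed

lemma act_base:
  "operator.act (fscale \<iota>) opX p v = X.act (map_poly \<iota> p) v"
  "operator.act (fscale \<iota>) opY p v = Y.act (map_poly \<iota> p) v"
  by (rule X.act_map_poly Y.act_map_poly, rule hom_embedding, rule operator_mat_op, rule hom_embedding, simp add: fscale_def)+

definition unit_fun :: "nat \<Rightarrow> nat \<Rightarrow> 'b" where
  "unit_fun i = (\<lambda>j. if j = i then 1 else 0)"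

lemma W_decompose:
  assumes "v \<in> W"
  shows "v = (\<Sum>i<n. fscale id (v i) (unit_fun i))"
proof
  fix j
  have "(\<Sum>i<n. fscale id (v i) (unit_fun i)) j = (\<Sum>i<n. if i = j then v i else 0)"
    unfolding sum_fun_apply by (intro sum.cong refl) (simp add: fscale_def unit_fun_def)
  thus "v j = (\<Sum>i<n. fscale id (v i) (unit_fun i)) j" using assms by (simp add: fvecs_def)
qed

lemma unit_fun_W0: "i < n \<Longrightarrow> unit_fun i \<in> W0"
proof -
  have "0 \<in> range \<iota>" by (rule range_eqI[of _ _ 0]) simp
  moreover have "1 \<in> range \<iota>" by (rule range_eqI[of _ _ 1]) simp
  ultimately show "i < n \<Longrightarrow> unit_fun i \<in> W0" by (simp add: fvecs_def unit_fun_def)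
qed

text \<open>The unit vectors lie in \<open>W0\<close> and span \<open>W\<close> over the larger
  field, so vanishing on \<open>W0\<close> extends to \<open>W\<close> by linearity.\<close>

lemma nilpotent_W:
  assumes "v \<in> W"
  shows "X.act (map_poly \<iota> f ^ N) v = 0" "Y.act (map_poly \<iota> g ^ N) v = 0"
proof -
  have "X.act (map_poly \<iota> f ^ N) (unit_fun i) = 0" "Y.act (map_poly \<iota> g ^ N) (unit_fun i) = 0" if "i < n" for i
    using nil_X[OF unit_fun_W0[OF that]] nil_Y[OF unit_fun_W0[OF that]]
    by (simp_all add: act_base P.hom_power)
  thus "X.act (map_poly \<iota> f ^ N) v = 0" "Y.act (map_poly \<iota> g ^ N) v = 0"
    by (subst W_decompose[OF assms], simp add: X.act_sum_right X.act_scale_right Y.act_sum_right Y.act_scale_right)+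
qed

abbreviation c where "c \<equiv> degree f"
abbreviation d where "d \<equiv> degree g"
abbreviation h where "h \<equiv> gcd c d"

section \<open>The factors of \<open>f\<close> and \<open>g\<close> that cut out
  \<open>part t\<close>, and the resulting projections\<close>

definition \<alpha>s where "\<alpha>s t = \<alpha> ^ (CARD('a) ^ t)"
definition \<beta>s where "\<beta>s t = \<beta> ^ (CARD('a) ^ t)"

lemma periodic_mod:
  assumes "z ^ (CARD('a) ^ e) = (z :: 'b)"
  shows "z ^ (CARD('a) ^ t) = z ^ (CARD('a) ^ (t mod e))"
proof -
  have *: "z ^ (CARD('a) ^ (e * k)) = z" for k
  proof (induction k)
    case (Suc k)
    have "z ^ (CARD('a) ^ (e * Suc k)) = (z ^ (CARD('a) ^ e)) ^ (CARD('a) ^ (e * k))"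
      by (simp only: mult_Suc_right power_add power_mult)
    thus ?case using assms Suc by simp
  qed simp
  have "z ^ (CARD('a) ^ t) = z ^ (CARD('a) ^ (e * (t div e) + t mod e))" by simp
  also have "\<dots> = (z ^ (CARD('a) ^ (e * (t div e)))) ^ (CARD('a) ^ (t mod e))"
    by (simp only: power_add power_mult)
  finally show ?thesis unfolding * .
qed

lemma \<alpha>s_mod: "\<alpha>s t = \<alpha>s (t mod c)"
  unfolding \<alpha>s_def using roots(1) by (intro periodic_mod) (simp add: conjugate_roots_def)

lemma \<beta>s_mod: "\<beta>s t = \<beta>s (t mod d)"
  unfolding \<beta>s_def using roots(2) by (intro periodic_mod) (simp add: conjugate_roots_def)

lemma \<alpha>s_eq: "\<alpha>s s = \<alpha>s t \<Longrightarrow> s mod c = t mod c"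
  using roots(1) deg_pos \<alpha>s_mod[of s] \<alpha>s_mod[of t] unfolding conjugate_roots_def inj_on_def \<alpha>s_def
  by (metis lessThan_iff mod_less_divisor)

lemma \<beta>s_eq: "\<beta>s s = \<beta>s t \<Longrightarrow> s mod d = t mod d"
  using roots(2) deg_pos \<beta>s_mod[of s] \<beta>s_mod[of t] unfolding conjugate_roots_def inj_on_def \<beta>s_def
  by (metis lessThan_iff mod_less_divisor)

definition pX where "pX t = [:- \<alpha>s t, 1:] ^ N"
text \<open>A window of \<open>h\<close> consecutive conjugates of \<open>\<beta>\<close>. The
  indices \<open>t < l\<close> with a fixed residue modulo \<open>c\<close> also share their residue
  modulo \<open>h\<close>, and the windows that start at them tile the residues modulo
  \<open>d\<close>.\<close>

definition pY where "pY t = (\<Prod>k<h. [:- \<beta>s (t + k), 1:] ^ N)"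

definition part where "part t = {w \<in> W. X.act (pX t) w = 0 \<and> Y.act (pY t) w = 0}"

definition fib where "fib i = {t. t < l \<and> t mod c = i}"

lemma prod_pX: "(\<Prod>i<c. pX i) = map_poly \<iota> f ^ N"
  using roots(1) by (simp add: pX_def \<alpha>s_def conjugate_roots_def prod_power_distrib)

lemma coprime_pX: "s < c \<Longrightarrow> t < c \<Longrightarrow> s \<noteq> t \<Longrightarrow> coprime (pX s) (pX t)"
  unfolding pX_def by (intro field_poly_coprime_power coprime_linear) (use \<alpha>s_eq in force)

text \<open>Modulo \<open>h\<close> the starting points \<open>s\<close> and \<open>t\<close> agree,
  so \<open>k\<close> and \<open>k'\<close> agree there and are equal. Then \<open>s\<close> and
  \<open>t\<close> agree modulo \<open>d\<close> as well as modulo \<open>c\<close>, hence modulo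
  \<open>l\<close>.\<close>

lemma fib_inj:
  assumes "s \<in> fib i" "t \<in> fib i" "k < h" "k' < h" "(s + k) mod d = (t + k') mod d"
  shows "s = t \<and> k = k'"
proof -
  have st: "s mod c = t mod c" "s < l" "t < l" using assms by (auto simp: fib_def)
  have "(s + k) mod h = (t + k') mod h"
    using assms(5) by (metis gcd_dvd2 mod_mod_cancel)
  moreover have "s mod h = t mod h" using st(1) by (metis gcd_dvd1 mod_mod_cancel)
  ultimately have "[s + k = s + k'] (mod h)" unfolding cong_def by (metis mod_add_left_eq)
  hence "[k = k'] (mod h)" by (simp add: cong_add_lcancel_nat)
  hence kk: "k = k'" using assms(3,4) by (simp add: cong_def)
  hence "[s = t] (mod d)" using assms(5) by (simp add: cong_def[symmetric] cong_add_rcancel_nat)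
  moreover have "[s = t] (mod c)" using st by (simp add: cong_def)
  ultimately have "[s = t] (mod (lcm c d))" by (simp add: cong_cong_lcm_nat)
  thus ?thesis using st l kk by (simp add: cong_def)
qed

lemma card_fib: "i < c \<Longrightarrow> card (fib i) * h = d"
proof -
  assume i: "i < c"
  obtain k where k: "l = c * k" using l by (metis dvd_def dvd_lcm1)
  have "c * k * h = c * d" using k l by (metis mult.commute prod_gcd_lcm_nat)
  hence kh: "k * h = d" using deg_pos by simp
  have "bij_betw (\<lambda>a. i + c * a) {..<k} (fib i)"
  proof (rule bij_betw_byWitness[where f' = "\<lambda>t. t div c"])
    show "\<forall>a\<in>{..<k}. (i + c * a) div c = a" using i by simp
    show "\<forall>t\<in>fib i. i + c * (t div c) = t" by (auto simp: fib_def)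
    show "(\<lambda>a. i + c * a) ` {..<k} \<subseteq> fib i"
    proof (intro image_subsetI)
      fix a assume "a \<in> {..<k}"
      hence "c * (a + 1) \<le> c * k" by (intro mult_left_mono) auto
      hence "i + c * a < l" using i k by simp
      thus "i + c * a \<in> fib i" using i by (simp add: fib_def)
    qed
    show "(\<lambda>t. t div c) ` fib i \<subseteq> {..<k}"
    proof (intro image_subsetI)
      fix t assume "t \<in> fib i"
      hence "t < k * c" using k unfolding fib_def by (simp add: mult.commute)
      thus "t div c \<in> {..<k}" by (simp add: less_mult_imp_div_less)
    qed
  qed
  hence "card (fib i) = k" using bij_betw_same_card by fastforce
  thus ?thesis using kh by simp
qed

lemma finite_fib: "finite (fib i)" by (simp add: fib_def)

text \<open>The windows over one fibre are disjoint modulo \<open>d\<close> by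
  \<open>fib_inj\<close>, and by \<open>card_fib\<close> they contain \<open>d\<close> indices in
  all. So every root of \<open>g\<close> occurs exactly once.\<close>

lemma prod_pY:
  assumes "i < c"
  shows "(\<Prod>t\<in>fib i. pY t) = map_poly \<iota> g ^ N"
proof -
  let ?m = "\<lambda>(t, k). (t + k) mod d"
  have inj: "inj_on ?m (fib i \<times> {..<h})"
    using fib_inj by (auto simp: inj_on_def)
  have "card (?m ` (fib i \<times> {..<h})) = d"
    using card_fib[OF assms] by (simp add: card_image[OF inj] card_cartesian_product)
  moreover have "?m ` (fib i \<times> {..<h}) \<subseteq> {..<d}" using deg_pos by auto
  ultimately have img: "?m ` (fib i \<times> {..<h}) = {..<d}"
    by (intro card_subset_eq) auto
  have "(\<Prod>t\<in>fib i. pY t) = (\<Prod>(t, k)\<in>fib i \<times> {..<h}. [:- \<beta>s (t + k), 1:] ^ N)"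
    unfolding pY_def by (rule prod.cartesian_product)
  also have "\<dots> = (\<Prod>x\<in>fib i \<times> {..<h}. [:- \<beta>s (?m x), 1:] ^ N)"
    by (intro prod.cong refl) (auto simp: \<beta>s_mod[symmetric])
  also have "\<dots> = (\<Prod>j\<in>{..<d}. [:- \<beta>s j, 1:] ^ N)"
    using prod.reindex[OF inj, of "\<lambda>j. [:- \<beta>s j, 1:] ^ N"] img by (simp add: comp_def)
  also have "\<dots> = map_poly \<iota> g ^ N"
    using roots(2) by (simp add: \<beta>s_def conjugate_roots_def prod_power_distrib)
  finally show ?thesis .
qed

lemma coprime_pY:
  assumes "s \<in> fib i" "t \<in> fib i" "s \<noteq> t"
  shows "coprime (pY s) (pY t)"
proof -
  have "coprime ([:- \<beta>s (s + k), 1:] ^ N) ([:- \<beta>s (t + k'), 1:] ^ N)" if "k < h" "k' < h" for k k'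
    using \<beta>s_eq[of "s + k" "t + k'"] fib_inj[OF assms(1,2) that] assms(3)
    by (intro field_poly_coprime_power coprime_linear) blast
  hence "coprime ([:- \<beta>s (s + k), 1:] ^ N) (pY t)" if "k < h" for k
    unfolding pY_def using that by (intro field_poly_coprime_prod) simp
  hence "coprime (pY t) (pY s)"
    unfolding pY_def[of s] by (intro field_poly_coprime_prod) (simp add: coprime_commute)
  thus ?thesis by (simp add: coprime_commute)
qed

lemma fib_nonempty: "i < c \<Longrightarrow> fib i \<noteq> {}"
  using card_fib[of i] deg_pos by (metis card.empty less_irrefl mult_0)

text \<open>Two partitions of unity are composed: \<open>f(X)^N = 0\<close> separates the residues
  of \<open>t\<close> modulo \<open>c\<close>, and \<open>g(Y)^N = 0\<close> separates the indices
  inside one residue class. For \<open>s\<close> and \<open>t\<close> in the same class the factor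
  in \<open>Y\<close> annihilates, otherwise the factor in \<open>X\<close>.\<close>

lemma ex_projections:
  "\<exists>E. (\<forall>v\<in>W. (\<Sum>t<l. E t v) = v) \<and> (\<forall>v\<in>W. \<forall>t<l. E t v \<in> part t) \<and>
    (\<forall>s<l. \<forall>t<l. s \<noteq> t \<longrightarrow> (\<forall>u\<in>part s. E t u = 0)) \<and> (\<forall>t u v. E t (u + v) = E t u + E t v)"
proof -
  have "\<exists>r. (\<Sum>i<c. r i) = 1 \<and> (\<forall>i\<in>{..<c}. prod pX {..<c} dvd pX i * r i) \<and>
      (\<forall>i\<in>{..<c}. \<forall>j\<in>{..<c}. i \<noteq> j \<longrightarrow> pX i dvd r j)"
    using deg_pos coprime_pX by (intro partition_of_unity) auto
  then obtain rX where rX: "(\<Sum>i<c. rX i) = 1" "\<And>i. i < c \<Longrightarrow> map_poly \<iota> f ^ N dvd pX i * rX i"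
    "\<And>i j. i < c \<Longrightarrow> j < c \<Longrightarrow> i \<noteq> j \<Longrightarrow> pX i dvd rX j"
    unfolding prod_pX by blast
  have "\<exists>r. (\<Sum>t\<in>fib i. r t) = 1 \<and> (\<forall>t\<in>fib i. prod pY (fib i) dvd pY t * r t) \<and>
      (\<forall>s\<in>fib i. \<forall>t\<in>fib i. s \<noteq> t \<longrightarrow> pY s dvd r t)" if "i < c" for i
    using finite_fib fib_nonempty[OF that] coprime_pY by (intro partition_of_unity) auto
  hence "\<forall>i. \<exists>r. i < c \<longrightarrow> (\<Sum>t\<in>fib i. r t) = 1 \<and> (\<forall>t\<in>fib i. map_poly \<iota> g ^ N dvd pY t * r t) \<and>
      (\<forall>s\<in>fib i. \<forall>t\<in>fib i. s \<noteq> t \<longrightarrow> pY s dvd r t)"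
    using prod_pY by simp
  from choice[OF this] obtain rY where
    rY: "\<forall>i. i < c \<longrightarrow> (\<Sum>t\<in>fib i. rY i t) = 1 \<and> (\<forall>t\<in>fib i. map_poly \<iota> g ^ N dvd pY t * rY i t) \<and>
      (\<forall>s\<in>fib i. \<forall>t\<in>fib i. s \<noteq> t \<longrightarrow> pY s dvd rY i t)" by (rule exE)
  have rY1: "(\<Sum>t\<in>fib i. rY i t) = 1" if "i < c" for i
    using rY[rule_format, OF that] by (rule conjunct1)
  have rY2: "map_poly \<iota> g ^ N dvd pY t * rY i t" if "i < c" "t \<in> fib i" for i t
    using rY[rule_format, OF that(1), THEN conjunct2, THEN conjunct1] that(2) by (rule bspec)
  have rY3: "pY s dvd rY i t" if "i < c" "s \<in> fib i" "t \<in> fib i" "s \<noteq> t" for i s t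
    using rY[rule_format, OF that(1), THEN conjunct2, THEN conjunct2] that(2-4) by simp
  define E where "E t v = X.act (rX (t mod c)) (Y.act (rY (t mod c) t) v)" for t v
  have modc: "t mod c < c" for t using deg_pos by simp
  have fibI: "t \<in> fib (t mod c)" if "t < l" for t using that by (simp add: fib_def)
  have pX_mod: "pX t = pX (t mod c)" for t by (simp add: pX_def \<alpha>s_mod[symmetric])
  have 1: "(\<Sum>t<l. E t v) = v" for v
  proof -
    have "(\<Sum>t<l. E t v) = (\<Sum>i<c. \<Sum>t\<in>{t\<in>{..<l}. t mod c = i}. E t v)"
      by (rule sum.group[symmetric]) (use deg_pos in auto)
    also have "\<dots> = (\<Sum>i<c. X.act (rX i) (Y.act (\<Sum>t\<in>fib i. rY i t) v))"
      unfolding Y.act_sum X.act_sum_right by (intro sum.cong) (auto simp: fib_def E_def)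
    also have "\<dots> = (\<Sum>i<c. X.act (rX i) v)" by (intro sum.cong refl) (simp add: rY1)
    also have "\<dots> = v" using rX(1) by (simp flip: X.act_sum)
    finally show ?thesis .
  qed
  have 2: "E t v \<in> part t" if "v \<in> W" "t < l" for v t
  proof -
    have "E t v \<in> W" unfolding E_def using that by (intro X.act_closed Y.act_closed)
    moreover have "X.act (pX t) (E t v) = Y.act (rY (t mod c) t) (X.act (pX (t mod c) * rX (t mod c)) v)"
      unfolding E_def pX_mod[of t] by (simp only: X.act_mult actX_actY)
    moreover have "X.act (pX (t mod c) * rX (t mod c)) v = 0"
      using rX(2)[OF modc] nilpotent_W(1)[OF that(1)] by (rule X.act_dvd_eq_0)
    moreover have "Y.act (pY t) (E t v) = X.act (rX (t mod c)) (Y.act (pY t * rY (t mod c) t) v)"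
      unfolding E_def by (simp only: Y.act_mult actX_actY)
    moreover have "Y.act (pY t * rY (t mod c) t) v = 0"
      using rY2[OF modc fibI[OF that(2)]] nilpotent_W(2)[OF that(1)] by (rule Y.act_dvd_eq_0)
    ultimately show ?thesis unfolding part_def
      by (simp only: mem_Collect_eq X.act_zero_right Y.act_zero_right simp_thms)
  qed
  have 3: "E t u = 0" if "s < l" "t < l" "s \<noteq> t" "u \<in> part s" for s t u
  proof (cases "s mod c = t mod c")
    case True
    have "pY s dvd rY (t mod c) t"
      by (rule rY3[OF modc _ fibI[OF that(2)] that(3)]) (use fibI[OF that(1)] True in simp)
    moreover have "Y.act (pY s) u = 0" using that(4) by (simp add: part_def)
    ultimately have "Y.act (rY (t mod c) t) u = 0" by (rule Y.act_dvd_eq_0)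
    thus ?thesis by (simp add: E_def)
  next
    case False
    have "pX (s mod c) dvd rX (t mod c)" using rX(3)[OF modc modc False] .
    moreover have "X.act (pX (s mod c)) u = 0" using that(4) pX_mod[of s] by (simp add: part_def)
    ultimately have "X.act (rX (t mod c)) u = 0" by (rule X.act_dvd_eq_0)
    thus ?thesis by (simp add: E_def actX_actY)
  qed
  have 4: "E t (u + v) = E t u + E t v" for t u v
    by (simp add: E_def X.act_add_right Y.act_add_right)
  show ?thesis using 1 2 3 4 by blast
qed

section \<open>The Frobenius map on vectors, and the trace from \<open>part 0\<close> to
  \<open>K^n\<close>\<close>

definition frob :: "(nat \<Rightarrow> 'b) \<Rightarrow> nat \<Rightarrow> 'b" where
  "frob v = (\<lambda>i. v i ^ CARD('a))"

lemma frob_hom: "comm_ring_hom (\<lambda>x :: 'b. x ^ CARD('a))"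
  using frob_add[of _ _ 1] q_gt_1 by unfold_locales (auto simp: power_mult_distrib)

lemma frob_plus: "frob (u + v) = frob u + frob v"
  using frob_add[of _ _ 1] by (simp add: frob_def fun_eq_iff)

lemma frob_zero: "frob 0 = 0"
  using q_gt_1 by (simp add: frob_def fun_eq_iff power_0_left)

lemma frob_sum_fun: "frob (\<Sum>j\<in>J. x j) = (\<Sum>j\<in>J. frob (x j))"
  by (induction J rule: infinite_finite_induct) (simp_all only: sum.infinite sum.empty sum.insert frob_zero frob_plus not_False_eq_True)

lemma frob_funpow_apply: "(frob ^^ t) v i = v i ^ (CARD('a) ^ t)"
proof (induction t)
  case (Suc t)
  have "(frob ^^ Suc t) v i = ((frob ^^ t) v i) ^ CARD('a)" by (simp add: frob_def)
  also have "\<dots> = v i ^ (CARD('a) ^ Suc t)" unfolding Suc by (metis power_Suc2 power_mult)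
  finally show ?case .
qed simp

lemma frob_funpow_l: "(frob ^^ l) v = v"
  by (rule ext) (simp only: frob_funpow_apply frob_period)

lemma frob_W: "v \<in> W \<Longrightarrow> frob v \<in> W"
  using q_gt_1 by (simp add: fvecs_def frob_def power_0_left)

lemma W0_iff: "v \<in> W0 \<longleftrightarrow> v \<in> W \<and> frob v = v"
proof -
  have "(\<forall>i<n. v i \<in> range \<iota>) \<longleftrightarrow> frob v = v" if z: "\<forall>i\<ge>n. v i = 0"
  proof -
    have "v i ^ CARD('a) = v i" if "i \<ge> n" for i using z that q_gt_1 by (simp add: power_0_left)
    thus ?thesis unfolding range_iff fun_eq_iff frob_def by (metis not_le)
  qed
  thus ?thesis by (auto simp: fvecs_def)
qed

lemma frob_mat_op:
  assumes "M \<in> carrier_mat n n"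
  shows "frob (mat_op n (map_mat \<iota> M) v) = mat_op n (map_mat \<iota> M) (frob v)"
proof
  fix i
  show "frob (mat_op n (map_mat \<iota> M) v) i = mat_op n (map_mat \<iota> M) (frob v) i"
  proof (cases "i < n")
    case True
    have "(\<Sum>j<n. map_mat \<iota> M $$ (i, j) * v j) ^ CARD('a) = (\<Sum>j<n. (map_mat \<iota> M $$ (i, j) * v j) ^ CARD('a))"
      using frob_sum[where i = 1] by simp
    also have "\<dots> = (\<Sum>j<n. map_mat \<iota> M $$ (i, j) * v j ^ CARD('a))"
      using True assms by (intro sum.cong refl) (simp add: power_mult_distrib frob_embed)
    finally show ?thesis using True by (simp add: frob_def mat_op_def)
  next
    case False
    thus ?thesis using q_gt_1 by (simp add: frob_def mat_op_def power_0_left)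
  qed
qed

lemma frob_fscale: "frob (fscale id a v) = fscale id (a ^ CARD('a)) (frob v)"
  by (simp add: frob_def fscale_def fun_eq_iff power_mult_distrib)

lemma frob_poly_pCons: "map_poly (\<lambda>x :: 'b. x ^ CARD('a)) (pCons a p) = pCons (a ^ CARD('a)) (map_poly (\<lambda>x :: 'b. x ^ CARD('a)) p)"
  using q_gt_1 by (intro poly_eqI) (simp add: coeff_map_poly coeff_pCons power_0_left split: nat.split)

text \<open>Frobenius is semilinear and commutes with \<open>opX\<close> and \<open>opY\<close>,
  whose matrices have entries in the base field; it therefore acts only on the coefficients of the
  polynomial.\<close>

lemma frob_act:
  "frob (X.act p v) = X.act (map_poly (\<lambda>x :: 'b. x ^ CARD('a)) p) (frob v)"
  "frob (Y.act p v) = Y.act (map_poly (\<lambda>x :: 'b. x ^ CARD('a)) p) (frob v)"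
proof -
  show "frob (X.act p v) = X.act (map_poly (\<lambda>x :: 'b. x ^ CARD('a)) p) (frob v)"
  proof (induction p)
    case (pCons a p)
    show ?case
      unfolding X.act_pCons frob_poly_pCons frob_plus frob_fscale frob_mat_op[OF XY(1)] pCons.IH ..
  next
    case 0
    show ?case by (simp only: map_poly_0 X.act_0 frob_zero)
  qed
  show "frob (Y.act p v) = Y.act (map_poly (\<lambda>x :: 'b. x ^ CARD('a)) p) (frob v)"
  proof (induction p)
    case (pCons a p)
    show ?case
      unfolding Y.act_pCons frob_poly_pCons frob_plus frob_fscale frob_mat_op[OF XY(2)] pCons.IH ..
  next
    case 0
    show ?case by (simp only: map_poly_0 Y.act_0 frob_zero)
  qed
qed

lemma frob_poly_base: "map_poly (\<lambda>x :: 'b. x ^ CARD('a)) (map_poly \<iota> p) = map_poly \<iota> p"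
  using q_gt_1 by (intro poly_eqI) (simp add: coeff_map_poly frob_embed power_0_left)

lemma frob_poly_linear: "map_poly (\<lambda>x :: 'b. x ^ CARD('a)) ([:- z, 1:] ^ N) = [:- (z ^ CARD('a)), 1:] ^ N"
proof -
  interpret fr: comm_ring_hom "\<lambda>x :: 'b. x ^ CARD('a)" by (rule frob_hom)
  interpret Fr: map_poly_comm_ring_hom "\<lambda>x :: 'b. x ^ CARD('a)" ..
  have "map_poly (\<lambda>x :: 'b. x ^ CARD('a)) [:- z, 1:] = [:- (z ^ CARD('a)), 1:]"
    using fr.hom_uminus[of z] by (simp add: frob_poly_pCons)
  thus ?thesis by (simp only: Fr.hom_power)
qed

lemma roots_Suc: "\<alpha>s t ^ CARD('a) = \<alpha>s (Suc t)" "\<beta>s t ^ CARD('a) = \<beta>s (Suc t)"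
  unfolding \<alpha>s_def \<beta>s_def by (metis power_Suc2 power_mult)+

lemma frob_pX: "map_poly (\<lambda>x :: 'b. x ^ CARD('a)) (pX t) = pX (Suc t)"
  unfolding pX_def frob_poly_linear roots_Suc ..

lemma frob_pY: "map_poly (\<lambda>x :: 'b. x ^ CARD('a)) (pY t) = pY (Suc t)"
proof -
  interpret fr: comm_ring_hom "\<lambda>x :: 'b. x ^ CARD('a)" by (rule frob_hom)
  interpret Fr: map_poly_comm_ring_hom "\<lambda>x :: 'b. x ^ CARD('a)" ..
  show ?thesis
    unfolding pY_def Fr.hom_prod frob_poly_linear roots_Suc by simp
qed

lemma frob_part:
  assumes "u \<in> part t"
  shows "frob u \<in> part (Suc t)"
proof -
  have "X.act (pX (Suc t)) (frob u) = 0" "Y.act (pY (Suc t)) (frob u) = 0"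
    using assms frob_act(1)[of "pX t" u] frob_act(2)[of "pY t" u]
    by (simp_all add: part_def frob_pX frob_pY frob_zero)
  thus ?thesis using assms frob_W by (simp add: part_def)
qed

text \<open>Closes the cycle of the parts: \<open>c\<close> and \<open>d\<close> divide
  \<open>l\<close>, so shifting all indices by \<open>l\<close> changes none of the roots.\<close>

lemma part_l: "part l = part 0"
proof -
  have "\<alpha>s l = \<alpha>s 0" using \<alpha>s_mod[of l] l by simp
  moreover have "\<beta>s (l + k) = \<beta>s (0 + k)" for k
  proof -
    have "(l + k) mod d = k mod d" using l by (metis dvd_lcm2 mod_add_self1 mod_mod_cancel dvd_def mod_mult_self2 add.commute)
    thus ?thesis using \<beta>s_mod[of "l + k"] \<beta>s_mod[of "0 + k"] by simp
  qed
  ultimately show ?thesis unfolding part_def pX_def pY_def by simp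
qed

lemma frob_funpow_part: "u \<in> part 0 \<Longrightarrow> (frob ^^ t) u \<in> part t"
  by (induction t) (simp_all add: frob_part)

definition trace :: "(nat \<Rightarrow> 'b) \<Rightarrow> nat \<Rightarrow> 'b" where
  "trace u = (\<Sum>t<l. (frob ^^ t) u)"

text \<open>Linearity over \<open>K[x]\<close> for the actions of \<open>X\<close> and
  \<open>Y\<close>. It holds for polynomials over the base field only, hence the choice of
  \<open>f(X)\<close> and \<open>g(Y)\<close> as nilpotent operators.\<close>

lemma trace_act:
  "trace (X.act (map_poly \<iota> p) u) = X.act (map_poly \<iota> p) (trace u)"
  "trace (Y.act (map_poly \<iota> p) u) = Y.act (map_poly \<iota> p) (trace u)"
proof -
  have "(frob ^^ t) (X.act (map_poly \<iota> p) u) = X.act (map_poly \<iota> p) ((frob ^^ t) u)" for t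
    by (induction t) (simp_all only: funpow_0 funpow.simps(2) comp_apply frob_act frob_poly_base)
  thus "trace (X.act (map_poly \<iota> p) u) = X.act (map_poly \<iota> p) (trace u)"
    by (simp only: trace_def X.act_sum_right)
  have "(frob ^^ t) (Y.act (map_poly \<iota> p) u) = Y.act (map_poly \<iota> p) ((frob ^^ t) u)" for t
    by (induction t) (simp_all only: funpow_0 funpow.simps(2) comp_apply frob_act frob_poly_base)
  thus "trace (Y.act (map_poly \<iota> p) u) = Y.act (map_poly \<iota> p) (trace u)"
    by (simp only: trace_def Y.act_sum_right)
qed

lemma part_W: "u \<in> part t \<Longrightarrow> u \<in> W"
  by (simp add: part_def)

lemma frob_trace: "frob (trace u) = trace u"
proof -
  \<comment> \<open>Splitting the last or the first term off a sum of \<open>l + 1\<close>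
    conjugates compares the trace with its Frobenius image, because \<open>frob ^^ l\<close> is the
    identity.\<close>
  have "trace u + (frob ^^ l) u = (\<Sum>t<Suc l. (frob ^^ t) u)" by (simp add: trace_def)
  also have "\<dots> = (frob ^^ 0) u + (\<Sum>t<l. (frob ^^ Suc t) u)" by (rule sum.lessThan_Suc_shift)
  also have "(\<Sum>t<l. (frob ^^ Suc t) u) = frob (trace u)" by (simp add: trace_def frob_sum_fun)
  finally have "trace u + u = u + frob (trace u)" by (simp only: frob_funpow_l funpow_0)
  thus ?thesis by (metis add.commute add_left_imp_eq)
qed

lemma trace_W0:
  assumes "u \<in> part 0"
  shows "trace u \<in> W0"
proof -
  have "(frob ^^ t) u \<in> W" for t using frob_funpow_part[OF assms] by (rule part_W)
  hence "trace u \<in> W" unfolding trace_def by (intro X.sum_closed)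
  thus ?thesis using W0_iff frob_trace by blast
qed

text \<open>A Frobenius-invariant vector is recovered from its component in \<open>part 0\<close>, since its other components
  are the conjugates of that one.\<close>

lemma trace_bij: "bij_betw trace (part 0) W0"
proof -
  obtain E where proj: "(\<forall>v\<in>W. (\<Sum>t<l. E t v) = v) \<and> (\<forall>v\<in>W. \<forall>t<l. E t v \<in> part t) \<and>
    (\<forall>s<l. \<forall>t<l. s \<noteq> t \<longrightarrow> (\<forall>u\<in>part s. E t u = 0)) \<and> (\<forall>t u v. E t (u + v) = E t u + E t v)"
    using ex_projections by (rule exE)
  have E: "(\<Sum>t<l. E t v) = v" if "v \<in> W" for v
    using proj[THEN conjunct1] that by (rule bspec)
  have E_part: "E t v \<in> part t" if "v \<in> W" "t < l" for v t
    using proj[THEN conjunct2, THEN conjunct1, THEN bspec, OF that(1)] that(2) by simp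
  have E_other: "E t u = 0" if "s < l" "t < l" "s \<noteq> t" "u \<in> part s" for s t u
    using proj[THEN conjunct2, THEN conjunct2, THEN conjunct1, rule_format, OF that] .
  have E_add: "E t (u + v) = E t u + E t v" for t u v
    using proj[THEN conjunct2, THEN conjunct2, THEN conjunct2] by (simp only: simp_thms)
  have E0: "E t 0 = 0" for t using E_add[of t 0 0] by simp
  have Esum: "E t (\<Sum>j\<in>J. x j) = (\<Sum>j\<in>J. E t (x j))" for t x and J :: "nat set"
    by (induction J rule: infinite_finite_induct)
      (simp_all only: sum.infinite sum.empty sum.insert E0 E_add not_False_eq_True)
  have Eself: "E t u = u" if "t < l" "u \<in> part t" for t u
  proof -
    have "u = (\<Sum>s<l. E s u)" using E[OF part_W[OF that(2)]] by (rule sym)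
    also have "\<dots> = (\<Sum>s\<in>{t}. E s u)"
      using that E_other[of t _ u] by (intro sum.mono_neutral_right) auto
    finally show ?thesis by simp
  qed
  have Etrace: "E 0 (trace u) = u" if "u \<in> part 0" for u
  proof -
    have "E 0 (trace u) = (\<Sum>t<l. E 0 ((frob ^^ t) u))" by (simp add: trace_def Esum)
    also have "\<dots> = (\<Sum>t\<in>{0}. E 0 ((frob ^^ t) u))"
      using l_pos E_other[OF _ l_pos _ frob_funpow_part[OF that]] by (intro sum.mono_neutral_right) auto
    also have "\<dots> = u" using Eself[OF l_pos that] by simp
    finally show ?thesis .
  qed
  have comp: "E t v = (frob ^^ t) (E 0 v)" if v: "v \<in> W0" and "t < l" for v t
    using that(2)
  proof (induction t)
    case (Suc t)
    have vW: "v \<in> W" "frob v = v" using v W0_iff by blast+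
    have pt: "frob (E s v) \<in> part (Suc s)" if "s < l" for s
      using frob_part[OF E_part[OF vW(1) that]] .
    have "v = (\<Sum>s<l. frob (E s v))" using vW(2) E[OF vW(1)] by (simp flip: frob_sum_fun)
    hence "E (Suc t) v = (\<Sum>s<l. E (Suc t) (frob (E s v)))" by (metis Esum)
    also have "\<dots> = (\<Sum>s\<in>{t}. E (Suc t) (frob (E s v)))"
    proof (intro sum.mono_neutral_right ballI)
      fix s assume s: "s \<in> {..<l} - {t}"
      show "E (Suc t) (frob (E s v)) = 0"
      proof (cases "Suc s < l")
        case True
        thus ?thesis using s Suc.prems pt by (intro E_other[of "Suc s"]) auto
      next
        \<comment> \<open>The image of the last component wraps around to \<open>part 0\<close>,
          which is still different from \<open>part (Suc t)\<close>.\<close>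
        case False
        hence "Suc s = l" using s by simp
        hence "frob (E s v) \<in> part 0" using pt[of s] s part_l by simp
        thus ?thesis using Suc.prems by (intro E_other[of 0]) auto
      qed
    qed (use Suc.prems in auto)
    also have "\<dots> = frob (E t v)" using Eself[OF Suc.prems pt[of t]] Suc.prems by simp
    also have "E t v = (frob ^^ t) (E 0 v)" using Suc.prems by (intro Suc.IH) simp
    finally show ?case by (simp only: funpow.simps comp_apply)
  next
    case 0
    show ?case by (rule funpow_0[symmetric])
  qed
  have traceE: "trace (E 0 v) = v" if v: "v \<in> W0" for v
  proof -
    have "trace (E 0 v) = (\<Sum>t<l. E t v)" unfolding trace_def
      by (rule sum.cong[OF refl], rule comp[OF v, symmetric]) (simp only: lessThan_iff)
    also have "\<dots> = v" using v by (intro E) (simp only: W0_iff)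
    finally show ?thesis .
  qed
  have E0_part: "E 0 v \<in> part 0" if "v \<in> W0" for v
    using that by (intro E_part l_pos) (simp only: W0_iff)
  show ?thesis
    by (rule bij_betw_byWitness[where f' = "E 0"])
      (intro ballI Etrace traceE image_subsetI trace_W0 E0_part; assumption)+
qed

lemma zero_part: "0 \<in> part t"
  using X.subspace_0[OF X.V_subspace] by (simp add: part_def)

lemma act_part: "u \<in> part t \<Longrightarrow> X.act p u \<in> part t" "u \<in> part t \<Longrightarrow> Y.act p u \<in> part t"
proof -
  assume u: "u \<in> part t"
  have "X.act (pX t) (X.act p u) = X.act p (X.act (pX t) u)"
    by (simp add: mult.commute flip: X.act_mult)
  moreover have "Y.act (pY t) (Y.act p u) = Y.act p (Y.act (pY t) u)"
    by (simp add: mult.commute flip: Y.act_mult)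
  moreover have "Y.act (pY t) (X.act p u) = X.act p (Y.act (pY t) u)"
    "X.act (pX t) (Y.act p u) = Y.act p (X.act (pX t) u)"
    by (simp_all only: actX_actY)
  moreover have "u \<in> W" "X.act (pX t) u = 0" "Y.act (pY t) u = 0" using u by (simp_all add: part_def)
  ultimately show "X.act p u \<in> part t" "Y.act p u \<in> part t"
    unfolding part_def by (simp_all only: mem_Collect_eq X.act_closed Y.act_closed X.act_zero_right Y.act_zero_right simp_thms)
qed

text \<open>Here the two fields meet: the kernels on the left are spaces over the larger field,
  those on the right only over the smaller one, and the trace matches their elements.\<close>

lemma card_kernel_part:
  "card {u \<in> part 0. X.act (map_poly \<iota> p) u = 0} = card {v \<in> W0. X.act (map_poly \<iota> p) v = 0}"
  "card {u \<in> part 0. Y.act (map_poly \<iota> p) u = 0} = card {v \<in> W0. Y.act (map_poly \<iota> p) v = 0}"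
proof -
  have inj: "inj_on trace (part 0)" and img: "trace ` part 0 = W0"
    using trace_bij by (auto simp: bij_betw_def)
  have t0: "trace u = 0 \<longleftrightarrow> u = 0" if "u \<in> part 0" for u
  proof -
    have "trace 0 = 0" using trace_act(1)[of 0 0] by (simp only: map_poly_0 X.act_0)
    thus ?thesis using inj_onD[OF inj _ that zero_part] by auto
  qed
  have "X.act (map_poly \<iota> p) (trace u) = 0 \<longleftrightarrow> X.act (map_poly \<iota> p) u = 0" if "u \<in> part 0" for u
    unfolding trace_act(1)[symmetric] by (rule t0[OF act_part(1)[OF that]])
  hence "{v \<in> W0. X.act (map_poly \<iota> p) v = 0} = trace ` {u \<in> part 0. X.act (map_poly \<iota> p) u = 0}"
    unfolding img[symmetric] by blast
  thus "card {u \<in> part 0. X.act (map_poly \<iota> p) u = 0} = card {v \<in> W0. X.act (map_poly \<iota> p) v = 0}"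
    using card_image[OF inj_on_subset[OF inj]] by (metis (no_types, lifting) mem_Collect_eq subsetI)
  have "Y.act (map_poly \<iota> p) (trace u) = 0 \<longleftrightarrow> Y.act (map_poly \<iota> p) u = 0" if "u \<in> part 0" for u
    unfolding trace_act(2)[symmetric] by (rule t0[OF act_part(2)[OF that]])
  hence "{v \<in> W0. Y.act (map_poly \<iota> p) v = 0} = trace ` {u \<in> part 0. Y.act (map_poly \<iota> p) u = 0}"
    unfolding img[symmetric] by blast
  thus "card {u \<in> part 0. Y.act (map_poly \<iota> p) u = 0} = card {v \<in> W0. Y.act (map_poly \<iota> p) v = 0}"
    using card_image[OF inj_on_subset[OF inj]] by (metis (no_types, lifting) mem_Collect_eq subsetI)
qed

lemma finite_module_part:
  "finite_module (fscale id) (X.act p) (part 0)" "finite_module (fscale id) (Y.act p) (part 0)"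
proof -
  have sub: "X.subspace (part 0)"
  proof (rule X.subspaceI)
    fix u v assume "u \<in> part 0" "v \<in> part 0"
    hence "u \<in> W" "v \<in> W" "X.act (pX 0) u = 0" "Y.act (pY 0) u = 0" "X.act (pX 0) v = 0" "Y.act (pY 0) v = 0"
      by (simp_all add: part_def)
    thus "u + v \<in> part 0" unfolding part_def
      by (simp only: mem_Collect_eq X.act_add_right Y.act_add_right X.subspace_add[OF X.V_subspace] simp_thms add_0_left)
  next
    fix a u assume "u \<in> part 0"
    hence "u \<in> W" "X.act (pX 0) u = 0" "Y.act (pY 0) u = 0" by (simp_all add: part_def)
    thus "fscale id a u \<in> part 0" unfolding part_def
      by (simp only: mem_Collect_eq X.act_scale_right Y.act_scale_right X.subspace_scale[OF X.V_subspace] simp_thms X.scale_zero_right)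
  qed (rule zero_part)
  have fin: "finite (part 0)" by (rule finite_subset[OF _ X.V_finite]) (auto simp: part_def)
  show "finite_module (fscale id) (X.act p) (part 0)"
    by (intro finite_module.intro operator.intro operator_axioms.intro finite_module_axioms.intro
        vector_space_fscale field_hom_id X.act_add_right X.act_scale_right sub fin act_part)
  show "finite_module (fscale id) (Y.act p) (part 0)"
    by (intro finite_module.intro operator.intro operator_axioms.intro finite_module_axioms.intro
        vector_space_fscale field_hom_id Y.act_add_right Y.act_scale_right sub fin act_part)
qed

lemma act_funpow: "(X.act p ^^ r) v = X.act (p ^ r) v" "(Y.act p ^^ r) v = Y.act (p ^ r) v"
  by (induction r) (simp_all add: X.act_mult Y.act_mult)

theorem ex_commuting_nilpotents:
  "\<exists>M1 M2 :: 'b mat. \<exists>\<nu>1 \<nu>2. commuting_mats M1 M2 \<and>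
    is_partition \<nu>1 \<and> M1 \<in> nilpotent_class \<nu>1 \<and>
    (\<forall>r. card {v \<in> W0. operator.act (fscale \<iota>) opX (f ^ r) v = 0} = CARD('b) ^ conj_sum (mset \<nu>1) r) \<and>
    is_partition \<nu>2 \<and> M2 \<in> nilpotent_class \<nu>2 \<and>
    (\<forall>r. card {v \<in> W0. operator.act (fscale \<iota>) opY (g ^ r) v = 0} = CARD('b) ^ conj_sum (mset \<nu>2) r)"
proof -
  let ?F = "map_poly \<iota> f" and ?G = "map_poly \<iota> g"
  note fmX = finite_module_part(1)[of ?F] and fmY = finite_module_part(2)[of ?G]
  \<comment> \<open>Both operators get their matrices from the same coordinate map, so that the
    matrices commute as the operators do.\<close>
  obtain m \<rho> where \<rho>: "X.coord_map (part 0) m \<rho>"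
    using finite_module.coord_map_exists[OF fmX] by blast
  obtain M1 where M1: "matrix_rep (fscale id) (X.act ?F) (part 0) m M1 \<rho>"
    using finite_module.matrix_rep_exists[OF fmX \<rho>] by blast
  obtain M2 where M2: "matrix_rep (fscale id) (Y.act ?G) (part 0) m M2 \<rho>"
    using finite_module.matrix_rep_exists[OF fmY \<rho>] by blast
  have "M1 * M2 = M2 * M1" by (rule matrix_reps_commute[OF M1 M2 actX_actY])
  hence comm: "commuting_mats M1 M2"
    using matrix_rep.M[OF M1] matrix_rep.M[OF M2] unfolding commuting_mats_def by blast
  have "(X.act ?F ^^ N) v = 0" "(Y.act ?G ^^ N) v = 0" if "v \<in> part 0" for v
    unfolding act_funpow using nilpotent_W part_W[OF that] by blast+
  then obtain \<nu>1 \<nu>2 where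
    \<nu>1: "is_partition \<nu>1" "M1 \<in> nilpotent_class \<nu>1"
      "\<forall>r. card {v \<in> part 0. (X.act ?F ^^ r) v = 0} = CARD('b) ^ conj_sum (mset \<nu>1) r" and
    \<nu>2: "is_partition \<nu>2" "M2 \<in> nilpotent_class \<nu>2"
      "\<forall>r. card {v \<in> part 0. (Y.act ?G ^^ r) v = 0} = CARD('b) ^ conj_sum (mset \<nu>2) r"
    using finite_module.nilpotent_class_exists[OF fmX M1, of N]
      finite_module.nilpotent_class_exists[OF fmY M2, of N] by blast
  have "card {v \<in> W0. operator.act (fscale \<iota>) opX (f ^ r) v = 0} = CARD('b) ^ conj_sum (mset \<nu>1) r" for r
    using \<nu>1(3) card_kernel_part(1)[of "f ^ r"] by (simp add: act_funpow act_base P.hom_power)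
  moreover have "card {v \<in> W0. operator.act (fscale \<iota>) opY (g ^ r) v = 0} = CARD('b) ^ conj_sum (mset \<nu>2) r" for r
    using \<nu>2(3) card_kernel_part(2)[of "g ^ r"] by (simp add: act_funpow act_base P.hom_power)
  ultimately show ?thesis using comm \<nu>1(1,2) \<nu>2(1,2) by blast
qed

end

section \<open>Restriction of scalars\<close>

context finite_field_ext
begin

text \<open>\<open>\<kappa>\<close> is general because the same map is needed over the larger field,
  where \<open>f\<close> splits, and over the smaller one, where the type is read off.\<close>

lemma operator_shifted: "field_hom (\<kappa> :: 'c::field \<Rightarrow> 'b) \<Longrightarrow> operator (fscale \<kappa>) (\<lambda>v. fscale id z v + mat_op m M v)"
proof (intro operator.intro operator_axioms.intro vector_space_fscale)
  fix x y :: "nat \<Rightarrow> 'b" and a :: 'c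
  show "fscale id z (x + y) + mat_op m M (x + y)
      = (fscale id z x + mat_op m M x) + (fscale id z y + mat_op m M y)"
    by (simp add: mat_op_add) (simp add: fscale_def fun_eq_iff distrib_left add_ac)
  show "fscale id z (fscale \<kappa> a x) + mat_op m M (fscale \<kappa> a x)
      = fscale \<kappa> a (fscale id z x + mat_op m M x)"
    unfolding mat_op_fscale by (simp add: fscale_def fun_eq_iff distrib_left mult_ac)
qed

lemma finite_module_shifted:
  fixes z :: 'b
  shows "finite_module (fscale \<iota>) (\<lambda>v. fscale id z v + mat_op m M v) (fvecs m UNIV)"
proof (intro finite_module.intro finite_module_axioms.intro operator_shifted hom_embedding finite_fvecs)
  interpret vector_space "fscale \<iota>" by (rule vector_space_fscale[OF hom_embedding])
  show "subspace (fvecs m UNIV)"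
    by (rule subspaceI) (auto simp: fvecs_def fscale_def)
qed (auto simp: fvecs_def fscale_def mat_op_def)

text \<open>Over the larger field \<open>f = (x - z) u\<close> with \<open>u\<close> coprime to
  \<open>x - z\<close>. The factor \<open>x - z\<close> acts as the nilpotent \<open>M\<close>, so
  \<open>u\<close> acts injectively, and the kernels of \<open>f^r\<close> and of \<open>M^r\<close>
  agree. A kernel with \<open>CARD('b)^k\<close> elements has
  \<open>CARD('a)^(deg f * e * k)\<close> elements, which is what \<open>e\<close> copies of the
  partition of \<open>M\<close> predict.\<close>

lemma has_primary_type_shifted:
  assumes N: "M \<in> carrier_mat m m" "M \<in> nilpotent_class \<nu>'"
    and f: "irreducible f" "monic f" "conjugate_roots f z"
    and l: "l = degree f * e" and \<nu>: "is_partition \<nu>" "mset \<nu> = repeat_mset e (mset \<nu>')"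
    and rep: "matrix_rep (fscale \<iota>) (\<lambda>v. fscale id z v + mat_op m M v) (fvecs m UNIV) n T \<rho>"
  shows "has_primary_type T (degree f, \<nu>)"
proof -
  let ?A = "\<lambda>v. fscale id z v + mat_op m M v" and ?W = "fvecs m (UNIV :: 'b set)"
  interpret E: operator "fscale id" ?A by (rule operator_shifted[OF field_hom_id])
  have repN: "matrix_rep (fscale id) (mat_op m M) ?W m M (fvec id m)"
    using matrix_rep_fvec[OF field_hom_id N(1)] by (simp add: map_mat_id)
  have fmN: "finite_module (fscale id) (mat_op m M) ?W" using repN by (simp add: matrix_rep_def)
  have m: "m = sum_list \<nu>'" by (rule card_kernel_nilpotent_class(1)[OF N(2,1)])
  have ker: "card {v \<in> ?W. (mat_op m M ^^ r) v = 0} = CARD('b) ^ conj_sum (mset \<nu>') r" for r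
    unfolding matrix_rep.card_kernel_pow[OF repN] by (rule card_kernel_nilpotent_class(2)[OF N(2,1)])
  have cardW: "card ?W = CARD('b) ^ m"
    by (rule finite_module.coord_map_card[OF fmN matrix_rep.coord_map[OF repN]])
  have "k \<le> sum_list \<nu>'" if "k \<in> set \<nu>'" for k using that member_le_sum_list by blast
  hence "conj_sum (mset \<nu>') m = m"
    using conj_sum_eventually[of "mset \<nu>'" m] by (simp add: m sum_mset_sum_list)
  hence "card {v \<in> ?W. (mat_op m M ^^ m) v = 0} = card ?W" using ker cardW by simp
  hence "{v \<in> ?W. (mat_op m M ^^ m) v = 0} = ?W" by (intro card_subset_eq finite_fvecs) auto
  hence nil: "(mat_op m M ^^ m) v = 0" if "v \<in> ?W" for v using that by blast
  let ?L = "\<lambda>i. [:- (z ^ (CARD('a) ^ i)), 1:]"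
  have "mat_op m M 0 = 0" by (simp add: mat_op_def fun_eq_iff)
  hence actL: "E.act (?L 0) v = mat_op m M v" for v
    by (simp add: E.act_pCons)
  have actLr: "E.act (?L 0 ^ r) v = (mat_op m M ^^ r) v" for r v
  proof (induction r)
    case 0
    show ?case unfolding power_0[of "?L 0"] E.act_1 funpow_0 ..
  next
    case (Suc r)
    show ?case unfolding power_Suc[of "?L 0"] E.act_mult Suc actL funpow.simps(2) comp_apply ..
  qed
  have "degree f > 0" using f(1) by (metis is_unit_iff_degree irreducible_def neq0_conv)
  then obtain c' where c': "degree f = Suc c'" by (metis gr0_conv_Suc)
  define u where "u = (\<Prod>i<c'. ?L (Suc i))"
  have F: "map_poly \<iota> f = ?L 0 * u"
    using f(3) unfolding conjugate_roots_def c' u_def by (simp only: prod.lessThan_Suc_shift)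
  have "coprime (?L 0) (?L (Suc i))" if "i < c'" for i
  proof (rule coprime_linear)
    have "inj_on (\<lambda>i. z ^ (CARD('a) ^ i)) {..<Suc c'}" using f(3) by (simp add: conjugate_roots_def c')
    thus "z ^ (CARD('a) ^ 0) \<noteq> z ^ (CARD('a) ^ Suc i)"
      using that inj_onD[of _ "{..<Suc c'}" 0 "Suc i"] by blast
  qed
  hence "coprime (?L 0) u" unfolding u_def by (intro field_poly_coprime_prod) simp
  hence cop: "coprime (?L 0 ^ a) (u ^ b)" for a b by (rule field_poly_coprime_power)
  have kerF: "E.act (map_poly \<iota> f ^ r) v = 0 \<longleftrightarrow> (mat_op m M ^^ r) v = 0" if v: "v \<in> ?W" for r v
  proof
    assume "(mat_op m M ^^ r) v = 0"
    hence "E.act (?L 0 ^ r) v = 0" unfolding actLr .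
    thus "E.act (map_poly \<iota> f ^ r) v = 0"
      unfolding F power_mult_distrib by (rule E.act_dvd_eq_0[OF dvd_triv_left])
  next
    assume "E.act (map_poly \<iota> f ^ r) v = 0"
    hence "E.act (u ^ r) (E.act (?L 0 ^ r) v) = 0"
      unfolding F power_mult_distrib by (simp only: E.act_mult[symmetric] mult.commute)
    \<comment> \<open>The vector is now killed by \<open>u^r\<close> and by a power of
      \<open>x - z\<close>, two coprime polynomials, and so it is 0.\<close>
    moreover have "E.act (?L 0 ^ m) (E.act (?L 0 ^ r) v) = 0"
    proof -
      have "E.act (?L 0 ^ m) (E.act (?L 0 ^ r) v) = E.act (?L 0 ^ r) (E.act (?L 0 ^ m) v)"
        by (simp only: E.act_mult[symmetric] mult.commute)
      also have "\<dots> = 0" unfolding actLr[of m] nil[OF v] by (rule E.act_zero_right)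
      finally show ?thesis .
    qed
    ultimately have "E.act (?L 0 ^ r) v = 0" using E.act_coprime_eq_0[OF cop] by blast
    thus "(mat_op m M ^^ r) v = 0" unfolding actLr .
  qed
  have base: "operator.act (fscale \<iota>) ?A (f ^ r) v = E.act (map_poly \<iota> f ^ r) v" for r v
  proof -
    have "operator.act (fscale \<iota>) ?A (f ^ r) v = E.act (map_poly \<iota> (f ^ r)) v"
      by (rule E.act_map_poly, rule hom_embedding, rule operator_shifted[OF hom_embedding]) (simp add: fscale_def)
    thus ?thesis by (simp only: P.hom_power)
  qed
  have conj: "conj_sum (mset \<nu>) r = e * conj_sum (mset \<nu>') r" for r
    unfolding \<nu>(2) by (rule conj_sum_repeat)
  have "card {v \<in> ?W. operator.act (fscale \<iota>) ?A (f ^ r) v = 0} = CARD('a) ^ (degree f * conj_sum (mset \<nu>) r)" for r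
  proof -
    have "{v \<in> ?W. operator.act (fscale \<iota>) ?A (f ^ r) v = 0} = {v \<in> ?W. (mat_op m M ^^ r) v = 0}"
      unfolding base using kerF by blast
    hence "card {v \<in> ?W. operator.act (fscale \<iota>) ?A (f ^ r) v = 0} = CARD('b) ^ conj_sum (mset \<nu>') r"
      by (simp only: ker)
    also have "\<dots> = CARD('a) ^ (degree f * conj_sum (mset \<nu>) r)"
      by (simp only: card_ext l conj mult.assoc flip: power_mult)
    finally show ?thesis .
  qed
  moreover have "card ?W = CARD('a) ^ (degree f * sum_list \<nu>)"
  proof -
    have "sum_mset (repeat_mset e K) = e * sum_mset K" for K :: "nat multiset"
    proof (induction e)
      case (Suc e)
      have "repeat_mset (Suc e) K = K + repeat_mset e K" by (rule multiset_eqI) simp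
      thus ?case by (simp only: sum_mset.union mult_Suc Suc.IH)
    qed simp
    hence "sum_list \<nu> = e * m" using arg_cong[OF \<nu>(2), of sum_mset] by (simp only: sum_mset_sum_list m)
    thus ?thesis by (simp only: cardW card_ext l mult.assoc flip: power_mult)
  qed
  ultimately show ?thesis
    unfolding matrix_rep.has_primary_type_iff_card[OF rep \<nu>(1)] using f(1,2) by blast
qed

lemma types_commute_if_nilpotent:
  assumes pos: "c > 0" "d > 0" and l: "l = lcm c d" "l = c * e" "l = d * e'"
    and comm: "classes_commute (nilpotent_class \<nu>1 :: 'b mat set) (nilpotent_class \<nu>2)"
    and lam: "is_partition lam" "mset lam = repeat_mset e (mset \<nu>1)"
    and mu: "is_partition mu" "mset mu = repeat_mset e' (mset \<nu>2)"
  shows "types_commute TYPE('a) (c, lam) (d, mu)"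
proof -
  obtain N1 N2 :: "'b mat" and m where N: "N1 \<in> nilpotent_class \<nu>1" "N2 \<in> nilpotent_class \<nu>2"
    "N1 \<in> carrier_mat m m" "N2 \<in> carrier_mat m m" "N1 * N2 = N2 * N1"
    using comm unfolding classes_commute_def commuting_mats_def by blast
  obtain f :: "'a poly" where f: "irreducible f" "monic f" "degree f = c"
    using ex_irreducible_of_degree[OF pos(1)] l(1) by auto
  obtain g :: "'a poly" where g: "irreducible g" "monic g" "degree g = d"
    using ex_irreducible_of_degree[OF pos(2)] l(1) by auto
  obtain x where x: "conjugate_roots f x" using ex_conjugate_roots[OF f(1,2)] f(3) l(1) by auto
  obtain y where y: "conjugate_roots g y" using ex_conjugate_roots[OF g(1,2)] g(3) l(1) by auto
  let ?A = "\<lambda>v. fscale id x v + mat_op m N1 v" and ?B = "\<lambda>v. fscale id y v + mat_op m N2 v"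
  let ?W = "fvecs m (UNIV :: 'b set)"
  obtain n \<rho> where \<rho>: "vector_space.coord_map (fscale \<iota>) ?W n \<rho>"
    using finite_module.coord_map_exists[OF finite_module_shifted] by blast
  obtain S where S: "matrix_rep (fscale \<iota>) ?A ?W n S \<rho>"
    using finite_module.matrix_rep_exists[OF finite_module_shifted \<rho>] by blast
  obtain T where T: "matrix_rep (fscale \<iota>) ?B ?W n T \<rho>"
    using finite_module.matrix_rep_exists[OF finite_module_shifted \<rho>] by blast
  have "?A (?B v) = ?B (?A v)" for v
  proof -
    have "mat_op m N1 (mat_op m N2 v) = mat_op m N2 (mat_op m N1 v)"
      using N by (simp add: mat_op_mult)
    thus ?thesis
      unfolding mat_op_add mat_op_fscale by (simp add: fscale_def fun_eq_iff distrib_left mult_ac add_ac)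
  qed
  hence "S * T = T * S" by (rule matrix_reps_commute[OF S T])
  moreover have "has_primary_type S (c, lam)"
    using has_primary_type_shifted[OF N(3,1) f(1,2) x _ lam S] l(2) f(3) by simp
  moreover have "has_primary_type T (d, mu)"
    using has_primary_type_shifted[OF N(4,2) g(1,2) y _ mu T] l(3) g(3) by simp
  ultimately show ?thesis
    using matrix_rep.M[OF S] matrix_rep.M[OF T] unfolding types_commute_def commuting_mats_def by blast
qed

lemma nilpotent_if_types_commute:
  assumes pos: "c > 0" "d > 0" and l: "l = lcm c d" "l = c * e" "l = d * e'"
    and lam: "is_partition lam" and mu: "is_partition mu"
    and comm: "types_commute TYPE('a) (c, lam) (d, mu)"
  shows "\<exists>\<nu>1 \<nu>2. is_partition \<nu>1 \<and> is_partition \<nu>2 \<and> lam = partition_times e \<nu>1 \<and> mu = partition_times e' \<nu>2 \<and>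
    classes_commute (nilpotent_class \<nu>1 :: 'b mat set) (nilpotent_class \<nu>2)"
proof -
  obtain X Y :: "'a mat" and n where XY: "has_primary_type X (c, lam)" "has_primary_type Y (d, mu)"
    "X \<in> carrier_mat n n" "Y \<in> carrier_mat n n" "X * Y = Y * X"
    using comm unfolding types_commute_def commuting_mats_def by blast
  let ?W0 = "fvecs n (range \<iota>)" and ?X = "mat_op n (map_mat \<iota> X)" and ?Y = "mat_op n (map_mat \<iota> Y)"
  let ?actX = "operator.act (fscale \<iota>) ?X" and ?actY = "operator.act (fscale \<iota>) ?Y"
  note rX = matrix_rep_fvec[OF hom_embedding XY(3)] and rY = matrix_rep_fvec[OF hom_embedding XY(4)]
  obtain f where f: "monic f" "irreducible f" "degree f = c"
    "\<And>r. card {v \<in> ?W0. ?actX (f ^ r) v = 0} = CARD('a) ^ (c * conj_sum (mset lam) r)"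
    "\<And>v. v \<in> ?W0 \<Longrightarrow> ?actX (f ^ sum_list lam) v = 0"
    using matrix_rep.has_primary_typeD[OF rX XY(1) lam] by blast
  obtain g where g: "monic g" "irreducible g" "degree g = d"
    "\<And>r. card {v \<in> ?W0. ?actY (g ^ r) v = 0} = CARD('a) ^ (d * conj_sum (mset mu) r)"
    "\<And>v. v \<in> ?W0 \<Longrightarrow> ?actY (g ^ sum_list mu) v = 0"
    using matrix_rep.has_primary_typeD[OF rY XY(2) mu] by blast
  obtain x where x: "conjugate_roots f x" using ex_conjugate_roots[OF f(2,1)] f(3) l(1) by auto
  obtain y where y: "conjugate_roots g y" using ex_conjugate_roots[OF g(2,1)] g(3) l(1) by auto
  \<comment> \<open>The sum of the two sizes is one exponent large enough for both
    \<open>f(X)\<close> and \<open>g(Y)\<close>.\<close>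
  have "commuting_pair \<iota> l n (sum_list lam + sum_list mu) X Y f g x y"
  proof (intro commuting_pair.intro finite_field_ext_axioms commuting_pair_axioms.intro XY(3-5) x y)
    show "0 < degree f" "0 < degree g" "l = lcm (degree f) (degree g)" using pos l f g by auto
    fix v assume v: "v \<in> ?W0"
    have oX: "operator (fscale \<iota>) ?X" and oY: "operator (fscale \<iota>) ?Y"
      by (rule operator_mat_op[OF hom_embedding])+
    show "?actX (f ^ (sum_list lam + sum_list mu)) v = 0"
      by (rule operator.act_dvd_eq_0[OF oX le_imp_power_dvd f(5)[OF v]]) simp
    show "?actY (g ^ (sum_list lam + sum_list mu)) v = 0"
      by (rule operator.act_dvd_eq_0[OF oY le_imp_power_dvd g(5)[OF v]]) simp
  qed
  from commuting_pair.ex_commuting_nilpotents[OF this] obtain M1 M2 :: "'b mat" and \<nu>1 \<nu>2 where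
    M: "commuting_mats M1 M2" and
    \<nu>1: "is_partition \<nu>1" "M1 \<in> nilpotent_class \<nu>1"
      "\<forall>r. card {v \<in> ?W0. ?actX (f ^ r) v = 0} = CARD('b) ^ conj_sum (mset \<nu>1) r" and
    \<nu>2: "is_partition \<nu>2" "M2 \<in> nilpotent_class \<nu>2"
      "\<forall>r. card {v \<in> ?W0. ?actY (g ^ r) v = 0} = CARD('b) ^ conj_sum (mset \<nu>2) r"
    by blast
  \<comment> \<open>Comparing exponents of \<open>CARD('a)\<close>, where \<open>CARD('b)\<close>
    contributes \<open>l = b * a\<close>, and cancelling \<open>b\<close> shows that the nullities
    for \<open>\<mu>\<close> are \<open>a\<close> times those for \<open>\<nu>\<close>. By
    \<open>conj_sum_eq_imp\<close> the same then holds for the multiplicities of the parts.\<close>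
  have times: "\<mu> = partition_times a \<nu>"
    if "is_partition \<mu>" "is_partition \<nu>" "b > 0" "l = b * a"
      "\<And>r. CARD('a) ^ (b * conj_sum (mset \<mu>) r) = CARD('b) ^ conj_sum (mset \<nu>) r" for \<mu> \<nu> a b
  proof -
    have "a * conj_sum (mset \<nu>) r = 1 * conj_sum (mset \<mu>) r" for r
    proof -
      have "CARD('a) ^ (b * conj_sum (mset \<mu>) r) = CARD('a) ^ (b * (a * conj_sum (mset \<nu>) r))"
        unfolding that(5) card_ext that(4) by (simp add: mult.assoc flip: power_mult)
      hence "b * conj_sum (mset \<mu>) r = b * (a * conj_sum (mset \<nu>) r)"
        by (rule power_inject_exp[OF q_gt_1, THEN iffD1])
      thus ?thesis using that(3) by simp
    qed
    hence "repeat_mset a (mset \<nu>) = repeat_mset 1 (mset \<mu>)"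
      using that(1,2) by (intro conj_sum_eq_imp) (auto simp: is_partition_def)
    hence "mset \<mu> = mset (partition_times a \<nu>)" by (simp add: mset_partition_times)
    thus ?thesis using that(1) is_partition_times[OF that(2)] by (intro is_partition_mset_eqD)
  qed
  have "lam = partition_times e \<nu>1"
    by (rule times[OF lam \<nu>1(1) pos(1) l(2)]) (use f(4) \<nu>1(3) in simp)
  moreover have "mu = partition_times e' \<nu>2"
    by (rule times[OF mu \<nu>2(1) pos(2) l(3)]) (use g(4) \<nu>2(3) in simp)
  moreover have "classes_commute (nilpotent_class \<nu>1 :: 'b mat set) (nilpotent_class \<nu>2)"
    using M \<nu>1(2) \<nu>2(2) unfolding classes_commute_def by blast
  ultimately show ?thesis using \<nu>1(1) \<nu>2(1) by blast
qed

end

theorem theorem2p10: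
  fixes c d h l :: nat and lam mu :: "nat list"
  assumes "0 < c" and "0 < d"
    and "is_partition lam" and "is_partition mu"
    and "type_dim (c, lam) = type_dim (d, mu)"
    and "h = gcd c d" and "l = lcm c d"
    and "CARD('b::finite_field) = CARD('a::finite_field) ^ l"
  shows "types_commute TYPE('a) (c, lam) (d, mu) \<longleftrightarrow>
    partition_divisible (d div h) lam \<and> partition_divisible (c div h) mu \<and>
    classes_commute (nilpotent_class (partition_frac h d lam) :: 'b mat set)
      (nilpotent_class (partition_frac h c mu))"
proof -
  obtain \<iota> :: "'a \<Rightarrow> 'b" where "field_hom \<iota>" using finite_field_embedding[OF assms(8)] by blast
  then interpret finite_field_ext \<iota> l
    using assms(8) by (intro finite_field_ext.intro finite_field_ext_axioms.intro)
  have h: "h > 0" "h dvd c" "h dvd d" using assms by simp_all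
  have "h * l = c * d" using assms(6,7) by (simp add: prod_gcd_lcm_nat[symmetric] mult.commute)
  hence "h * l = h * (c * (d div h))" "h * l = h * (d * (c div h))" using h by (auto elim!: dvdE)
  hence l: "l = c * (d div h)" "l = d * (c div h)" using h(1) by simp_all
  note frac = partition_frac_times[OF _ h(1,3) assms(2)] partition_frac_times[OF _ h(1,2) assms(1)]
  show ?thesis
  proof
    assume "types_commute TYPE('a) (c, lam) (d, mu)"
    from nilpotent_if_types_commute[OF assms(1,2,7) l assms(3,4) this] obtain \<nu>1 \<nu>2 where
      \<nu>: "is_partition \<nu>1" "is_partition \<nu>2" "lam = partition_times (d div h) \<nu>1"
      "mu = partition_times (c div h) \<nu>2"
      "classes_commute (nilpotent_class \<nu>1 :: 'b mat set) (nilpotent_class \<nu>2)" by blast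
    thus "partition_divisible (d div h) lam \<and> partition_divisible (c div h) mu \<and>
      classes_commute (nilpotent_class (partition_frac h d lam) :: 'b mat set)
        (nilpotent_class (partition_frac h c mu))"
      using frac(1)[OF \<nu>(1)] frac(2)[OF \<nu>(2)] unfolding partition_divisible_def by auto
  next
    assume R: "partition_divisible (d div h) lam \<and> partition_divisible (c div h) mu \<and>
      classes_commute (nilpotent_class (partition_frac h d lam) :: 'b mat set)
        (nilpotent_class (partition_frac h c mu))"
    then obtain \<nu>1 \<nu>2 where \<nu>: "is_partition \<nu>1" "is_partition \<nu>2"
      "lam = partition_times (d div h) \<nu>1" "mu = partition_times (c div h) \<nu>2"
      unfolding partition_divisible_def by blast
    have "classes_commute (nilpotent_class \<nu>1 :: 'b mat set) (nilpotent_class \<nu>2)"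
      using R unfolding \<nu>(3,4) frac(1)[OF \<nu>(1)] frac(2)[OF \<nu>(2)] by blast
    thus "types_commute TYPE('a) (c, lam) (d, mu)"
      by (rule types_commute_if_nilpotent[OF assms(1,2,7) l _ assms(3) _ assms(4)])
        (simp_all add: \<nu>(3,4) mset_partition_times)
  qed
qed

end
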